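(* Let $m\geq n\geq 1$ be integers, and consider the following four assertions about the pair $(n,m)$. 1) For every collection of vectors $v_1,\dots,v_m\in\mathbb{R}^n$, the zonotope volume polynomial $f(x)=\left|\sum_{i=1}^m x_i[0,v_i]\right|$ is a Rayleigh polynomial. 2) For every collection of vectors $v_1,\dots,v_m\in\mathbb{R}^n$, the inequality $|A|\,|A+B+C|\leq |A+B|\,|A+C|$ holds for all zonotopes $A,B,C$ generated by $v_1,\dots,v_m$. 3) For every collection of vectors $v_1,\dots,v_{m-1}\in\mathbb{R}^n$, the inequality $$\frac{|A|}{|P_{u^\perp}A|_{n-1}}\leq\frac{|A+B|}{|P_{u^\perp}(A+B)|_{n-1}}$$ holds for all zonotopes $A,B$ generated by $v_1,\dots,v_{m-1}$ with $A$ full-dimensional, and every $u\in\mathbb{S}^{n-1}$. 4) For every collection of vectors $v_1,\dots,v_{m-2}\in\mathbb{R}^n$, the inequality $$|A|\,|P_{\{u,v\}^\perp}A|_{n-2}\leq |P_{u^\perp}A|_{n-1}\,|P_{v^\perp}A|_{n-1}$$ holds for all zonotopes $A$ generated by $v_1,\dots,v_{m-2}$ and all orthogonal vectors $u,v\in\mathbb{S}^{n-1}$. If $\min\{n,m-n\}\leq 3$, then all four assertions are true. If $\min\{n,m-n\}>3$, then each of the four assertions is false.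
   Context: For vectors $v_1,\dots,v_k\in\mathbb{R}^n$, a zonotope generated by $v_1,\dots,v_k$ is a translate of $\sum_{i=1}^k x_i[0,v_i]$ (Minkowski sum of segments) with coefficients $x_i\geq 0$ (zero coefficients allowed; for $k=0$ it is a point). $|K|$ is $n$-dimensional Lebesgue measure of $K\subset\mathbb{R}^n$; if $K$ lies in a $d$-dimensional affine subspace, $|K|_d$ is its $d$-dimensional Hausdorff measure there (a point has $|\cdot|_0=1$). $P_E$ is the orthogonal projection onto a linear subspace $E$; $u^\perp$ and $\{u,v\}^\perp$ are orthogonal complements. If $n=1$, assertion 4) is vacuous. For $v_1,\dots,v_m\in\mathbb{R}^n$ and $x\in\mathbb{R}_+^m=[0,\infty)^m$, the zonotope volume polynomial is $$f(x)=\Big|\sum_{i=1}^m x_i[0,v_i]\Big|=\sum_{I\subset[m],\,|I|=n}|\det(v_i)_{i\in I}|\prod_{i\in I}x_i,$$ a homogeneous multiaffine polynomial (degree at most one in each variable) with nonnegative coefficients. A homogeneous multiaffine polynomial $f$ in $m$ variables with nonnegative coefficients is called Rayleigh if $\partial_i f(x)\,\partial_j f(x)\geq f(x)\,\partial_{ij}f(x)$ for all $x\in\mathbb{R}_+^m$ and all $i\neq j$, where $\partial_{ij}=\partial_i\partial_j$. *)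

theory Defs
  imports "HOL-Analysis.Analysis"
begin

text \<open>
  Empty covering sets have weight 0 (also for \<open>d = 0\<close>, where \<open>0 ^ 0 = 1\<close>). Boundedness is required
  because \<open>diameter\<close> is meaningful only for bounded sets.
\<close>

definition hausdorff_pre :: "nat \<Rightarrow> real \<Rightarrow> 'a::metric_space set \<Rightarrow> ennreal" where
  "hausdorff_pre d \<delta> S =
     (INF U \<in> {U :: nat \<Rightarrow> 'a set. S \<subseteq> (\<Union>i. U i) \<and> (\<forall>i. bounded (U i) \<and> diameter (U i) \<le> \<delta>)}.
        \<Sum>i. if U i = {} then 0 else ennreal (diameter (U i) ^ d))"

definition hausdorff_unnormalised :: "nat \<Rightarrow> 'a::metric_space set \<Rightarrow> ennreal" where
  "hausdorff_unnormalised d S = (SUP \<delta> \<in> {0<..}. hausdorff_pre d \<delta> S)"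

text \<open>
  A unit cube in a \<open>d\<close>-dimensional coordinate subspace (for \<open>d \<le> DIM('a)\<close>). Any two choices
  of the coordinates are related by an isometry.
\<close>

definition unit_cube :: "nat \<Rightarrow> 'a::euclidean_space set" where
  "unit_cube d = cbox 0 (\<Sum>(SOME D. D \<subseteq> Basis \<and> card D = d))"

text \<open>
  The \<open>d\<close>-dimensional Hausdorff measure in the usual normalisation in which a \<open>d\<close>-dimensional
  unit cube has measure 1, so that it is \<open>d\<close>-dimensional Lebesgue measure on
  \<open>d\<close>-dimensional subspaces (and counting measure for \<open>d = 0\<close>).
\<close>

definition hausdorff :: "nat \<Rightarrow> 'a::euclidean_space set \<Rightarrow> real" where
  "hausdorff d S =
     enn2real (hausdorff_unnormalised d S)
       / enn2real (hausdorff_unnormalised d (unit_cube d :: 'a set))"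

definition orth_proj :: "'a::euclidean_space set \<Rightarrow> 'a \<Rightarrow> 'a" where
  "orth_proj E x = (THE y. y \<in> E \<and> x - y \<in> E\<^sup>\<bottom>)"

abbreviation vol :: "'a::euclidean_space set \<Rightarrow> real" where
  "vol \<equiv> measure lebesgue"

text \<open>
  Collections \<open>v\<^sub>1, \<dots>, v\<^sub>k\<close> are functions on \<open>nat\<close> of which only the values on \<open>{..<k}\<close> are used;
  likewise for points of \<open>[0,\<infinity>)\<^sup>k\<close>. Sums of sets are Minkowski sums.
\<close>

definition nonneg_orthant :: "nat \<Rightarrow> (nat \<Rightarrow> real) set" where
  "nonneg_orthant k = {x. \<forall>i<k. 0 \<le> x i}"

definition segment_sum :: "nat \<Rightarrow> (nat \<Rightarrow> 'a::euclidean_space) \<Rightarrow> (nat \<Rightarrow> real) \<Rightarrow> 'a set" where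
  "segment_sum k v x = (\<Sum>i<k. (\<lambda>w. x i *\<^sub>R w) ` closed_segment 0 (v i))"

definition zonotope :: "nat \<Rightarrow> (nat \<Rightarrow> 'a::euclidean_space) \<Rightarrow> 'a set \<Rightarrow> bool" where
  "zonotope k v Z \<longleftrightarrow> (\<exists>t. \<exists>x \<in> nonneg_orthant k. Z = {t} + segment_sum k v x)"

definition multiaffine :: "nat \<Rightarrow> (nat set \<Rightarrow> real) \<Rightarrow> (nat \<Rightarrow> real) \<Rightarrow> real" where
  "multiaffine m c x = (\<Sum>I \<in> Pow {..<m}. c I * (\<Prod>i\<in>I. x i))"

definition partial_deriv :: "nat \<Rightarrow> ((nat \<Rightarrow> real) \<Rightarrow> real) \<Rightarrow> (nat \<Rightarrow> real) \<Rightarrow> real" where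
  "partial_deriv i p x = deriv (\<lambda>t. p (x(i := t))) (x i)"

definition rayleigh_inequalities :: "nat \<Rightarrow> ((nat \<Rightarrow> real) \<Rightarrow> real) \<Rightarrow> bool" where
  "rayleigh_inequalities m p \<longleftrightarrow>
     (\<forall>x \<in> nonneg_orthant m. \<forall>i<m. \<forall>j<m. i \<noteq> j \<longrightarrow>
        partial_deriv i p x * partial_deriv j p x \<ge> p x * partial_deriv i (partial_deriv j p) x)"

text \<open>
  The function \<open>f\<close> matters only on the nonnegative orthant, where it has to be given by a
  homogeneous multiaffine polynomial with nonnegative coefficients. The coefficients
  \<open>c I\<close>, \<open>I \<subseteq> {..<m}\<close>, are determined by \<open>f\<close>. The derivatives are those of the polynomial, taken
  on the whole space, since \<open>f\<close> itself (a volume) need not be differentiable at the boundary of the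
  orthant.
\<close>

definition rayleigh_polynomial :: "nat \<Rightarrow> ((nat \<Rightarrow> real) \<Rightarrow> real) \<Rightarrow> bool" where
  "rayleigh_polynomial m f \<longleftrightarrow>
     (\<exists>c d. (\<forall>I \<subseteq> {..<m}. 0 \<le> c I) \<and> (\<forall>I \<subseteq> {..<m}. card I \<noteq> d \<longrightarrow> c I = 0) \<and>
        (\<forall>x \<in> nonneg_orthant m. f x = multiaffine m c x) \<and>
        rayleigh_inequalities m (multiaffine m c))"

definition all_volume_polynomials_rayleigh :: "'n::finite itself \<Rightarrow> nat \<Rightarrow> bool" where
  "all_volume_polynomials_rayleigh _ m \<longleftrightarrow>
     (\<forall>v :: nat \<Rightarrow> real^'n. rayleigh_polynomial m (\<lambda>x. vol (segment_sum m v x)))"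

definition sum_volume_inequality :: "'n::finite itself \<Rightarrow> nat \<Rightarrow> bool" where
  "sum_volume_inequality _ m \<longleftrightarrow>
     (\<forall>v :: nat \<Rightarrow> real^'n. \<forall>A B C. zonotope m v A \<longrightarrow> zonotope m v B \<longrightarrow> zonotope m v C \<longrightarrow>
        vol A * vol (A + B + C) \<le> vol (A + B) * vol (A + C))"

definition projection_ratio_inequality :: "'n::finite itself \<Rightarrow> nat \<Rightarrow> bool" where
  "projection_ratio_inequality _ m \<longleftrightarrow>
     (\<forall>v :: nat \<Rightarrow> real^'n. \<forall>A B u. zonotope (m - 1) v A \<longrightarrow> zonotope (m - 1) v B \<longrightarrow>
        aff_dim A = int CARD('n) \<longrightarrow> norm u = 1 \<longrightarrow>
        vol A / hausdorff (CARD('n) - 1) (orth_proj ({u}\<^sup>\<bottom>) ` A)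
          \<le> vol (A + B) / hausdorff (CARD('n) - 1) (orth_proj ({u}\<^sup>\<bottom>) ` (A + B)))"

text \<open>
  The truncated subtractions are harmless: orthogonal unit vectors exist only if
  \<open>CARD('n) \<ge> 2\<close>, and \<open>m \<ge> CARD('n)\<close> in the theorem.
\<close>

definition two_projections_inequality :: "'n::finite itself \<Rightarrow> nat \<Rightarrow> bool" where
  "two_projections_inequality _ m \<longleftrightarrow>
     (\<forall>v :: nat \<Rightarrow> real^'n. \<forall>A u w. zonotope (m - 2) v A \<longrightarrow>
        norm u = 1 \<longrightarrow> norm w = 1 \<longrightarrow> orthogonal u w \<longrightarrow>
        vol A * hausdorff (CARD('n) - 2) (orth_proj ({u, w}\<^sup>\<bottom>) ` A)
          \<le> hausdorff (CARD('n) - 1) (orth_proj ({u}\<^sup>\<bottom>) ` A)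
             * hausdorff (CARD('n) - 1) (orth_proj ({w}\<^sup>\<bottom>) ` A))"

end

theory Submission
  imports Defs
begin

text \<open>
  Lengthening a segment in a Minkowski sum adds sets that are translates of each other, so the volume
  of \<open>\<Sum> x\<^sub>i [0, v\<^sub>i]\<close> is affine in each \<open>x\<^sub>i\<close>; with homogeneity this forces the polynomial formula.
  Write \<open>f = g + x\<^sub>i h\<^sub>i + x\<^sub>j h\<^sub>j + x\<^sub>i x\<^sub>j k\<close>; the Rayleigh inequality at \<open>(i, j)\<close> says \<open>g k \<le> h\<^sub>i h\<^sub>j\<close>.

  If \<open>n = 3\<close>, choose coordinates in which \<open>v\<^sub>i\<close> and \<open>v\<^sub>j\<close> are the first two basis vectors. Then
  \<open>g, h\<^sub>i, h\<^sub>j, k\<close> are weighted sums of absolute minors of one matrix with the three rows \<open>a, b, c\<close>, taken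
  on all rows, on \<open>(b, c)\<close>, on \<open>(a, c)\<close> and on \<open>c\<close>. If \<open>m - n = 3\<close>, the same holds in dual form,
  with \<open>g\<close> and \<open>k\<close> exchanged. After scaling, \<open>c = 1\<close>. The product \<open>h\<^sub>i h\<^sub>j\<close> is additive, and \<open>g k\<close>
  is subadditive, when \<open>a\<close> and \<open>b\<close> are decomposed into indicator functions of their superlevel sets,
  and for two indicator functions \<open>h\<^sub>i h\<^sub>j - g k\<close> is a square.

  The Rayleigh property says that \<open>log f\<close> has nonpositive mixed second derivatives, which integrates
  to assertion 2. Since \<open>|A + [0, u]| = |A| + |P\<^sub>u A|\<close> for unit vectors \<open>u\<close>, assertions 3 and 4 follow by taking
  segments as summands. For large \<open>n\<close> and \<open>m - n\<close> it remains to violate assertion 4, by an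
  explicit example in dimension four multiplied by a unit cube.
\<close>

section \<open>Volumes of sums with segments\<close>

text \<open>The threshold three comes from the row \<open>c\<close>. Once the coordinates belonging
  to \<open>v i\<close> and \<open>v j\<close> are split off, dimension three leaves a single row,
  and scaling the columns makes it constant. Two-row minors then become differences
  \<open>a l - a r\<close>, whose absolute values add exactly over nested superlevel sets; for
  three-row minors there is only the triangle inequality, but it points in the favourable direction.
  In dimension four two rows remain, and column scaling cannot make both constant.

  Since the Hausdorff measure is given by covers and diameters, the proof works with
  full-dimensional volumes wherever it can: a projection along a unit vector is measured by the
  volume gained on adding that unit segment, and a projection along two orthogonal ones by a mixed
  second difference. Hausdorff measure is met only where these increments are identified with it. In
  this form assertion 4 is literally \<open>g k \<le> h h\<close> for two orthonormal vectors, so a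
  configuration violating the Rayleigh inequality at two orthonormal columns violates all four
  assertions.\<close>

abbreviation seg :: "'a::real_vector \<Rightarrow> 'a set" where
  "seg v \<equiv> closed_segment 0 v"

lemma seg_eq: "seg v = (\<lambda>t. t *\<^sub>R v) ` {0..1}"
  by (auto simp: closed_segment_def)

lemma seg_scaleR_eq: "0 \<le> t \<Longrightarrow> seg (t *\<^sub>R v) = (\<lambda>s. s *\<^sub>R v) ` {0..t}"
proof (intro set_eqI iffI)
  fix x assume "0 \<le> t" "x \<in> (\<lambda>s. s *\<^sub>R v) ` {0..t}"
  then obtain s where s: "0 \<le> s" "s \<le> t" "x = s *\<^sub>R v" by auto
  show "x \<in> seg (t *\<^sub>R v)"
  proof (cases "t = 0")
    case False
    then have "x = (s / t) *\<^sub>R (t *\<^sub>R v)" "s / t \<in> {0..1}" using s by auto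
    then show ?thesis unfolding seg_eq by blast
  qed (use s in auto)
qed (auto simp: seg_eq mult_left_le_one_le)

lemma set_plus_mem_iff: "x \<in> A + B \<longleftrightarrow> (\<exists>a\<in>A. \<exists>b\<in>B. x = a + b)"
  by (auto simp: set_plus_def)

lemma seg_plus_seg:
  assumes "0 \<le> s" "0 \<le> t"
  shows "seg (s *\<^sub>R v) + seg (t *\<^sub>R v) = seg ((s + t) *\<^sub>R v)"
proof -
  have "x \<in> (\<lambda>s. s *\<^sub>R v) ` {0..s} + (\<lambda>s. s *\<^sub>R v) ` {0..t}" if "x \<in> (\<lambda>s. s *\<^sub>R v) ` {0..s+t}" for x
  proof -
    from that obtain r where r: "0 \<le> r" "r \<le> s + t" "x = r *\<^sub>R v" by auto
    then have "x = min r s *\<^sub>R v + (r - min r s) *\<^sub>R v" by (simp flip: scaleR_add_left)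
    moreover have "min r s \<in> {0..s}" "r - min r s \<in> {0..t}" using r assms by auto
    ultimately show ?thesis by blast
  qed
  then show ?thesis
    unfolding seg_scaleR_eq[OF assms(1)] seg_scaleR_eq[OF assms(2)] seg_scaleR_eq[OF add_nonneg_nonneg[OF assms]]
    by (intro set_eqI iffI)
      (force simp: set_plus_mem_iff simp flip: scaleR_add_left intro!: image_eqI, blast)
qed

section \<open>Compact convex sets and their volume\<close>

lemma compact_set_plus: "compact (A::'a::real_normed_vector set) \<Longrightarrow> compact B \<Longrightarrow> compact (A + B)"
proof -
  assume "compact A" "compact B"
  moreover have "A + B = {x + y |x y. x \<in> A \<and> y \<in> B}" by (auto simp: set_plus_def)
  ultimately show ?thesis using compact_sums[of A B] by simp
qed

definition convex_body :: "'a::euclidean_space set \<Rightarrow> bool" where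
  "convex_body A \<longleftrightarrow> compact A \<and> convex A \<and> A \<noteq> {}"

lemma convex_body_plus: "convex_body A \<Longrightarrow> convex_body B \<Longrightarrow> convex_body (A + B)"
  using set_plus_intro by (fastforce simp: convex_body_def compact_set_plus convex_set_plus)

lemma convex_body_seg [simp]: "convex_body (seg v)" by (simp add: convex_body_def)
lemma convex_body_singleton [simp]: "convex_body {t}" by (simp add: convex_body_def)

lemma convex_body_sum: "finite I \<Longrightarrow> (\<And>i. i \<in> I \<Longrightarrow> convex_body (f i)) \<Longrightarrow> convex_body (\<Sum>i\<in>I. f i)"
  by (induction I rule: finite_induct) (auto intro: convex_body_plus simp: set_zero)

lemma convex_body_lmeasurable: "convex_body A \<Longrightarrow> A \<in> lmeasurable"
  by (simp add: convex_body_def lmeasurable_compact)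

lemma vol_mono: "A \<subseteq> B \<Longrightarrow> convex_body A \<Longrightarrow> convex_body B \<Longrightarrow> vol A \<le> vol B"
  by (meson convex_body_lmeasurable measure_mono_fmeasurable fmeasurableD)

lemma singleton_plus: "{t} + A = (+) t ` A" by (auto simp: set_plus_def)

lemma vol_translate [simp]: "vol ({t} + A) = vol (A::'a::euclidean_space set)"
  by (simp add: singleton_plus measure_translation)

lemma subset_plus_seg: "A \<subseteq> A + seg v"
  by (metis add.commute ends_in_segment(1) set_zero_plus2)

text \<open>Cauchy's functional equation on the half-line. Nonnegativity makes \<open>f\<close>
  monotone, so \<open>f (k t)\<close> is squeezed between the values at two consecutive integers,
  and the error \<open>k * |f t - t * f 1|\<close> stays below \<open>f 1\<close> for every
  \<open>k\<close>.\<close>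

lemma additive_mono_linear:
  fixes f :: "real \<Rightarrow> real"
  assumes add: "\<And>s t. 0 \<le> s \<Longrightarrow> 0 \<le> t \<Longrightarrow> f (s + t) = f s + f t"
    and nn: "\<And>t. 0 \<le> t \<Longrightarrow> 0 \<le> f t" and t: "0 \<le> t"
  shows "f t = t * f 1"
proof -
  have mono: "f s \<le> f u" if "0 \<le> s" "s \<le> u" for s u
    using add[of s "u - s"] nn[of "u - s"] that by simp
  have f0: "f 0 = 0" using add[of 0 0] by simp
  have mult: "f (real k * s) = real k * f s" if "0 \<le> s" for k s
    by (induction k) (use that add f0 in \<open>auto simp: algebra_simps\<close>)
  have bound: "real k * \<bar>f t - t * f 1\<bar> \<le> f 1" for k
  proof -
    define p where "p = real k * t"
    have p: "0 \<le> p" using t by (simp add: p_def)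
    define q where "q = nat \<lfloor>p\<rfloor>"
    have q: "real q \<le> p" "p \<le> real q + 1" using p by (auto simp: q_def) 
    have "f (real q) \<le> f p" "f p \<le> f (real (Suc q))" using q by (auto intro!: mono p)
    then have "real q * f 1 \<le> f p" "f p \<le> (real q + 1) * f 1"
      using mult[of 1 q] mult[of 1 "Suc q"] by (auto simp: algebra_simps)
    moreover have "real q * f 1 \<le> p * f 1" "p * f 1 \<le> (real q + 1) * f 1"
      using q nn[of 1] by (auto intro!: mult_right_mono)
    ultimately have "\<bar>f p - p * f 1\<bar> \<le> f 1" by (simp add: algebra_simps abs_le_iff)
    moreover have "f p - p * f 1 = real k * (f t - t * f 1)"
      using mult[OF t, of k] by (simp add: p_def algebra_simps)
    ultimately show ?thesis by (simp add: abs_mult)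
  qed
  show ?thesis
  proof (rule ccontr)
    assume "f t \<noteq> t * f 1"
    then have "0 < \<bar>f t - t * f 1\<bar>" by simp
    then obtain k where "f 1 < real k * \<bar>f t - t * f 1\<bar>"
      using reals_Archimedean3 by blast
    then show False using bound[of k] by simp
  qed
qed

text \<open>Along each line parallel to \<open>v\<close>, lengthening the added segment appends an interval of the
  same length beyond \<open>A\<close>; hence the set gained depends on the starting length only by a translation.\<close>
lemma plus_seg_diff:
  assumes A: "convex A" and s: "0 \<le> s" and t: "0 \<le> t"
  shows "(A + seg ((s + t) *\<^sub>R v)) - (A + seg (s *\<^sub>R v)) = (+) (s *\<^sub>R v) ` ((A + seg (t *\<^sub>R v)) - A)"
proof (intro set_eqI iffI)
  fix y assume y: "y \<in> (A + seg ((s + t) *\<^sub>R v)) - (A + seg (s *\<^sub>R v))"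
  then obtain a r where r: "a \<in> A" "0 \<le> r" "r \<le> s + t" "y = a + r *\<^sub>R v"
    using s t by (auto simp: set_plus_mem_iff seg_scaleR_eq)
  have "\<not> r \<le> s"
  proof
    assume "r \<le> s"
    then have "r *\<^sub>R v \<in> seg (s *\<^sub>R v)"
      using r s by (auto simp: seg_scaleR_eq)
    then show False using y r by blast
  qed
  define z where "z = a + (r - s) *\<^sub>R v"
  have yz: "y = s *\<^sub>R v + z" by (simp add: z_def r algebra_simps)
  have "(r - s) *\<^sub>R v \<in> seg (t *\<^sub>R v)" using r t \<open>\<not> r \<le> s\<close> by (auto simp: seg_scaleR_eq)
  then have "z \<in> A + seg (t *\<^sub>R v)" using r by (auto simp: z_def)
  moreover have "z \<notin> A"
  proof
    assume "z \<in> A"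
    then have "y \<in> A + seg (s *\<^sub>R v)"
      using s yz by (auto simp: set_plus_mem_iff seg_scaleR_eq intro!: bexI[of _ z])
    then show False using y by blast
  qed
  ultimately show "y \<in> (+) (s *\<^sub>R v) ` ((A + seg (t *\<^sub>R v)) - A)" using yz by blast
next
  fix y assume "y \<in> (+) (s *\<^sub>R v) ` ((A + seg (t *\<^sub>R v)) - A)"
  then obtain z where z: "y = s *\<^sub>R v + z" "z \<in> A + seg (t *\<^sub>R v)" "z \<notin> A" by auto
  then obtain a r where r: "a \<in> A" "0 \<le> r" "r \<le> t" "z = a + r *\<^sub>R v"
    using t by (auto simp: set_plus_mem_iff seg_scaleR_eq)
  have "y = a + (s + r) *\<^sub>R v" by (simp add: z r algebra_simps)
  moreover have "(s + r) *\<^sub>R v \<in> seg ((s + t) *\<^sub>R v)" using r s t by (auto simp: seg_scaleR_eq)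
  ultimately have "y \<in> A + seg ((s + t) *\<^sub>R v)" using r by auto
  moreover have "y \<notin> A + seg (s *\<^sub>R v)"
  proof
    assume "y \<in> A + seg (s *\<^sub>R v)"
    then obtain a' p where p: "a' \<in> A" "0 \<le> p" "p \<le> s" "y = a' + p *\<^sub>R v"
      using s by (auto simp: set_plus_mem_iff seg_scaleR_eq)
    \<comment> \<open>\<open>z\<close> lies on the segment from \<open>a\<close> to
      \<open>a'\<close>, at the fraction \<open>r / d\<close>, so convexity would put
      \<open>z\<close> into \<open>A\<close>.\<close>
    define d where "d = r + (s - p)"
    have a': "a' = a + d *\<^sub>R v" using p z r by (simp add: d_def algebra_simps)
    show False
    proof (cases "d = 0")
      case True
      then have "r = 0" using r p by (auto simp: d_def)
      then show False using z r by simp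
    next
      case False
      have d: "0 < d" "r \<le> d" using False r p by (auto simp: d_def)
      have "z = (1 - r / d) *\<^sub>R a + (r / d) *\<^sub>R a'"
        using d by (simp add: a' r algebra_simps)
      moreover have "(1 - r / d) *\<^sub>R a + (r / d) *\<^sub>R a' \<in> A"
        using convexD_alt[OF A \<open>a \<in> A\<close> \<open>a' \<in> A\<close>, of "r / d"] d r by auto
      ultimately show False using z by simp
    qed
  qed
  ultimately show "y \<in> (A + seg ((s + t) *\<^sub>R v)) - (A + seg (s *\<^sub>R v))" by blast
qed

text \<open>For a unit vector \<open>v\<close> and a convex body this is the (n-1)-dimensional
  volume of the projection along \<open>v\<close> (\<open>hausdorff_projection_1\<close>). As an
  increment of volume it can be handled without any lower-dimensional measure.\<close>

definition shadow :: "'a::euclidean_space \<Rightarrow> 'a set \<Rightarrow> real" where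
  "shadow v A = vol (A + seg v) - vol A"

text \<open>By \<open>plus_seg_diff\<close> the volume gained is an additive function of the length;
  being nonnegative as well, it is linear.\<close>

lemma vol_plus_seg:
  assumes A: "convex_body A" and t: "0 \<le> t"
  shows "vol (A + seg (t *\<^sub>R v)) = vol A + t * shadow v A"
proof -
  define f where "f t = vol (A + seg (t *\<^sub>R v)) - vol A" for t
  have meas [simp]: "A + seg w \<in> lmeasurable" "A \<in> lmeasurable" for w
    using A by (auto intro!: convex_body_lmeasurable convex_body_plus)
  have f_alt: "f t = vol ((A + seg (t *\<^sub>R v)) - A)" for t
    unfolding f_def by (intro measurable_measure_Diff[symmetric]) (auto simp: fmeasurableD subset_plus_seg)
  have "f t = t * f 1"
  proof (rule additive_mono_linear[OF _ _ t])
    fix s t :: real assume st: "0 \<le> s" "0 \<le> t"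
    have sub: "A + seg (s *\<^sub>R v) \<subseteq> A + seg ((s + t) *\<^sub>R v)"
      using st by (intro set_plus_mono2) (auto simp: seg_scaleR_eq)
    have "f (s + t) - f s = vol ((A + seg ((s + t) *\<^sub>R v)) - (A + seg (s *\<^sub>R v)))"
      unfolding f_def by (subst measurable_measure_Diff) (use sub in \<open>auto simp: fmeasurableD\<close>)
    also have "\<dots> = f t"
      using A st by (subst plus_seg_diff) (auto simp: convex_body_def measure_translation f_alt)
    finally show "f (s + t) = f s + f t" by simp
  qed (simp add: f_alt)
  then show ?thesis by (simp add: f_def shadow_def)
qed

lemma shadow_nonneg: "convex_body A \<Longrightarrow> 0 \<le> shadow v A"
  using vol_mono[OF subset_plus_seg, of A v] by (simp add: shadow_def convex_body_plus)

section \<open>Zonotopes as functions of their coefficients\<close>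

lemma segment_sum_alt: "segment_sum k v x = (\<Sum>i<k. seg (x i *\<^sub>R v i))"
proof -
  have "(\<lambda>w. x i *\<^sub>R w) ` seg (v i) = seg (x i *\<^sub>R v i)" for i
    using closed_segment_linear_image[of "\<lambda>w. x i *\<^sub>R w" 0 "v i"] by (simp add: linear_scaleR)
  then show ?thesis by (simp add: segment_sum_def)
qed

lemma convex_body_segment_sum [simp]: "convex_body (segment_sum k v x)"
  by (auto simp: segment_sum_alt intro: convex_body_sum)

lemma segment_sum_plus:
  assumes "x \<in> nonneg_orthant k" "y \<in> nonneg_orthant k"
  shows "segment_sum k v x + segment_sum k v y = segment_sum k v (\<lambda>i. x i + y i)"
  unfolding segment_sum_alt sum.distrib[symmetric]
  using assms by (intro sum.cong) (auto simp: seg_plus_seg nonneg_orthant_def)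

lemma segment_sum_upd:
  assumes "i < k"
  shows "segment_sum k v (x(i := t)) = segment_sum k v (x(i := 0)) + seg (t *\<^sub>R v i)"
  unfolding segment_sum_alt using assms
  by (subst (1 2) sum.remove[of _ i]) (auto simp: add.commute add.left_commute set_zero intro!: sum.cong)

lemma convex_body_zonotope: "zonotope k v Z \<Longrightarrow> convex_body Z"
  by (auto simp: zonotope_def intro!: convex_body_plus)

section \<open>Multiaffine functions\<close>

lemma sum_Pow_insert:
  assumes "finite A" "a \<notin> A"
  shows "(\<Sum>I\<in>Pow (insert a A). F I) = (\<Sum>I\<in>Pow A. F I + F (insert a I))"
proof -
  have "inj_on (insert a) (Pow A)" using assms by (intro inj_onI) (auto 4 4)
  moreover have "Pow A \<inter> insert a ` Pow A = {}" using assms by auto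
  ultimately show ?thesis using assms
    by (simp add: Pow_insert sum.union_disjoint sum.reindex sum.distrib)
qed

definition subset_poly :: "nat set \<Rightarrow> (nat set \<Rightarrow> real) \<Rightarrow> (nat \<Rightarrow> real) \<Rightarrow> real" where
  "subset_poly A c x = (\<Sum>I\<in>Pow A. c I * (\<Prod>i\<in>I. x i))"

lemma multiaffine_subset_poly: "multiaffine m c x = subset_poly {..<m} c x"
  by (simp add: multiaffine_def subset_poly_def)

lemma subset_poly_insert:
  assumes "finite A" "a \<notin> A"
  shows "subset_poly (insert a A) c x = subset_poly A c x + x a * subset_poly A (\<lambda>I. c (insert a I)) x"
proof -
  have "c (insert a I) * (\<Prod>i\<in>insert a I. x i) = x a * (c (insert a I) * (\<Prod>i\<in>I. x i))" if "I \<in> Pow A" for I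
  proof -
    have "finite I" "a \<notin> I" using that assms finite_subset by auto
    then show ?thesis by simp
  qed
  then have "(\<Sum>I\<in>Pow A. c (insert a I) * (\<Prod>i\<in>insert a I. x i)) = (\<Sum>I\<in>Pow A. x a * (c (insert a I) * (\<Prod>i\<in>I. x i)))"
    by (rule sum.cong[OF refl])
  then show ?thesis
    unfolding subset_poly_def sum_Pow_insert[OF assms] sum.distrib sum_distrib_left by simp
qed

lemma subset_poly_cong:
  "(\<And>I. I \<subseteq> A \<Longrightarrow> c I = d I) \<Longrightarrow> (\<And>i. i \<in> A \<Longrightarrow> x i = y i) \<Longrightarrow> subset_poly A c x = subset_poly A d y"
  unfolding subset_poly_def by (intro sum.cong arg_cong2[of _ _ _ _ "(*)"] prod.cong) auto

lemma subset_poly_nonneg: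
  "(\<And>I. I \<subseteq> A \<Longrightarrow> 0 \<le> c I) \<Longrightarrow> (\<And>i. i \<in> A \<Longrightarrow> 0 \<le> x i) \<Longrightarrow> 0 \<le> subset_poly A c x"
  unfolding subset_poly_def by (intro sum_nonneg mult_nonneg_nonneg prod_nonneg) auto

text \<open>Induction on the variables: as a function of \<open>x a\<close>, \<open>F\<close> is its
  value at 0 plus \<open>x a\<close> times a slope, and both value and slope inherit the hypotheses.
  Everything is confined to the orthant because a volume depends on a negative coefficient through
  its absolute value and is not affine across 0.\<close>

lemma ex_subset_poly:
  assumes "finite A"
    and "\<And>x y. (\<And>i. i \<in> A \<Longrightarrow> x i = y i) \<Longrightarrow> F x = F y"
    and "\<And>x i t. (\<And>j. j \<in> A \<Longrightarrow> 0 \<le> x j) \<Longrightarrow> i \<in> A \<Longrightarrow> 0 \<le> t \<Longrightarrow>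
           F (x(i := t)) = F (x(i := 0)) + t * (F (x(i := 1)) - F (x(i := 0)))"
  shows "\<exists>c. \<forall>x. (\<forall>i\<in>A. 0 \<le> x i) \<longrightarrow> F x = subset_poly A c x"
  using assms
proof (induction A arbitrary: F rule: finite_induct)
  case empty
  have "F x = F (\<lambda>_. 0)" for x using empty(1) by simp
  then show ?case by (intro exI[of _ "\<lambda>_. F (\<lambda>_. 0)"]) (simp add: subset_poly_def)
next
  case (insert a A)
  note dep = insert.prems(1) and aff = insert.prems(2)
  define F0 where "F0 x = F (x(a := 0))" for x
  define F1 where "F1 x = F (x(a := 1)) - F (x(a := 0))" for x
  have "\<exists>c. \<forall>x. (\<forall>i\<in>A. 0 \<le> x i) \<longrightarrow> F0 x = subset_poly A c x"
  proof (rule insert.IH)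
    fix x y :: "nat \<Rightarrow> real" assume "\<And>i. i \<in> A \<Longrightarrow> x i = y i"
    then show "F0 x = F0 y" unfolding F0_def by (intro dep) auto
  next
    fix x :: "nat \<Rightarrow> real" and i t assume *: "\<And>j. j \<in> A \<Longrightarrow> 0 \<le> x j" "i \<in> A" "0 \<le> (t::real)"
    have "i \<noteq> a" using * insert.hyps by auto
    then have tw: "x(i := s, a := r) = x(a := r, i := s)" for s r by (rule fun_upd_twist)
    show "F0 (x(i := t)) = F0 (x(i := 0)) + t * (F0 (x(i := 1)) - F0 (x(i := 0)))"
      unfolding F0_def tw by (rule aff) (use * in auto)
  qed
  then obtain c0 where c0: "\<And>x. (\<forall>i\<in>A. 0 \<le> x i) \<Longrightarrow> F0 x = subset_poly A c0 x" by blast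
  have "\<exists>c. \<forall>x. (\<forall>i\<in>A. 0 \<le> x i) \<longrightarrow> F1 x = subset_poly A c x"
  proof (rule insert.IH)
    fix x y :: "nat \<Rightarrow> real" assume "\<And>i. i \<in> A \<Longrightarrow> x i = y i"
    then show "F1 x = F1 y" unfolding F1_def by (intro arg_cong2[of _ _ _ _ "(-)"] dep) auto
  next
    fix x :: "nat \<Rightarrow> real" and i t assume *: "\<And>j. j \<in> A \<Longrightarrow> 0 \<le> x j" "i \<in> A" "0 \<le> (t::real)"
    have "i \<noteq> a" using * insert.hyps by auto
    then have tw: "x(i := s, a := r) = x(a := r, i := s)" for s r by (rule fun_upd_twist)
    have "F (x(a := r, i := t)) = F (x(a := r, i := 0)) + t * (F (x(a := r, i := 1)) - F (x(a := r, i := 0)))"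
      if "0 \<le> r" for r
      by (rule aff) (use * that in auto)
    from this[of 0] this[of 1]
    show "F1 (x(i := t)) = F1 (x(i := 0)) + t * (F1 (x(i := 1)) - F1 (x(i := 0)))"
      unfolding F1_def tw by (simp add: algebra_simps)
  qed
  then obtain c1 where c1: "\<And>x. (\<forall>i\<in>A. 0 \<le> x i) \<Longrightarrow> F1 x = subset_poly A c1 x" by blast
  define c where "c I = (if a \<in> I then c1 (I - {a}) else c0 I)" for I
  have "F x = subset_poly (insert a A) c x" if x: "\<forall>i\<in>insert a A. 0 \<le> x i" for x
  proof -
    have "F (x(a := x a)) = F0 x + x a * F1 x" unfolding F0_def F1_def by (rule aff) (use x in auto)
    then have "F x = F0 x + x a * F1 x" by simp
    also have "\<dots> = subset_poly A c0 x + x a * subset_poly A c1 x" using c0 c1 x by simp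
    also have "subset_poly A c0 x = subset_poly A c x" using insert.hyps by (intro subset_poly_cong) (auto simp: c_def)
    also have "subset_poly A c1 x = subset_poly A (\<lambda>I. c (insert a I)) x"
    proof (rule subset_poly_cong)
      fix I assume "I \<subseteq> A"
      then have "insert a I - {a} = I" using insert.hyps by auto
      then show "c1 I = c (insert a I)" by (simp add: c_def)
    qed simp
    finally show ?thesis using insert.hyps by (simp add: subset_poly_insert)
  qed
  then show ?case by blast
qed

text \<open>The values at multiples of indicator vectors determine the coefficients by induction
  over subsets. Comparing the multiples 1 and 2 kills \<open>c I\<close> unless
  \<open>card I = d\<close>, so homogeneity under doubling is enough.\<close>

lemma homogeneous_subset_poly:
  assumes fin: "finite A"
    and dep: "\<And>x y. (\<And>i. i \<in> A \<Longrightarrow> x i = y i) \<Longrightarrow> F x = F y"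
    and aff: "\<And>x i t. (\<And>j. j \<in> A \<Longrightarrow> 0 \<le> x j) \<Longrightarrow> i \<in> A \<Longrightarrow> 0 \<le> t \<Longrightarrow>
           F (x(i := t)) = F (x(i := 0)) + t * (F (x(i := 1)) - F (x(i := 0)))"
    and hom: "\<And>x. (\<And>i. i \<in> A \<Longrightarrow> 0 \<le> x i) \<Longrightarrow> F (\<lambda>i. 2 * x i) = 2 ^ d * F x"
    and x: "\<And>i. i \<in> A \<Longrightarrow> 0 \<le> x i"
  shows "F x = subset_poly A (\<lambda>I. if card I = d then F (indicator I) else 0) x"
proof -
  obtain c where c: "\<And>x. (\<forall>i\<in>A. 0 \<le> x i) \<Longrightarrow> F x = subset_poly A c x"
    using ex_subset_poly[of A F] fin dep aff by blast
  have F_ind: "F (\<lambda>i. r * indicator I i) = (\<Sum>J\<in>Pow I. c J * r ^ card J)" if "0 \<le> r" "I \<subseteq> A" for r I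
  proof -
    have "(\<Prod>i\<in>J. r * indicator I i) = (if J \<subseteq> I then r ^ card J else 0)" if "J \<subseteq> A" for J
    proof (cases "J \<subseteq> I")
      case True
      have "(\<Prod>i\<in>J. r * indicator I i) = (\<Prod>i\<in>J. r)"
        using True by (intro prod.cong) (auto simp: indicator_def)
      then show ?thesis using True by simp
    next
      case False
      then obtain j where "j \<in> J" "j \<notin> I" by blast
      then show ?thesis using False that fin finite_subset
        by (auto intro!: prod_zero bexI[of _ j] simp: prod_zero_iff)
    qed
    then have "F (\<lambda>i. r * indicator I i) = (\<Sum>J\<in>Pow A. c J * (if J \<subseteq> I then r ^ card J else 0))"
      using \<open>0 \<le> r\<close> by (subst c) (auto simp: subset_poly_def)
    also have "\<dots> = (\<Sum>J\<in>Pow I. c J * (if J \<subseteq> I then r ^ card J else 0))"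
      using that fin by (intro sum.mono_neutral_right) auto
    also have "\<dots> = (\<Sum>J\<in>Pow I. c J * r ^ card J)" by (intro sum.cong) auto
    finally show ?thesis .
  qed
  have coeff: "c I = (if card I = d then F (indicator I) else 0)" if "I \<subseteq> A" for I
  proof -
    have "finite I" using that fin finite_subset by blast
    then show ?thesis using that
    proof (induction I rule: finite_psubset_induct)
      case (psubset I)
      have fI: "finite (Pow I)" "I \<in> Pow I" using psubset.hyps by auto
      have ex: "F (\<lambda>i. r * indicator I i) = c I * r ^ card I + r ^ d * (\<Sum>J\<in>Pow I - {I}. c J)"
        if "0 \<le> r" for r
      proof -
        have "c J * r ^ card J = r ^ d * c J" if "J \<in> Pow I - {I}" for J
        proof -
          have "J \<subset> I" "J \<subseteq> A" using that psubset.prems by auto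
          then show ?thesis using psubset.IH[of J] by simp
        qed
        then have "(\<Sum>J\<in>Pow I - {I}. c J * r ^ card J) = r ^ d * (\<Sum>J\<in>Pow I - {I}. c J)"
          unfolding sum_distrib_left by (rule sum.cong[OF refl])
        moreover have "(\<Sum>J\<in>Pow I. c J * r ^ card J) = c I * r ^ card I + (\<Sum>J\<in>Pow I - {I}. c J * r ^ card J)"
          by (rule sum.remove[OF fI])
        ultimately show ?thesis using F_ind[OF that psubset.prems] by simp
      qed
      define S where "S = (\<Sum>J\<in>Pow I - {I}. c J)"
      have e1: "F (indicator I) = c I + S" using ex[of 1] by (simp add: S_def)
      show ?case
      proof (cases "card I = d")
        case True
        have "c J = 0" if "J \<in> Pow I - {I}" for J
        proof -
          have J: "J \<subset> I" "J \<subseteq> A" using that psubset.prems by auto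
          have "card J < d" using J(1) True psubset.hyps psubset_card_mono by blast
          then show ?thesis using psubset.IH[of J] J by simp
        qed
        then have "S = 0" by (simp add: S_def)
        then show ?thesis using e1 True by simp
      next
        case False
        have "2 ^ d * F (indicator I) = c I * 2 ^ card I + 2 ^ d * S"
          using ex[of 2] hom[of "indicator I"] by (simp add: S_def)
        then have "c I = 0" using False by (auto simp: e1 algebra_simps)
        then show ?thesis using False by simp
      qed
    qed
  qed
  have "F x = subset_poly A c x" using c x by simp
  also have "\<dots> = subset_poly A (\<lambda>I. if card I = d then F (indicator I) else 0) x"
    using coeff by (intro subset_poly_cong) auto
  finally show ?thesis .
qed

section \<open>The volume polynomial\<close>

lemma segment_sum_cong:
  "(\<And>i. i < k \<Longrightarrow> x i = y i) \<Longrightarrow> segment_sum k v x = segment_sum k v y"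
  unfolding segment_sum_alt by (intro sum.cong) auto

lemma vol_segment_sum_plus_affine:
  assumes K: "convex_body K" and i: "i < m" and t: "0 \<le> t"
  shows "vol (K + segment_sum m v (x(i := t))) = vol (K + segment_sum m v (x(i := 0))) +
    t * (vol (K + segment_sum m v (x(i := 1))) - vol (K + segment_sum m v (x(i := 0))))"
proof -
  let ?B = "K + segment_sum m v (x(i := 0))"
  have B: "convex_body ?B" using K by (simp add: convex_body_plus)
  have eq: "K + segment_sum m v (x(i := s)) = ?B + seg (s *\<^sub>R v i)" for s
    by (simp add: segment_sum_upd[OF i, of v x s] add.assoc)
  show ?thesis
    unfolding eq[of t] eq[of 1] vol_plus_seg[OF B t] using vol_plus_seg[OF B, of 1 "v i"] by simp
qed

text \<open>The fixed body \<open>K\<close> serves two purposes: it is \<open>{0}\<close> for the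
  volume polynomial itself, and the cube factor in the counterexample. The degree depends on
  \<open>K\<close>, so homogeneity is a hypothesis.\<close>

lemma vol_plus_segment_sum_subset_poly:
  assumes K: "convex_body K"
    and hom: "\<And>x. x \<in> nonneg_orthant m \<Longrightarrow>
      vol (K + segment_sum m v (\<lambda>i. 2 * x i)) = 2 ^ d * vol (K + segment_sum m v x)"
    and x: "x \<in> nonneg_orthant m"
  shows "vol (K + segment_sum m v x) =
    subset_poly {..<m} (\<lambda>I. if card I = d then vol (K + segment_sum m v (indicator I)) else 0) x"
proof (rule homogeneous_subset_poly[where F = "\<lambda>x. vol (K + segment_sum m v x)"])
  fix x y :: "nat \<Rightarrow> real" assume *: "\<And>i. i \<in> {..<m} \<Longrightarrow> x i = y i"
  show "vol (K + segment_sum m v x) = vol (K + segment_sum m v y)"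
    using segment_sum_cong[of m x y v] * by simp
qed (use assms vol_segment_sum_plus_affine in \<open>auto simp: nonneg_orthant_def\<close>)

lemma linear_image_set_plus:
  assumes "linear f"
  shows "f ` (A + B) = f ` A + f ` B"
proof (intro subset_antisym subsetI)
  fix y assume "y \<in> f ` A + f ` B"
  then obtain a b where "a \<in> A" "b \<in> B" "y = f a + f b" by (auto simp: set_plus_mem_iff)
  then have "a + b \<in> A + B" "y = f (a + b)" using linear_add[OF assms] by auto
  then show "y \<in> f ` (A + B)" by blast
qed (use linear_add[OF assms] in \<open>auto 4 4 simp: set_plus_mem_iff\<close>)

lemma linear_image_sum:
  assumes "linear f" "finite I"
  shows "f ` (\<Sum>i\<in>I. A i) = (\<Sum>i\<in>I. f ` A i)"
  using assms(2) by (induction I rule: finite_induct)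
    (simp_all add: linear_image_set_plus[OF assms(1)] set_zero linear_0[OF assms(1)])

lemma linear_image_seg: "linear f \<Longrightarrow> f ` seg v = seg (f v)"
  by (metis closed_segment_linear_image linear_0)

lemma linear_image_segment_sum:
  "linear f \<Longrightarrow> f ` segment_sum k v x = segment_sum k (\<lambda>i. f (v i)) x"
  by (simp add: segment_sum_alt linear_image_sum linear_image_seg linear_cmul)

lemma vol_scaleR: "0 \<le> r \<Longrightarrow> vol ((*\<^sub>R) r ` S) = r ^ DIM('a) * vol (S::'a::euclidean_space set)"
  using measure_lebesgue_affine[of r 0 S] by simp

lemma segment_sum_scaleR: "segment_sum k v (\<lambda>i. r * x i) = (*\<^sub>R) r ` segment_sum k v x"
  by (simp add: segment_sum_alt linear_image_sum linear_image_seg linear_scaleR)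

lemma vol_segment_sum:
  fixes v :: "nat \<Rightarrow> 'a::euclidean_space"
  assumes "x \<in> nonneg_orthant m"
  shows "vol (segment_sum m v x) =
    subset_poly {..<m} (\<lambda>I. if card I = DIM('a) then vol (segment_sum m v (indicator I)) else 0) x"
proof -
  have "vol ({0} + segment_sum m v (\<lambda>i. 2 * x i)) = 2 ^ DIM('a) * vol ({0} + segment_sum m v x)" for x
    by (simp add: segment_sum_scaleR vol_scaleR)
  then have "vol ({0} + segment_sum m v x) = subset_poly {..<m}
    (\<lambda>I. if card I = DIM('a) then vol ({0} + segment_sum m v (indicator I)) else 0) x"
    by (intro vol_plus_segment_sum_subset_poly assms) simp_all
  then show ?thesis unfolding vol_translate .
qed

section \<open>An inequality for the minors of a three-row matrix\<close>

definition minor3 :: "(nat \<Rightarrow> real) \<Rightarrow> (nat \<Rightarrow> real) \<Rightarrow> (nat \<Rightarrow> real) \<Rightarrow> nat \<Rightarrow> nat \<Rightarrow> nat \<Rightarrow> real" where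
  "minor3 a b c l r s = a l * (b r * c s - b s * c r) - a r * (b l * c s - b s * c l) + a s * (b l * c r - b r * c l)"

text \<open>The sums run over ordered tuples, and tuples with repetitions contribute 0, so every
  minor is counted 6, 2 and 1 times in the three sums. This is the origin of the factors 2 and 3
  below: \<open>(S3 / 6) * S1 \<le> (S2 / 2) * (S2' / 2)\<close> becomes
  \<open>2 * S3 * S1 \<le> 3 * S2 * S2'\<close>.\<close>

definition minor_sum3 :: "nat set \<Rightarrow> (nat \<Rightarrow> real) \<Rightarrow> (nat \<Rightarrow> real) \<Rightarrow> (nat \<Rightarrow> real) \<Rightarrow> (nat \<Rightarrow> real) \<Rightarrow> real" where
  "minor_sum3 R w a b c = (\<Sum>l\<in>R. \<Sum>r\<in>R. \<Sum>s\<in>R. w l * w r * w s * \<bar>minor3 a b c l r s\<bar>)"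
definition minor_sum2 :: "nat set \<Rightarrow> (nat \<Rightarrow> real) \<Rightarrow> (nat \<Rightarrow> real) \<Rightarrow> (nat \<Rightarrow> real) \<Rightarrow> real" where
  "minor_sum2 R w a c = (\<Sum>l\<in>R. \<Sum>r\<in>R. w l * w r * \<bar>a l * c r - a r * c l\<bar>)"
definition minor_sum1 :: "nat set \<Rightarrow> (nat \<Rightarrow> real) \<Rightarrow> (nat \<Rightarrow> real) \<Rightarrow> real" where
  "minor_sum1 R w c = (\<Sum>l\<in>R. w l * \<bar>c l\<bar>)"

text \<open>Layer-cake decomposition, one layer at a time: \<open>a\<close> is cut off at its second
  largest value, and \<open>S\<close> is the set where the maximum is attained. The truncated
  function and the indicator are ordered alike, so absolute differences add without cancellation;
  this makes \<open>minor_sum2\<close> additive when \<open>c\<close> is constant.\<close>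

lemma threshold_induct [consumes 1, case_names const add]:
  fixes a :: "nat \<Rightarrow> real"
  assumes "finite R"
    and const: "\<And>a k. (\<And>l. l \<in> R \<Longrightarrow> a l = k) \<Longrightarrow> P a"
    and add: "\<And>a a' \<alpha> S. P a' \<Longrightarrow> 0 \<le> \<alpha> \<Longrightarrow> (\<And>l. l \<in> R \<Longrightarrow> a l = a' l + \<alpha> * indicator S l) \<Longrightarrow>
       (\<And>l r. l \<in> R \<Longrightarrow> r \<in> R \<Longrightarrow> \<bar>a l - a r\<bar> = \<bar>a' l - a' r\<bar> + \<alpha> * \<bar>indicator S l - indicator S r\<bar>) \<Longrightarrow> P a"
  shows "P a"
proof (induction "card (a ` R)" arbitrary: a rule: less_induct)
  case less
  show ?case
  proof (cases "\<exists>k. \<forall>l\<in>R. a l = k")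
    case True then show ?thesis using const by blast
  next
    case False
    then have ne: "R \<noteq> {}" by auto
    define M where "M = Max (a ` R)"
    have M: "M \<in> a ` R" "\<And>l. l \<in> R \<Longrightarrow> a l \<le> M" using ne \<open>finite R\<close> by (auto simp: M_def)
    define V where "V = a ` R - {M}"
    have V: "finite V" "V \<noteq> {}" using \<open>finite R\<close> False M by (auto simp: V_def)
    define N where "N = Max V"
    have N: "N \<in> V" "\<And>y. y \<in> V \<Longrightarrow> y \<le> N" using V by (auto simp: N_def)
    have NM: "N < M" using N(1) M(2) by (force simp: V_def)
    define a' where "a' l = min (a l) N" for l
    define S where "S = {l. a l = M}"
    have cases: "a l = M \<or> (a l \<le> N \<and> l \<notin> S)" if "l \<in> R" for l
      using N(2)[of "a l"] that by (auto simp: V_def S_def)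
    have im: "a' ` R \<subseteq> V"
    proof
      fix y assume "y \<in> a' ` R"
      then obtain l where l: "l \<in> R" "y = a' l" by auto
      show "y \<in> V"
        using cases[OF l(1)] l N(1) NM by (auto simp: a'_def min_def V_def)
    qed
    have "card (a' ` R) \<le> card V" using im V by (intro card_mono)
    also have "card V < card (a ` R)"
      using M(1) \<open>finite R\<close> unfolding V_def by (intro psubset_card_mono) auto
    finally have "P a'" by (rule less.hyps)
    then show ?thesis
    proof (rule add[of _ "M - N" _ S])
      show eq: "a l = a' l + (M - N) * indicator S l" if "l \<in> R" for l
        using cases[OF that] NM by (auto simp: a'_def S_def min_def indicator_def)
      have a'N: "a' l \<le> N" for l by (simp add: a'_def)
      have a'S: "a' l = N" if "l \<in> S" for l using that NM by (simp add: a'_def S_def)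
      show "\<bar>a l - a r\<bar> = \<bar>a' l - a' r\<bar> + (M - N) * \<bar>indicator S l - indicator S r\<bar>" if "l \<in> R" "r \<in> R" for l r
        using eq[OF that(1)] eq[OF that(2)] a'N[of l] a'N[of r] a'S[of l] a'S[of r] NM
        by (cases "l \<in> S"; cases "r \<in> S") auto
    qed (use NM in simp)
  qed
qed

text \<open>The minors are linear in the first row, but their absolute values may cancel. An upper
  bound suffices, since \<open>minor_sum3\<close> stands on the smaller side of the
  inequality.\<close>

lemma minor_sum3_add_le:
  assumes "\<And>l. l \<in> R \<Longrightarrow> 0 \<le> w l" "0 \<le> \<alpha>"
    "\<And>l. l \<in> R \<Longrightarrow> a l = a' l + \<alpha> * a'' l"
  shows "minor_sum3 R w a b c \<le> minor_sum3 R w a' b c + \<alpha> * minor_sum3 R w a'' b c"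
proof -
  have "minor_sum3 R w a b c \<le> (\<Sum>l\<in>R. \<Sum>r\<in>R. \<Sum>s\<in>R. w l * w r * w s * (\<bar>minor3 a' b c l r s\<bar> + \<alpha> * \<bar>minor3 a'' b c l r s\<bar>))"
    unfolding minor_sum3_def
  proof (intro sum_mono mult_left_mono)
    fix l r s assume "l \<in> R" "r \<in> R" "s \<in> R"
    then have "minor3 a b c l r s = minor3 a' b c l r s + \<alpha> * minor3 a'' b c l r s"
      using assms(3) by (simp add: minor3_def algebra_simps)
    then show "\<bar>minor3 a b c l r s\<bar> \<le> \<bar>minor3 a' b c l r s\<bar> + \<alpha> * \<bar>minor3 a'' b c l r s\<bar>"
      using abs_triangle_ineq[of "minor3 a' b c l r s" "\<alpha> * minor3 a'' b c l r s"] assms(2) by (simp add: abs_mult)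
  qed (use assms in auto)
  also have "\<dots> = minor_sum3 R w a' b c + \<alpha> * minor_sum3 R w a'' b c"
    unfolding minor_sum3_def by (simp add: sum_distrib_left sum.distrib distrib_left mult.left_commute)
  finally show ?thesis .
qed

lemma minor_sum3_swap: "minor_sum3 R w a b c = minor_sum3 R w b a c"
proof -
  have "\<bar>minor3 a b c l r s\<bar> = \<bar>minor3 b a c l r s\<bar>" for l r s
  proof -
    have "minor3 a b c l r s = - minor3 b a c l r s" by (simp add: minor3_def algebra_simps)
    then show ?thesis by simp
  qed
  then show ?thesis by (simp add: minor_sum3_def)
qed

abbreviation "ones \<equiv> (\<lambda>_::nat. 1::real)"

lemma minor_sum2_ones_const: "(\<And>l. l \<in> R \<Longrightarrow> a l = k) \<Longrightarrow> minor_sum2 R w a ones = 0"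
  by (simp add: minor_sum2_def)

lemma minor_sum3_ones_const: "(\<And>l. l \<in> R \<Longrightarrow> a l = k) \<Longrightarrow> minor_sum3 R w a b ones = 0"
  by (simp add: minor_sum3_def minor3_def algebra_simps)

lemma minor_sum2_ones_add:
  assumes "\<And>l r. l \<in> R \<Longrightarrow> r \<in> R \<Longrightarrow> \<bar>a l - a r\<bar> = \<bar>a' l - a' r\<bar> + \<alpha> * \<bar>a'' l - a'' r\<bar>"
  shows "minor_sum2 R w a ones = minor_sum2 R w a' ones + \<alpha> * minor_sum2 R w a'' ones"
proof -
  have "minor_sum2 R w a ones = (\<Sum>l\<in>R. \<Sum>r\<in>R. w l * w r * (\<bar>a' l - a' r\<bar> + \<alpha> * \<bar>a'' l - a'' r\<bar>))"
    unfolding minor_sum2_def using assms by (intro sum.cong) auto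
  then show ?thesis
    by (simp add: minor_sum2_def sum_distrib_left sum.distrib distrib_left mult.left_commute)
qed

lemma sum_two_indicators:
  assumes "finite R"
  shows "(\<Sum>l\<in>R. w l * (F (indicator S l) (indicator T l)) :: real) =
    sum w (R \<inter> S \<inter> T) * F 1 1 + sum w (R \<inter> S - T) * F 1 0 +
    sum w (R \<inter> T - S) * F 0 1 + sum w (R - S - T) * F (0::real) (0::real)"
proof -
  have R: "R = (R \<inter> S \<inter> T) \<union> ((R \<inter> S - T) \<union> ((R \<inter> T - S) \<union> (R - S - T)))" by auto
  show ?thesis
    unfolding sum_distrib_right
    apply (subst R)
    apply (subst sum.union_disjoint, use assms in \<open>auto\<close>)+
    done
qed

text \<open>For indicator functions both sides are polynomials in the four weights \<open>p, q, r, s\<close> of the cells cut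
  out by \<open>S\<close> and \<open>T\<close>, and their difference is \<open>(p s - q r)\<^sup>2\<close>.\<close>
lemma minor_inequality_indicators:
  assumes "finite R"
  shows "2 * minor_sum3 R w (indicator S) (indicator T) ones * sum w R
    \<le> 3 * minor_sum2 R w (indicator S) ones * minor_sum2 R w (indicator T) ones"
proof -
  define p q r s where "p = sum w (R \<inter> S \<inter> T)" and "q = sum w (R \<inter> S - T)"
    and "r = sum w (R \<inter> T - S)" and "s = sum w (R - S - T)"
  note sum2 = sum_two_indicators[OF assms, of w _ S T, folded p_def q_def r_def s_def]
  have W: "sum w R = p + q + r + s"
    using sum2[of "\<lambda>_ _. 1"] by simp
  have E2S: "minor_sum2 R w (indicator S) ones = 2 * ((p + q) * (r + s))"
  proof -
    have "minor_sum2 R w (indicator S) ones = (\<Sum>l\<in>R. w l * (\<Sum>k\<in>R. w k * \<bar>indicator S l - indicator S k\<bar>))"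
      by (simp add: minor_sum2_def sum_distrib_left mult.assoc)
    also have "\<dots> = (\<Sum>l\<in>R. w l * (\<lambda>x y. p * \<bar>x - 1\<bar> + q * \<bar>x - 1\<bar> + r * \<bar>x\<bar> + s * \<bar>x\<bar>) (indicator S l) (indicator T l))"
      by (subst sum2[of "\<lambda>x y. \<bar>indicator S _ - x\<bar>"]) simp
    also have "\<dots> = 2 * ((p + q) * (r + s))"
      by (subst sum2) (simp add: algebra_simps)
    finally show ?thesis .
  qed
  have E2T: "minor_sum2 R w (indicator T) ones = 2 * ((p + r) * (q + s))"
  proof -
    have "minor_sum2 R w (indicator T) ones = (\<Sum>l\<in>R. w l * (\<Sum>k\<in>R. w k * \<bar>indicator T l - indicator T k\<bar>))"
      by (simp add: minor_sum2_def sum_distrib_left mult.assoc)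
    also have "\<dots> = (\<Sum>l\<in>R. w l * (\<lambda>x y. p * \<bar>y - 1\<bar> + q * \<bar>y\<bar> + r * \<bar>y - 1\<bar> + s * \<bar>y\<bar>) (indicator S l) (indicator T l))"
      by (subst sum2[of "\<lambda>x y. \<bar>indicator T _ - y\<bar>"]) simp
    also have "\<dots> = 2 * ((p + r) * (q + s))"
      by (subst sum2) (simp add: algebra_simps)
    finally show ?thesis .
  qed
  \<comment> \<open>\<open>d\<close> is twice the area of the triangle with three given vertices in
    the plane. Three distinct corners of the unit square give 1 and repeated corners give 0, so the
    sum below is six times the third elementary symmetric polynomial in the four cell
    weights.\<close>
  define d :: "real \<Rightarrow> real \<Rightarrow> real \<Rightarrow> real \<Rightarrow> real \<Rightarrow> real \<Rightarrow> real" where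
    "d x y x' y' x'' y'' = \<bar>x * (y' - y'') - x' * (y - y'') + x'' * (y - y')\<bar>" for x y x' y' x'' y''
  let ?S = "indicator S :: nat \<Rightarrow> real" and ?T = "indicator T :: nat \<Rightarrow> real"
  have minor_sum3: "minor_sum3 R w ?S ?T ones = 6 * (p * q * r + p * q * s + p * r * s + q * r * s)"
  proof -
    have "minor_sum3 R w ?S ?T ones =
        (\<Sum>l\<in>R. w l * (\<Sum>k\<in>R. w k * (\<Sum>j\<in>R. w j * d (?S l) (?T l) (?S k) (?T k) (?S j) (?T j))))"
      by (simp add: minor_sum3_def minor3_def d_def sum_distrib_left mult.assoc)
    also have "\<dots> = (\<Sum>l\<in>R. w l * (\<Sum>k\<in>R. w k * (\<lambda>x y.
        p * d (?S l) (?T l) x y 1 1 + q * d (?S l) (?T l) x y 1 0 + r * d (?S l) (?T l) x y 0 1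
          + s * d (?S l) (?T l) x y 0 0) (?S k) (?T k)))"
      by (subst sum2) simp
    also have "\<dots> = (\<Sum>l\<in>R. w l * (\<lambda>x y.
        p * (p * d x y 1 1 1 1 + q * d x y 1 1 1 0 + r * d x y 1 1 0 1 + s * d x y 1 1 0 0) +
        q * (p * d x y 1 0 1 1 + q * d x y 1 0 1 0 + r * d x y 1 0 0 1 + s * d x y 1 0 0 0) +
        r * (p * d x y 0 1 1 1 + q * d x y 0 1 1 0 + r * d x y 0 1 0 1 + s * d x y 0 1 0 0) +
        s * (p * d x y 0 0 1 1 + q * d x y 0 0 1 0 + r * d x y 0 0 0 1 + s * d x y 0 0 0 0))
         (?S l) (?T l))"
      by (subst sum2) simp
    also have "\<dots> = 6 * (p * q * r + p * q * s + p * r * s + q * r * s)"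
      by (subst sum2) (simp add: d_def algebra_simps)
    finally show ?thesis .
  qed
  have "3 * minor_sum2 R w ?S ones * minor_sum2 R w ?T ones - 2 * minor_sum3 R w ?S ?T ones * sum w R = 12 * (p * s - q * r)\<^sup>2"
    unfolding E2S E2T minor_sum3 W by (simp add: algebra_simps power2_eq_square)
  then show ?thesis using zero_le_power2[of "p * s - q * r"] by linarith
qed

text \<open>The rows are decomposed one after the other: \<open>step\<close> extends the inequality
  from indicators to arbitrary first rows while the second row is held fixed, and interchanging the
  rows allows a second use of it.\<close>

lemma minor_inequality_ones:
  assumes R: "finite R" and w: "\<And>l. l \<in> R \<Longrightarrow> 0 \<le> w l"
  shows "2 * minor_sum3 R w a b ones * sum w R \<le> 3 * minor_sum2 R w a ones * minor_sum2 R w b ones"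
proof -
  have W: "0 \<le> sum w R" using w by (rule sum_nonneg)
  have step: "2 * minor_sum3 R w a b ones * sum w R \<le> 3 * minor_sum2 R w a ones * minor_sum2 R w b ones"
    if ind: "\<And>S. 2 * minor_sum3 R w (indicator S) b ones * sum w R \<le> 3 * minor_sum2 R w (indicator S) ones * minor_sum2 R w b ones" for a b
    using R
  proof (induction a rule: threshold_induct)
    case (const a k)
    then show ?case by (simp add: minor_sum2_ones_const minor_sum3_ones_const)
  next
    case (add a a' \<alpha> S)
    have "minor_sum3 R w a b ones * (2 * sum w R) \<le> (minor_sum3 R w a' b ones + \<alpha> * minor_sum3 R w (indicator S) b ones) * (2 * sum w R)"
      using W by (intro mult_right_mono minor_sum3_add_le w add) auto
    also have "\<dots> = 2 * minor_sum3 R w a' b ones * sum w R + \<alpha> * (2 * minor_sum3 R w (indicator S) b ones * sum w R)"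
      by (simp add: algebra_simps)
    also have "\<dots> \<le> 3 * minor_sum2 R w a' ones * minor_sum2 R w b ones + \<alpha> * (3 * minor_sum2 R w (indicator S) ones * minor_sum2 R w b ones)"
      by (intro add_mono mult_left_mono ind add)
    also have "\<dots> = 3 * minor_sum2 R w a ones * minor_sum2 R w b ones"
      by (subst minor_sum2_ones_add[OF add(4)]) (simp_all add: algebra_simps)
    finally show ?case by (simp add: algebra_simps)
  qed
  show ?thesis
  proof (rule step)
    fix S
    have "2 * minor_sum3 R w b (indicator S) ones * sum w R \<le> 3 * minor_sum2 R w b ones * minor_sum2 R w (indicator S) ones"
      by (rule step) (rule minor_inequality_indicators[OF R])
    then show "2 * minor_sum3 R w (indicator S) b ones * sum w R \<le> 3 * minor_sum2 R w (indicator S) ones * minor_sum2 R w b ones"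
      by (simp only: minor_sum3_swap[of R w "indicator S" b] mult_ac)
  qed
qed

text \<open>Dividing column \<open>l\<close> by \<open>c l\<close> divides every minor through it by
  \<open>c l\<close>, which the new weight \<open>y l * |c l|\<close> compensates. This turns the
  row \<open>c\<close> into ones.\<close>

lemma minor_inequality_nonzero:
  assumes R: "finite R" and y: "\<And>l. l \<in> R \<Longrightarrow> 0 \<le> y l" and c: "\<And>l. l \<in> R \<Longrightarrow> c l \<noteq> 0"
  shows "2 * minor_sum3 R y a b c * minor_sum1 R y c \<le> 3 * minor_sum2 R y a c * minor_sum2 R y b c"
proof -
  define w where "w l = y l * \<bar>c l\<bar>" for l
  have minor_sum2: "minor_sum2 R y a c = minor_sum2 R w (\<lambda>l. a l / c l) ones" for a
    unfolding minor_sum2_def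
  proof (intro sum.cong refl)
    fix l r assume "l \<in> R" "r \<in> R"
    then have "a l * c r - a r * c l = c l * c r * (a l / c l * 1 - a r / c r * 1)"
      using c by (simp add: field_simps)
    then show "y l * y r * \<bar>a l * c r - a r * c l\<bar> = w l * w r * \<bar>a l / c l * 1 - a r / c r * 1\<bar>"
      by (simp add: abs_mult w_def)
  qed
  have minor_sum3: "minor_sum3 R y a b c = minor_sum3 R w (\<lambda>l. a l / c l) (\<lambda>l. b l / c l) ones"
    unfolding minor_sum3_def
  proof (intro sum.cong refl)
    fix l r s assume "l \<in> R" "r \<in> R" "s \<in> R"
    then have "minor3 a b c l r s = c l * c r * c s * minor3 (\<lambda>l. a l / c l) (\<lambda>l. b l / c l) ones l r s"
      using c by (simp add: minor3_def field_simps)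
    then show "y l * y r * y s * \<bar>minor3 a b c l r s\<bar> =
        w l * w r * w s * \<bar>minor3 (\<lambda>l. a l / c l) (\<lambda>l. b l / c l) ones l r s\<bar>"
      by (simp add: abs_mult w_def)
  qed
  have "minor_sum1 R y c = sum w R" by (simp add: minor_sum1_def w_def)
  then show ?thesis unfolding minor_sum2 minor_sum3 using minor_inequality_ones[OF R, of w] y by (simp add: w_def)
qed

text \<open>Both sides are continuous in \<open>c\<close>, so zero entries are replaced by
  \<epsilon> and \<epsilon> tends to 0.\<close>

lemma minor_inequality:
  assumes R: "finite R" and y: "\<And>l. l \<in> R \<Longrightarrow> 0 \<le> y l"
  shows "2 * minor_sum3 R y a b c * minor_sum1 R y c \<le> 3 * minor_sum2 R y a c * minor_sum2 R y b c"
proof -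
  define c' where "c' \<epsilon> l = (if c l = 0 then \<epsilon> else c l)" for \<epsilon> :: real and l
  have c': "((\<lambda>\<epsilon>. c' \<epsilon> l) \<longlongrightarrow> c l) (at_right 0)" for l
    unfolding c'_def by (cases "c l = 0") (auto intro!: tendsto_eq_intros)
  have "((\<lambda>\<epsilon>. 2 * minor_sum3 R y a b (c' \<epsilon>) * minor_sum1 R y (c' \<epsilon>)) \<longlongrightarrow> 2 * minor_sum3 R y a b c * minor_sum1 R y c) (at_right 0)"
    unfolding minor_sum3_def minor_sum1_def minor3_def by (intro tendsto_intros c')
  moreover have "((\<lambda>\<epsilon>. 3 * minor_sum2 R y a (c' \<epsilon>) * minor_sum2 R y b (c' \<epsilon>)) \<longlongrightarrow> 3 * minor_sum2 R y a c * minor_sum2 R y b c) (at_right 0)"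
    unfolding minor_sum2_def by (intro tendsto_intros c')
  moreover have "eventually (\<lambda>\<epsilon>. 2 * minor_sum3 R y a b (c' \<epsilon>) * minor_sum1 R y (c' \<epsilon>) \<le> 3 * minor_sum2 R y a (c' \<epsilon>) * minor_sum2 R y b (c' \<epsilon>)) (at_right 0)"
    using eventually_at_right_less[of 0]
    by eventually_elim (intro minor_inequality_nonzero R y, auto simp: c'_def)
  ultimately show ?thesis by (intro tendsto_le[OF trivial_limit_at_right_real])
qed

section \<open>Volumes of parallelepipeds\<close>

lemma inner_sum_subset_Basis:
  assumes "D \<subseteq> Basis" "i \<in> Basis"
  shows "(\<Sum>b\<in>D. r b *\<^sub>R b) \<bullet> i = (if i \<in> D then r i else 0)"
proof -
  have fin: "finite D" using assms(1) finite_subset[OF _ finite_Basis] by blast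
  have "(\<Sum>b\<in>D. r b *\<^sub>R b) \<bullet> i = (\<Sum>b\<in>D. if i = b then r b else 0)"
    unfolding inner_sum_left
  proof (rule sum.cong[OF refl])
    fix b assume "b \<in> D"
    then have "b \<in> Basis" using assms(1) by blast
    then have "b \<bullet> i = (if b = i then 1 else 0)" using assms(2) by (rule inner_Basis)
    then show "(r b *\<^sub>R b) \<bullet> i = (if i = b then r b else 0)" by simp
  qed
  then show ?thesis unfolding sum.delta'[OF fin] .
qed

lemma sum_seg_Basis:
  assumes "D \<subseteq> Basis"
  shows "(\<Sum>b\<in>D. seg b) = cbox 0 (\<Sum>D :: 'a::euclidean_space)"
proof (intro subset_antisym subsetI)
  have fD: "finite D" using assms finite_subset[OF _ finite_Basis] by blast
  have One: "(\<Sum>D) \<bullet> i = (if i \<in> D then 1 else 0)" if "i \<in> Basis" for i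
    using inner_sum_subset_Basis[OF assms that, of "\<lambda>_. 1"] by simp
  fix x :: 'a
  { assume "x \<in> (\<Sum>b\<in>D. seg b)"
    then obtain s where s: "x = sum s D" "\<And>b. b \<in> D \<Longrightarrow> s b \<in> seg b"
      unfolding set_sum_alt[OF fD] by blast
    have "\<forall>b\<in>D. \<exists>r. s b = r *\<^sub>R b \<and> 0 \<le> r \<and> r \<le> 1"
      using s(2) unfolding seg_eq by fastforce
    then obtain r where r: "\<And>b. b \<in> D \<Longrightarrow> s b = r b *\<^sub>R b \<and> 0 \<le> r b \<and> r b \<le> 1" by metis
    have x: "x = (\<Sum>b\<in>D. r b *\<^sub>R b)" unfolding s(1) by (intro sum.cong) (use r in auto)
    show "x \<in> cbox 0 (\<Sum>D)"
      unfolding mem_box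
    proof
      fix i :: 'a assume i: "i \<in> Basis"
      show "0 \<bullet> i \<le> x \<bullet> i \<and> x \<bullet> i \<le> \<Sum>D \<bullet> i"
        using r[of i] unfolding x One[OF i] inner_sum_subset_Basis[OF assms i] by simp
    qed }
  { assume x: "x \<in> cbox 0 (\<Sum>D)"
    have b: "0 \<le> x \<bullet> i" "x \<bullet> i \<le> (if i \<in> D then 1 else 0)" if "i \<in> Basis" for i
      using x that One[OF that] by (auto simp: mem_box)
    have "x = (\<Sum>b\<in>Basis. (x \<bullet> b) *\<^sub>R b)" by (simp add: euclidean_representation)
    also have "\<dots> = (\<Sum>b\<in>D. (x \<bullet> b) *\<^sub>R b)"
    proof (intro sum.mono_neutral_right ballI)
      fix i assume "i \<in> Basis - D"
      then show "(x \<bullet> i) *\<^sub>R i = 0" using b[of i] by simp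
    qed (use assms in auto)
    finally have "x = (\<Sum>b\<in>D. (x \<bullet> b) *\<^sub>R b)" .
    moreover have "(x \<bullet> i) *\<^sub>R i \<in> seg i" if "i \<in> D" for i
    proof -
      have "i \<in> Basis" using that assms by blast
      then have "x \<bullet> i \<in> {0..1}" using b[of i] that by simp
      then show ?thesis unfolding seg_eq by (rule imageI)
    qed
    ultimately show "x \<in> (\<Sum>b\<in>D. seg b)"
      unfolding set_sum_alt[OF fD] by blast }
qed

lemma sum_seg_axis: "(\<Sum>k\<in>UNIV. seg (axis k 1 :: real^'n)) = cbox 0 One"
proof -
  have "bij_betw (\<lambda>k. axis k 1 :: real^'n) UNIV Basis"
    by (auto simp: bij_betw_def inj_def axis_eq_axis Basis_vec_def)
  then have "(\<Sum>k\<in>UNIV. seg (axis k 1 :: real^'n)) = (\<Sum>b\<in>Basis. seg b)"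
    by (rule sum.reindex_bij_betw)
  then show ?thesis by (simp only: sum_seg_Basis[OF order_refl])
qed

text \<open>A permutation that moves a point outside \<open>J\<close> picks an off-diagonal entry of
  a unit column, which is 0. Determinants in unspecified dimension are thereby reduced to the few
  rows in \<open>J\<close>.\<close>

lemma det_axis_columns:
  fixes w :: "'n::finite \<Rightarrow> real^'n"
  assumes "\<And>k. k \<notin> J \<Longrightarrow> w k = axis k 1"
  shows "det (\<chi> r k. w k $ r) = (\<Sum>p\<in>{p. p permutes J}. of_int (sign p) * (\<Prod>j\<in>J. w (p j) $ j))"
proof -
  have "det (\<chi> r k. w k $ r) = (\<Sum>p\<in>{p. p permutes UNIV}. of_int (sign p) * (\<Prod>j\<in>UNIV. w (p j) $ j))"
    by (simp add: det_def)
  also have "\<dots> = (\<Sum>p\<in>{p. p permutes J}. of_int (sign p) * (\<Prod>j\<in>UNIV. w (p j) $ j))"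
  proof (intro sum.mono_neutral_right ballI)
    show "{p. p permutes J} \<subseteq> {p. p permutes UNIV}" by (auto intro: permutes_subset)
    fix p assume p: "p \<in> {p. p permutes UNIV} - {p. p permutes J}"
    then obtain k where k: "k \<notin> J" "p k \<noteq> k"
      by (auto simp: permutes_def)
    then obtain i where i: "p i = k" "i \<noteq> k" using p by (metis (no_types, lifting) DiffD1 mem_Collect_eq permutes_def)
    have "w (p i) $ i = 0" using assms[OF k(1)] i by (simp add: axis_def)
    then show "of_int (sign p) * (\<Prod>j\<in>UNIV. w (p j) $ j) = 0"
      by (auto intro!: prod_zero)
  qed (auto simp: finite_permutations)
  also have "\<dots> = (\<Sum>p\<in>{p. p permutes J}. of_int (sign p) * (\<Prod>j\<in>J. w (p j) $ j))"
  proof (intro sum.cong refl arg_cong2[of _ _ _ _ "(*)"])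
    fix p assume "p \<in> {p. p permutes J}"
    then have "w (p j) $ j = 1" if "j \<notin> J" for j
      using that assms by (simp add: permutes_not_in)
    then show "(\<Prod>j\<in>UNIV. w (p j) $ j) = (\<Prod>j\<in>J. w (p j) $ j)"
      by (intro prod.mono_neutral_right) auto
  qed
  finally show ?thesis .
qed

lemma det_axis_columns_0:
  fixes w :: "'n::finite \<Rightarrow> real^'n"
  assumes "\<And>k. w k = axis k 1"
  shows "det (\<chi> r k. w k $ r) = 1"
  by (subst det_axis_columns[of "{}" w]) (simp_all only: assms permutes_empty, simp)

lemma det_axis_columns_1:
  fixes w :: "'n::finite \<Rightarrow> real^'n"
  assumes "\<And>k. k \<noteq> a \<Longrightarrow> w k = axis k 1"
  shows "det (\<chi> r k. w k $ r) = w a $ a"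
  by (subst det_axis_columns[of "{a}" w]) (simp_all add: assms)

lemma det_axis_columns_2:
  fixes w :: "'n::finite \<Rightarrow> real^'n"
  assumes "a \<noteq> b" "\<And>k. k \<noteq> a \<Longrightarrow> k \<noteq> b \<Longrightarrow> w k = axis k 1"
  shows "det (\<chi> r k. w k $ r) = w a $ a * w b $ b - w b $ a * w a $ b"
proof -
  have f12: "finite {b}" "a \<notin> {b}" using assms by auto
  show ?thesis
    apply (subst det_axis_columns[of "{a,b}" w], use assms in force)
    unfolding sum_over_permutations_insert[OF f12] permutes_sing
    by (use assms in \<open>simp add: sign_swap_id permutation_swap_id sign_compose sign_id\<close>)
qed

lemma det_axis_columns_3:
  fixes w :: "'n::finite \<Rightarrow> real^'n"
  assumes "distinct [a, b, c]" "\<And>k. k \<notin> {a, b, c} \<Longrightarrow> w k = axis k 1"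
  shows "det (\<chi> r k. w k $ r) = w a $ a * (w b $ b * w c $ c - w c $ b * w b $ c)
    - w b $ a * (w a $ b * w c $ c - w c $ b * w a $ c) + w c $ a * (w a $ b * w b $ c - w b $ b * w a $ c)"
proof -
  have ne: "a \<noteq> b" "b \<noteq> a" "a \<noteq> c" "c \<noteq> a" "b \<noteq> c" "c \<noteq> b" using assms(1) by auto
  have f: "finite {b, c}" "a \<notin> {b, c}" "finite {c}" "b \<notin> {c}" using assms by auto
  show ?thesis
    apply (subst det_axis_columns[of "{a,b,c}" w], use assms in force)
    unfolding sum_over_permutations_insert[OF f(1,2)] sum_over_permutations_insert[OF f(3,4)] permutes_sing
    using ne
    by (simp add: sign_swap_id permutation_swap_id sign_compose sign_id Transposition.transpose_def)
      (simp add: algebra_simps)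
qed

text \<open>Boxes suffice by \<open>measure_linear_sufficient\<close>, and elementary maps by
  \<open>induct_linear_elementary\<close>: determinants multiply under composition, and a map with a
  vanishing coordinate gives 0 on both sides.\<close>

lemma vol_linear_image:
  fixes f :: "real^'n::finite \<Rightarrow> real^'n"
  assumes "linear f" "S \<in> lmeasurable"
  shows "vol (f ` S) = \<bar>det (matrix f)\<bar> * vol S"
proof -
  have "\<forall>a b. vol (f ` cbox a b) = \<bar>det (matrix f)\<bar> * vol (cbox a b)"
  proof (rule induct_linear_elementary[OF \<open>linear f\<close>]; intro allI)
    fix f g :: "real^'n \<Rightarrow> real^'n" and a b
    assume *: "linear f" "linear g" "\<forall>a b. vol (f ` cbox a b) = \<bar>det (matrix f)\<bar> * vol (cbox a b)"
      "\<forall>a b. vol (g ` cbox a b) = \<bar>det (matrix g)\<bar> * vol (cbox a b)"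
    have "vol (f ` g ` cbox a b) = \<bar>det (matrix f)\<bar> * vol (g ` cbox a b)"
      using measure_linear_sufficient[OF *(1) measurable_linear_image_interval[OF *(2)]] *(3) by metis
    then show "vol ((f \<circ> g) ` cbox a b) = \<bar>det (matrix (f \<circ> g))\<bar> * vol (cbox a b)"
      using * by (simp add: matrix_compose det_mul abs_mult image_comp)
  next
    fix f :: "real^'n \<Rightarrow> real^'n" and i a b
    assume *: "linear f" "\<And>x. f x $ i = 0"
    have ninj: "\<not> inj f"
    proof
      assume "inj f"
      then obtain x where "f x = axis i 1"
        using linear_injective_imp_surjective[OF *(1)] by (metis surjD)
      then show False using *(2)[of x] by simp
    qed
    then have "negligible (f ` cbox a b)" by (rule negligible_linear_singular_image[OF *(1)])
    moreover have "det (matrix f) = 0" using ninj det_nz_iff_inj[OF *(1)] by blast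
    ultimately show "vol (f ` cbox a b) = \<bar>det (matrix f)\<bar> * vol (cbox a b)"
      by (simp add: negligible_imp_measure0)
  next
    fix c :: "'n \<Rightarrow> real" and a b
    show "vol ((\<lambda>x. \<chi> i. c i * x $ i) ` cbox a b) = \<bar>det (matrix (\<lambda>x. \<chi> i. c i * x $ i))\<bar> * vol (cbox a b)"
      by (simp add: measure_stretch matrix_def axis_def det_diagonal)
  next
    fix m n :: 'n and a b assume "m \<noteq> n"
    let ?h = "\<lambda>x :: real^'n. \<chi> i. x $ Transposition.transpose m n i"
    have "det (matrix ?h) = det (\<chi> r k. axis (Transposition.transpose m n k) 1 $ r)"
      unfolding matrix_def by (intro arg_cong[of _ _ det]) (auto simp: vec_eq_iff axis_def Transposition.transpose_def)
    also have "\<dots> = -1"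
      using \<open>m \<noteq> n\<close> by (subst det_axis_columns_2[of m n]) (auto simp: axis_def Transposition.transpose_def)
    finally have det: "\<bar>det (matrix ?h)\<bar> = 1" by simp
    have "?h ` cbox a b = cbox (?h a) (?h b)"
    proof (intro subset_antisym subsetI)
      fix y assume "y \<in> cbox (?h a) (?h b)"
      then have "?h y \<in> cbox a b"
        by (simp add: mem_box_cart) (metis transpose_involutory)
      moreover have "y = ?h (?h y)" by (simp add: vec_eq_iff)
      ultimately show "y \<in> ?h ` cbox a b" by blast
    qed (auto simp: mem_box_cart)
    moreover have "vol (?h ` cbox a b) = vol (cbox a b)"
    proof (cases "cbox a b = {}")
      case False
      then have ne: "cbox (?h a) (?h b) \<noteq> {}" using calculation by auto
      have "(\<Prod>i\<in>UNIV. b $ Transposition.transpose m n i - a $ Transposition.transpose m n i) = (\<Prod>i\<in>UNIV. b $ i - a $ i)"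
        using prod.permute[OF permutes_swap_id[of m UNIV n], of "\<lambda>i. b $ i - a $ i"] by (simp add: o_def)
      then show ?thesis
        using False ne by (simp add: calculation content_cbox_cart)
    qed simp
    ultimately show "vol (?h ` cbox a b) = \<bar>det (matrix ?h)\<bar> * vol (cbox a b)"
      by (simp add: det)
  next
    fix m n :: 'n and a b assume "m \<noteq> n"
    let ?h = "\<lambda>x :: real^'n. \<chi> i. if i = m then x $ m + x $ n else x $ i"
    have lin: "linear ?h" by (rule linearI) (auto simp: vec_eq_iff algebra_simps)
    have "det (matrix ?h) = det (\<chi> r k. ?h (axis k 1) $ r)" by (simp add: matrix_def)
    also have "\<dots> = 1"
      using \<open>m \<noteq> n\<close> by (subst det_axis_columns_1[of n]) (auto simp: axis_def vec_eq_iff)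
    finally have det: "det (matrix ?h) = 1" .
    have "vol (?h ` cbox a b) = vol (cbox a b)"
    proof (cases "cbox a b = {}")
      case False
      \<comment> \<open>The box is moved to the origin, where \<open>measure_shear_interval\<close>
        applies; translation changes neither volume.\<close>
      have "cbox a b = (+) a ` cbox 0 (b - a)" using cbox_translation[of a 0 "b - a"] by simp
      then have "?h ` cbox a b = (+) (?h a) ` ?h ` cbox 0 (b - a)"
        by (simp add: image_comp o_def linear_add[OF lin])
      then have "vol (?h ` cbox a b) = vol (?h ` cbox 0 (b - a))" by (simp add: measure_translation)
      also have "\<dots> = vol (cbox 0 (b - a))"
        using False by (intro measure_shear_interval \<open>m \<noteq> n\<close>) (auto simp: interval_ne_empty_cart)
      also have "\<dots> = vol ((+) a ` cbox 0 (b - a))" by (rule measure_translation[symmetric])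
      finally show ?thesis using \<open>cbox a b = (+) a ` cbox 0 (b - a)\<close> by simp
    qed simp
    then show "vol (?h ` cbox a b) = \<bar>det (matrix ?h)\<bar> * vol (cbox a b)" by (simp add: det)
  qed
  then have "\<And>a b. vol (f ` cbox a b) = \<bar>det (matrix f)\<bar> * vol (cbox a b)" by blast
  from measure_linear_sufficient[OF assms this] show ?thesis by simp
qed

lemma vol_parallelepiped:
  fixes w :: "'n::finite \<Rightarrow> real^'n"
  shows "vol (\<Sum>k\<in>UNIV. seg (w k)) = \<bar>det (\<chi> r k. w k $ r)\<bar>"
proof -
  define f where "f x = (\<Sum>k\<in>UNIV. (x $ k) *\<^sub>R w k)" for x :: "real^'n"
  have lin: "linear f"
    by (rule linearI) (simp_all add: f_def sum.distrib scaleR_add_left scaleR_sum_right)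
  have f_axis: "f (axis k 1) = w k" for k
  proof -
    have "(axis k 1 $ j) *\<^sub>R w j = (if j = k then w j else 0)" for j by (simp add: axis_def)
    then show ?thesis by (simp add: f_def)
  qed
  have "(\<Sum>k\<in>UNIV. seg (w k)) = f ` cbox 0 One"
    unfolding sum_seg_axis[symmetric] linear_image_sum[OF lin finite] linear_image_seg[OF lin] f_axis ..
  moreover have "matrix f = (\<chi> r k. w k $ r)" by (simp add: matrix_def f_axis)
  ultimately show ?thesis using vol_linear_image[OF lin, of "cbox 0 One"]
    by simp
qed

section \<open>The Rayleigh property in low rank and corank\<close>

text \<open>The absolute determinant of the columns in \<open>I\<close>, which is the coefficient of
  the volume polynomial. As a volume it does not depend on an enumeration of \<open>I\<close>;
  \<open>abs_minor_bij\<close> gives the determinant for any chosen one.\<close>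

definition abs_minor :: "(nat \<Rightarrow> real^'n::finite) \<Rightarrow> nat set \<Rightarrow> real" where
  "abs_minor v I = (if card I = CARD('n) then vol (\<Sum>i\<in>I. seg (v i)) else 0)"

lemma abs_minor_nonneg [simp]: "0 \<le> abs_minor v I" by (simp add: abs_minor_def)

lemma abs_minor_card: "abs_minor (v :: nat \<Rightarrow> real^'n::finite) I \<noteq> 0 \<Longrightarrow> card I = CARD('n)"
  by (auto simp: abs_minor_def split: if_splits)

lemma abs_minor_bij:
  fixes v :: "nat \<Rightarrow> real^'n::finite"
  assumes "bij_betw \<beta> UNIV I"
  shows "abs_minor v I = \<bar>det (\<chi> r k. v (\<beta> k) $ r)\<bar>"
proof -
  have "card I = CARD('n)" using bij_betw_same_card[OF assms] by simp
  moreover have "(\<Sum>i\<in>I. seg (v i)) = (\<Sum>k\<in>UNIV. seg (v (\<beta> k)))"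
    by (rule sum.reindex_bij_betw[OF assms, symmetric])
  ultimately show ?thesis using vol_parallelepiped[of "\<lambda>k. v (\<beta> k)"] by (simp add: abs_minor_def)
qed

lemma abs_minor_linear:
  fixes v :: "nat \<Rightarrow> real^'n::finite"
  assumes "linear T"
  shows "abs_minor (\<lambda>i. T (v i)) I = \<bar>det (matrix T)\<bar> * abs_minor v I"
proof (cases "card I = CARD('n)")
  case True
  then have "finite I" by (intro card_ge_0_finite) simp
  have "(\<Sum>i\<in>I. seg (T (v i))) = T ` (\<Sum>i\<in>I. seg (v i))"
    by (simp add: linear_image_sum[OF assms \<open>finite I\<close>] linear_image_seg[OF assms])
  moreover have "(\<Sum>i\<in>I. seg (v i)) \<in> lmeasurable"
    using \<open>finite I\<close> by (intro convex_body_lmeasurable convex_body_sum) auto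
  ultimately show ?thesis using True by (simp add: abs_minor_def vol_linear_image[OF assms])
qed (simp add: abs_minor_def)

lemma abs_minor_zero_vector:
  fixes v :: "nat \<Rightarrow> real^'n::finite"
  assumes "l \<in> I" "v l = 0"
  shows "abs_minor v I = 0"
proof (cases "card I = CARD('n)")
  case True
  then have "finite I" by (intro card_ge_0_finite) simp
  then obtain \<beta> :: "'n \<Rightarrow> nat" where \<beta>: "bij_betw \<beta> UNIV I"
    using True finite_same_card_bij[of "UNIV :: 'n set" I] by auto
  then obtain k where "\<beta> k = l" using assms(1) by (metis bij_betw_imp_surj_on imageE)
  then have "column k (\<chi> r k. v (\<beta> k) $ r) = 0" using assms(2) by (simp add: column_def vec_eq_iff)
  then have "det (\<chi> r k. v (\<beta> k) $ r) = 0" by (rule det_zero_column)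
  then show ?thesis by (simp add: abs_minor_bij[OF \<beta>])
qed (simp add: abs_minor_def)

lemma exists_normalizing_map:
  fixes v :: "nat \<Rightarrow> real^'n::finite"
  assumes "bij_betw \<beta> UNIV I" "abs_minor v I \<noteq> 0"
  obtains T :: "real^'n \<Rightarrow> real^'n" where "linear T" "det (matrix T) \<noteq> 0" "\<And>k. T (v (\<beta> k)) = axis k 1"
proof -
  define M where "M = (\<chi> r k. v (\<beta> k) $ r)"
  have dM: "det M \<noteq> 0" using assms by (simp add: abs_minor_bij M_def)
  then obtain N where N: "N ** M = mat 1" using invertible_det_nz unfolding invertible_def by blast
  have "det N * det M = 1" using N by (metis det_I det_mul)
  then have "det (matrix ((*v) N)) \<noteq> 0" by auto
  moreover have "N *v v (\<beta> k) = axis k 1" for k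
  proof -
    have "v (\<beta> k) = M *v axis k 1" by (simp add: matrix_vector_mult_basis column_def M_def vec_eq_iff)
    then show ?thesis by (simp add: matrix_vector_mul_assoc N)
  qed
  ultimately show thesis using that[of "(*v) N"] by simp
qed

section \<open>Sums over subsets of a fixed size\<close>

definition subset_sum :: "nat \<Rightarrow> nat set \<Rightarrow> (nat set \<Rightarrow> real) \<Rightarrow> real" where
  "subset_sum k R F = (\<Sum>I | I \<subseteq> R \<and> card I = k. F I)"

lemma subset_sum_0: "finite R \<Longrightarrow> subset_sum 0 R F = F {}"
proof -
  assume "finite R"
  then have "{I. I \<subseteq> R \<and> card I = 0} = {{}}"
    by (auto simp: card_eq_0_iff dest: finite_subset)
  then show ?thesis by (simp add: subset_sum_def)
qed

text \<open>Double counting of the subsets with one marked element \<open>l\<close>. Iteration turns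
  sums over subsets into sums over ordered tuples, the form in which the minor inequality is
  stated.\<close>

lemma subset_sum_Suc:
  assumes "finite R"
  shows "real (Suc k) * subset_sum (Suc k) R F = (\<Sum>l\<in>R. subset_sum k (R - {l}) (\<lambda>J. F (insert l J)))"
proof -
  have fin: "finite {I. I \<subseteq> A \<and> P I}" if "finite A" for A :: "nat set" and P
    using that by (rule rev_finite_subset[OF finite_Collect_subsets]) auto
  have "real (Suc k) * subset_sum (Suc k) R F = (\<Sum>I | I \<subseteq> R \<and> card I = Suc k. \<Sum>l\<in>I. F I)"
    unfolding subset_sum_def sum_distrib_left by (intro sum.cong) auto
  also have "\<dots> = (\<Sum>(I, l)\<in>(SIGMA I:{I. I \<subseteq> R \<and> card I = Suc k}. I). F I)"
    using assms fin finite_subset[OF _ assms] by (intro sum.Sigma) auto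
  also have "\<dots> = (\<Sum>(l, J)\<in>(SIGMA l:R. {J. J \<subseteq> R - {l} \<and> card J = k}). F (insert l J))"
  proof (rule sum.reindex_bij_witness[where i = "\<lambda>(l, J). (insert l J, l)" and j = "\<lambda>(I, l). (l, I - {l})"])
    fix p assume "p \<in> (SIGMA I:{I. I \<subseteq> R \<and> card I = Suc k}. I)"
    then show "(case case p of (I, l) \<Rightarrow> (l, I - {l}) of (l, J) \<Rightarrow> (insert l J, l)) = p"
      "(case p of (I, l) \<Rightarrow> (l, I - {l})) \<in> (SIGMA l:R. {J. J \<subseteq> R - {l} \<and> card J = k})"
      "(case case p of (I, l) \<Rightarrow> (l, I - {l}) of (l, J) \<Rightarrow> F (insert l J)) = (case p of (I, l) \<Rightarrow> F I)"
      by (auto simp: insert_absorb)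
  next
    fix p assume p: "p \<in> (SIGMA l:R. {J. J \<subseteq> R - {l} \<and> card J = k})"
    then obtain l J where J: "p = (l, J)" "l \<in> R" "J \<subseteq> R - {l}" "card J = k" by auto
    then have "finite J" "l \<notin> J" using finite_subset[OF _ assms, of J] by auto
    then show "(case case p of (l, J) \<Rightarrow> (insert l J, l) of (I, l) \<Rightarrow> (l, I - {l})) = p"
      "(case p of (l, J) \<Rightarrow> (insert l J, l)) \<in> (SIGMA I:{I. I \<subseteq> R \<and> card I = Suc k}. I)"
      using J by auto
  qed
  also have "\<dots> = (\<Sum>l\<in>R. subset_sum k (R - {l}) (\<lambda>J. F (insert l J)))"
    unfolding subset_sum_def using assms fin by (intro sum.Sigma[symmetric]) auto
  finally show ?thesis .
qed

lemma sum_diff1_zero: "finite R \<Longrightarrow> (l \<in> R \<Longrightarrow> g l = 0) \<Longrightarrow> (\<Sum>r\<in>R - {l}. g r) = (\<Sum>r\<in>R. g r :: real)"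
  by (cases "l \<in> R") (simp_all add: sum_diff1)

lemma subset_sum_1: "finite R \<Longrightarrow> subset_sum 1 R F = (\<Sum>l\<in>R. F {l})"
  using subset_sum_Suc[of R 0 F] by (simp add: subset_sum_0)

lemma subset_sum_2:
  assumes R: "finite R" and eq: "\<And>l r. l \<in> R \<Longrightarrow> r \<in> R \<Longrightarrow> l \<noteq> r \<Longrightarrow> F {l, r} = G l r"
    and diag: "\<And>l. G l l = 0"
  shows "2 * subset_sum 2 R F = (\<Sum>l\<in>R. \<Sum>r\<in>R. G l r)"
proof -
  have "2 * subset_sum 2 R F = (\<Sum>l\<in>R. subset_sum 1 (R - {l}) (\<lambda>J. F (insert l J)))"
    using subset_sum_Suc[OF R, of 1 F] by (simp add: numeral_2_eq_2)
  also have "\<dots> = (\<Sum>l\<in>R. \<Sum>r\<in>R - {l}. G l r)"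
    using R eq by (intro sum.cong refl, subst subset_sum_1) (auto intro!: sum.cong)
  also have "\<dots> = (\<Sum>l\<in>R. \<Sum>r\<in>R. G l r)"
    using R diag by (intro sum.cong sum_diff1_zero) auto
  finally show ?thesis .
qed

lemma subset_sum_3:
  assumes R: "finite R"
    and eq: "\<And>l r s. l \<in> R \<Longrightarrow> r \<in> R \<Longrightarrow> s \<in> R \<Longrightarrow> distinct [l, r, s] \<Longrightarrow> F {l, r, s} = G l r s"
    and diag: "\<And>l r. G l l r = 0" "\<And>l r. G l r l = 0" "\<And>l r. G l r r = 0"
  shows "6 * subset_sum 3 R F = (\<Sum>l\<in>R. \<Sum>r\<in>R. \<Sum>s\<in>R. G l r s)"
proof -
  have "3 * subset_sum 3 R F = (\<Sum>l\<in>R. subset_sum 2 (R - {l}) (\<lambda>J. F (insert l J)))"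
    using subset_sum_Suc[OF R, of 2 F] by (simp add: numeral_3_eq_3)
  then have "6 * subset_sum 3 R F = (\<Sum>l\<in>R. 2 * subset_sum 2 (R - {l}) (\<lambda>J. F (insert l J)))"
    by (simp flip: sum_distrib_left)
  also have "\<dots> = (\<Sum>l\<in>R. \<Sum>r\<in>R - {l}. \<Sum>s\<in>R - {l}. G l r s)"
    using R eq diag by (intro sum.cong refl subset_sum_2) auto
  also have "\<dots> = (\<Sum>l\<in>R. \<Sum>r\<in>R - {l}. \<Sum>s\<in>R. G l r s)"
    using R diag by (intro sum.cong sum_diff1_zero refl) auto
  also have "\<dots> = (\<Sum>l\<in>R. \<Sum>r\<in>R. \<Sum>s\<in>R. G l r s)"
    using R diag by (intro sum.cong sum_diff1_zero refl) auto
  finally show ?thesis .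
qed

lemma subset_poly_subset_sum:
  assumes "finite R" "\<And>I. I \<subseteq> R \<Longrightarrow> c I \<noteq> 0 \<Longrightarrow> card I = k"
  shows "subset_poly R c x = subset_sum k R (\<lambda>I. c I * (\<Prod>i\<in>I. x i))"
  unfolding subset_poly_def subset_sum_def using assms
  by (intro sum.mono_neutral_right) auto

text \<open>The substitution \<open>x = 1 / y\<close> turns sums over subsets into sums over their complements.\<close>
lemma subset_poly_subset_sum_complement:
  assumes R: "finite R" and c: "\<And>I. I \<subseteq> R \<Longrightarrow> c I \<noteq> 0 \<Longrightarrow> card I + k = card R"
    and x: "\<And>i. i \<in> R \<Longrightarrow> x i \<noteq> 0"
  shows "subset_poly R c x = (\<Prod>i\<in>R. x i) * subset_sum k R (\<lambda>L. c (R - L) * (\<Prod>i\<in>L. 1 / x i))"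
proof -
  have "subset_poly R c x = (\<Sum>L\<in>Pow R. c (R - L) * (\<Prod>i\<in>R - L. x i))"
    unfolding subset_poly_def
    by (rule sum.reindex_bij_witness[where i = "\<lambda>L. R - L" and j = "\<lambda>L. R - L"]) (auto simp: double_diff)
  also have "\<dots> = (\<Sum>L\<in>Pow R. (\<Prod>i\<in>R. x i) * (c (R - L) * (\<Prod>i\<in>L. 1 / x i)))"
  proof (rule sum.cong[OF refl])
    fix L assume L: "L \<in> Pow R"
    then have "(\<Prod>i\<in>R. x i) = (\<Prod>i\<in>R - L. x i) * (\<Prod>i\<in>L. x i)"
      using R by (intro prod.subset_diff) auto
    moreover have "(\<Prod>i\<in>L. x i) * (\<Prod>i\<in>L. 1 / x i) = 1"
      using L x by (simp add: prod.distrib[symmetric] subset_iff)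
    ultimately have "(\<Prod>i\<in>R. x i) * (\<Prod>i\<in>L. 1 / x i) = (\<Prod>i\<in>R - L. x i)"
      by (simp add: mult.assoc)
    then show "c (R - L) * (\<Prod>i\<in>R - L. x i) = (\<Prod>i\<in>R. x i) * (c (R - L) * (\<Prod>i\<in>L. 1 / x i))"
      by (simp add: mult.left_commute)
  qed
  also have "\<dots> = (\<Prod>i\<in>R. x i) * (\<Sum>L\<in>Pow R. c (R - L) * (\<Prod>i\<in>L. 1 / x i))"
    by (simp add: sum_distrib_left)
  also have "(\<Sum>L\<in>Pow R. c (R - L) * (\<Prod>i\<in>L. 1 / x i)) = subset_sum k R (\<lambda>L. c (R - L) * (\<Prod>i\<in>L. 1 / x i))"
    unfolding subset_sum_def
  proof (intro sum.mono_neutral_right ballI)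
    fix L assume L: "L \<in> Pow R - {I. I \<subseteq> R \<and> card I = k}"
    then have "card (R - L) + card L = card R"
      using R by (simp add: card_Diff_subset finite_subset[OF _ R] card_mono)
    then have "c (R - L) = 0" using c[of "R - L"] L by (cases "c (R - L) = 0") auto
    then show "c (R - L) * (\<Prod>i\<in>L. 1 / x i) = 0" by simp
  qed (use R in auto)
  finally show ?thesis .
qed

text \<open>This is \<open>g k \<le> h h\<close> with \<open>R\<close> the set of remaining indices.
  \<open>R\<close> is an arbitrary set rather than an initial segment, so that it can be enlarged by
  further indices.\<close>

definition rayleigh_at :: "(nat \<Rightarrow> real^'n::finite) \<Rightarrow> nat set \<Rightarrow> nat \<Rightarrow> nat \<Rightarrow> (nat \<Rightarrow> real) \<Rightarrow> bool" where
  "rayleigh_at v R i j x \<longleftrightarrow>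
     subset_poly R (abs_minor v) x * subset_poly R (\<lambda>I. abs_minor v (insert i (insert j I))) x \<le>
     subset_poly R (\<lambda>I. abs_minor v (insert i I)) x * subset_poly R (\<lambda>I. abs_minor v (insert j I)) x"

lemma subset_poly_scale: "subset_poly R (\<lambda>I. r * c I) x = r * subset_poly R c x"
  by (simp add: subset_poly_def sum_distrib_left mult.assoc)

text \<open>Both sides are quadratic in the minors, and all minors scale by the same factor; hence a
  basis among the vectors may be moved to the standard basis.\<close>

lemma rayleigh_at_linear:
  assumes "linear T" "det (matrix T) \<noteq> 0" "rayleigh_at (\<lambda>i. T (v i)) R i j x"
  shows "rayleigh_at v R i j x"
proof -
  define D where "D = \<bar>det (matrix T)\<bar>"
  have "D > 0" using assms(2) by (simp add: D_def)
  have "D * D * (subset_poly R (abs_minor v) x * subset_poly R (\<lambda>I. abs_minor v (insert i (insert j I))) x)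
      \<le> D * D * (subset_poly R (\<lambda>I. abs_minor v (insert i I)) x * subset_poly R (\<lambda>I. abs_minor v (insert j I)) x)"
    using assms(3) unfolding rayleigh_at_def abs_minor_linear[OF assms(1)] subset_poly_scale D_def[symmetric]
    by (simp add: mult_ac)
  then show ?thesis unfolding rayleigh_at_def using \<open>D > 0\<close> by simp
qed

text \<open>Disposes of the cases in which there is no basis to normalize: if \<open>g\<close> or
  \<open>k\<close> is nonzero, then so is one of the minors in it.\<close>

lemma rayleigh_at_trivial:
  assumes "subset_poly R (abs_minor v) x = 0 \<or> subset_poly R (\<lambda>I. abs_minor v (insert i (insert j I))) x = 0"
    "\<And>i. i \<in> R \<Longrightarrow> 0 \<le> x i"
  shows "rayleigh_at v R i j x"
proof -
  have "0 \<le> subset_poly R (\<lambda>I. abs_minor v (insert i I)) x * subset_poly R (\<lambda>I. abs_minor v (insert j I)) x"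
    by (intro mult_nonneg_nonneg subset_poly_nonneg assms(2)) auto
  then show ?thesis using assms(1) by (auto simp: rayleigh_at_def)
qed

lemma subset_poly_neq_0E:
  assumes "subset_poly R c x \<noteq> 0"
  obtains I where "I \<subseteq> R" "c I \<noteq> 0"
proof -
  have "\<exists>I\<in>Pow R. c I * (\<Prod>i\<in>I. x i) \<noteq> 0"
    using assms unfolding subset_poly_def by (meson sum.neutral)
  then show thesis using that by auto
qed

text \<open>The inequality behind dimension two: there \<open>k\<close> is a single minor,
  normalized to 1, and the triangle inequality is enough.\<close>

lemma minor_sum2_le_minor_sum1: 
  assumes "finite R" "\<And>l. l \<in> R \<Longrightarrow> 0 \<le> w l"
  shows "minor_sum2 R w a c \<le> 2 * minor_sum1 R w a * minor_sum1 R w c"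
proof -
  have "minor_sum2 R w a c \<le> (\<Sum>l\<in>R. \<Sum>r\<in>R. (w l * \<bar>a l\<bar>) * (w r * \<bar>c r\<bar>) + (w r * \<bar>a r\<bar>) * (w l * \<bar>c l\<bar>))"
    unfolding minor_sum2_def
  proof (intro sum_mono)
    fix l r assume "l \<in> R" "r \<in> R"
    then have "w l * w r * \<bar>a l * c r - a r * c l\<bar> \<le> w l * w r * (\<bar>a l\<bar> * \<bar>c r\<bar> + \<bar>a r\<bar> * \<bar>c l\<bar>)"
      using assms(2) abs_triangle_ineq4[of "a l * c r" "a r * c l"]
      by (intro mult_left_mono) (auto simp: abs_mult)
    then show "w l * w r * \<bar>a l * c r - a r * c l\<bar> \<le> (w l * \<bar>a l\<bar>) * (w r * \<bar>c r\<bar>) + (w r * \<bar>a r\<bar>) * (w l * \<bar>c l\<bar>)"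
      by (simp add: algebra_simps)
  qed
  also have "\<dots> = minor_sum1 R w a * minor_sum1 R w c + minor_sum1 R w a * minor_sum1 R w c"
    unfolding minor_sum1_def sum.distrib
    by (simp add: sum_product) (rule sum.swap)
  finally show ?thesis by simp
qed

lemma minor3_same: "minor3 a b c l l s = 0" "minor3 a b c l s l = 0" "minor3 a b c s l l = 0"
  by (simp_all add: minor3_def algebra_simps)

lemma bij_betw_upd:
  assumes "bij_betw \<beta> UNIV I" "l \<notin> I"
  shows "bij_betw (\<beta>(k := l)) UNIV (insert l (I - {\<beta> k}))"
proof -
  have "inj (\<beta>(k := l))" using assms by (auto simp: bij_betw_def inj_def)
  moreover have "range (\<beta>(k := l)) = insert l (I - {\<beta> k})"
    using assms by (auto simp: bij_betw_def inj_def)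
  ultimately show ?thesis by (simp add: bij_betw_def)
qed

section \<open>Minors after exchanging columns of the standard basis\<close>

lemma abs_minor_replace_0:
  fixes v :: "nat \<Rightarrow> real^'n::finite"
  assumes "bij_betw \<beta> UNIV I" "\<And>k. v (\<beta> k) = axis k 1"
  shows "abs_minor v I = 1"
  using abs_minor_bij[OF assms(1), of v] det_axis_columns_0[of "\<lambda>k. v (\<beta> k)"] assms(2) by simp

lemma abs_minor_replace_1:
  fixes v :: "nat \<Rightarrow> real^'n::finite"
  assumes \<beta>: "bij_betw \<beta> UNIV I" and ax: "\<And>k. v (\<beta> k) = axis k 1"
    and l: "l \<notin> I" and J: "J = insert l (I - {\<beta> p})"
  shows "abs_minor v J = \<bar>v l $ p\<bar>"
proof -
  have "bij_betw (\<beta>(p := l)) UNIV J" unfolding J by (rule bij_betw_upd[OF \<beta> l])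
  from abs_minor_bij[OF this, of v] det_axis_columns_1[of p "\<lambda>k. v ((\<beta>(p := l)) k)"] show ?thesis
    using ax by simp
qed

lemma abs_minor_replace_2:
  fixes v :: "nat \<Rightarrow> real^'n::finite"
  assumes \<beta>: "bij_betw \<beta> UNIV I" and ax: "\<And>k. v (\<beta> k) = axis k 1"
    and l: "l \<notin> I" "r \<notin> I" "l \<noteq> r" and pq: "p \<noteq> q"
    and J: "J = insert l (insert r (I - {\<beta> p, \<beta> q}))"
  shows "abs_minor v J = \<bar>v l $ p * v r $ q - v r $ p * v l $ q\<bar>"
proof -
  have 1: "bij_betw (\<beta>(p := l)) UNIV (insert l (I - {\<beta> p}))" by (rule bij_betw_upd[OF \<beta> l(1)])
  have "\<beta> q \<noteq> l" "\<beta> q \<in> I" using l \<beta> by (auto simp: bij_betw_def)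
  then have "J = insert r (insert l (I - {\<beta> p}) - {(\<beta>(p := l)) q})" using J pq by auto
  then have "bij_betw (\<beta>(p := l, q := r)) UNIV J"
    using bij_betw_upd[OF 1, of r q] l by auto
  from abs_minor_bij[OF this, of v] det_axis_columns_2[of p q "\<lambda>k. v ((\<beta>(p := l, q := r)) k)"] show ?thesis
    using ax pq by simp
qed

lemma abs_minor_replace_3:
  fixes v :: "nat \<Rightarrow> real^'n::finite"
  assumes \<beta>: "bij_betw \<beta> UNIV I" and ax: "\<And>k. v (\<beta> k) = axis k 1"
    and l: "l \<notin> I" "r \<notin> I" "s \<notin> I" "distinct [l, r, s]" and pq: "distinct [p, q, t]"
    and J: "J = insert l (insert r (insert s (I - {\<beta> p, \<beta> q, \<beta> t})))"
  shows "abs_minor v J = \<bar>minor3 (\<lambda>l. v l $ p) (\<lambda>l. v l $ q) (\<lambda>l. v l $ t) l r s\<bar>"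
proof -
  let ?\<beta>1 = "\<beta>(p := l)" and ?\<beta>2 = "\<beta>(p := l, q := r)"
  have 1: "bij_betw ?\<beta>1 UNIV (insert l (I - {\<beta> p}))" by (rule bij_betw_upd[OF \<beta> l(1)])
  have *: "\<beta> q \<in> I" "\<beta> t \<in> I" using \<beta> by (auto simp: bij_betw_def)
  have "bij_betw ?\<beta>2 UNIV (insert r (insert l (I - {\<beta> p}) - {?\<beta>1 q}))"
    using l pq by (intro bij_betw_upd[OF 1]) auto
  also have "insert r (insert l (I - {\<beta> p}) - {?\<beta>1 q}) = insert r (insert l (I - {\<beta> p, \<beta> q}))"
    using l pq * by auto
  finally have 2: "bij_betw ?\<beta>2 UNIV (insert r (insert l (I - {\<beta> p, \<beta> q})))" .
  have "J = insert s (insert r (insert l (I - {\<beta> p, \<beta> q})) - {?\<beta>2 t})"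
    using J l pq * by auto
  then have "bij_betw (?\<beta>2(t := s)) UNIV J"
    using bij_betw_upd[OF 2, of s t] l by auto
  from abs_minor_bij[OF this, of v] det_axis_columns_3[of p q t "\<lambda>k. v ((?\<beta>2(t := s)) k)"] show ?thesis
    using ax pq by (simp add: minor3_def)
qed

lemma rayleigh_at_dim_2:
  fixes v :: "nat \<Rightarrow> real^'n::finite"
  assumes n: "CARD('n) = 2" and R: "finite R" and i: "i \<notin> R" "j \<notin> R" "i \<noteq> j"
    and x: "\<And>l. l \<in> R \<Longrightarrow> 0 \<le> x l"
  shows "rayleigh_at v R i j x"
proof (cases "subset_poly R (\<lambda>I. abs_minor v (insert i (insert j I))) x = 0")
  case False
  then obtain I where I: "I \<subseteq> R" "abs_minor v (insert i (insert j I)) \<noteq> 0" by (elim subset_poly_neq_0E)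
  have fI: "finite I" using I(1) R finite_subset by blast
  have "i \<notin> I" "j \<notin> I" using I(1) i by auto
  then have "I = {}" using abs_minor_card[OF I(2)] fI i n by auto
  then have nz: "abs_minor v {i, j} \<noteq> 0" using I by simp
  then obtain \<beta> :: "'n \<Rightarrow> nat" where \<beta>: "bij_betw \<beta> UNIV {i, j}"
    using abs_minor_card[OF nz] finite_same_card_bij[of "UNIV :: 'n set" "{i, j}"] by auto
  obtain T :: "real^'n \<Rightarrow> real^'n" where T: "linear T" "det (matrix T) \<noteq> 0" "\<And>k. T (v (\<beta> k)) = axis k 1"
    using exists_normalizing_map[OF \<beta> nz] by blast
  define u where "u i = T (v i)" for i
  have ax: "u (\<beta> k) = axis k 1" for k using T(3) by (simp add: u_def)
  obtain p q where pq: "\<beta> p = i" "\<beta> q = j" using \<beta> by (metis bij_betw_imp_surj_on imageE insertCI)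
  then have "p \<noteq> q" using i by auto
  define a b where "a l = u l $ p" and "b l = u l $ q" for l
  have "rayleigh_at u R i j x"
  proof -
    have cc: "card I = 0" "I = {}" if "I \<subseteq> R" "abs_minor u (insert i (insert j I)) \<noteq> 0" for I
    proof -
      have "finite I" "i \<notin> I" "j \<notin> I" using that(1) R i finite_subset by auto
      then show "card I = 0" "I = {}" using abs_minor_card[OF that(2)] i n by auto
    qed
    have c1: "card I = 1" if "I \<subseteq> R" "abs_minor u (insert l I) \<noteq> 0" "l \<notin> R" for I l
    proof -
      have "finite I" "l \<notin> I" using that R i finite_subset by auto
      then show ?thesis using abs_minor_card[OF that(2)] n by auto
    qed
    have g: "2 * subset_poly R (abs_minor u) x = minor_sum2 R x a b"
    proof -
      have "subset_poly R (abs_minor u) x = subset_sum 2 R (\<lambda>I. abs_minor u I * (\<Prod>i\<in>I. x i))"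
        using n abs_minor_card by (intro subset_poly_subset_sum R) fastforce
      moreover have "2 * subset_sum 2 R (\<lambda>I. abs_minor u I * (\<Prod>i\<in>I. x i)) = (\<Sum>l\<in>R. \<Sum>r\<in>R. x l * x r * \<bar>a l * b r - a r * b l\<bar>)"
      proof (rule subset_sum_2[OF R])
        fix l r assume "l \<in> R" "r \<in> R" "l \<noteq> r"
        moreover have "abs_minor u {l, r} = \<bar>a l * b r - a r * b l\<bar>"
          unfolding a_def b_def
          by (rule abs_minor_replace_2[OF \<beta> ax]) (use i pq \<open>p \<noteq> q\<close> calculation in auto)
        ultimately show "abs_minor u {l, r} * prod x {l, r} = x l * x r * \<bar>a l * b r - a r * b l\<bar>" by simp
      qed simp
      ultimately show ?thesis by (simp add: minor_sum2_def)
    qed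
    have h: "subset_poly R (\<lambda>I. abs_minor u (insert k I)) x = minor_sum1 R x a'"
      if "k \<notin> R" "\<And>l. l \<in> R \<Longrightarrow> abs_minor u {k, l} = \<bar>a' l\<bar>" for k a'
    proof -
      have "subset_poly R (\<lambda>I. abs_minor u (insert k I)) x = (\<Sum>l\<in>R. abs_minor u (insert k {l}) * (\<Prod>i\<in>{l}. x i))"
        using c1 that(1) by (subst subset_poly_subset_sum[OF R, of _ 1]) (simp_all only: subset_sum_1[OF R])
      then show ?thesis using that(2) by (simp add: minor_sum1_def mult.commute)
    qed
    \<comment> \<open>Column \<open>i\<close> is the unit vector of row \<open>p\<close>, so in the
      minors containing it only row \<open>q\<close> survives.\<close>
    have hi: "subset_poly R (\<lambda>I. abs_minor u (insert i I)) x = minor_sum1 R x b"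
      unfolding b_def[abs_def] using i pq \<open>p \<noteq> q\<close> by (intro h abs_minor_replace_1[OF \<beta> ax]) auto
    have hj: "subset_poly R (\<lambda>I. abs_minor u (insert j I)) x = minor_sum1 R x a"
      unfolding a_def[abs_def] using i pq \<open>p \<noteq> q\<close> by (intro h abs_minor_replace_1[OF \<beta> ax]) auto
    have k: "subset_poly R (\<lambda>I. abs_minor u (insert i (insert j I))) x = 1"
    proof -
      have "subset_poly R (\<lambda>I. abs_minor u (insert i (insert j I))) x = abs_minor u {i, j}"
        using cc(1) by (subst subset_poly_subset_sum[OF R, of _ 0]) (auto simp: subset_sum_0[OF R])
      also have "\<dots> = 1" by (rule abs_minor_replace_0[OF \<beta> ax])
      finally show ?thesis .
    qed
    have "minor_sum2 R x a b \<le> 2 * minor_sum1 R x a * minor_sum1 R x b" using R x by (intro minor_sum2_le_minor_sum1)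
    also have "\<dots> = 2 * (minor_sum1 R x b * minor_sum1 R x a)" by simp
    finally show ?thesis unfolding rayleigh_at_def hi hj k using g by linarith
  qed
  then show ?thesis using rayleigh_at_linear[OF T(1,2)] by (simp add: u_def[abs_def])
qed (use rayleigh_at_trivial x in blast)

lemma abs_minor_cong: "(\<And>l. l \<in> I \<Longrightarrow> v l = v' l) \<Longrightarrow> abs_minor v I = abs_minor v' I"
  unfolding abs_minor_def by (simp cong: sum.cong)

lemma rayleigh_at_cong:
  assumes "\<And>l. l \<in> insert i (insert j R) \<Longrightarrow> v l = v' l"
  shows "rayleigh_at v R i j x = rayleigh_at v' R i j x"
proof -
  have "subset_poly R (\<lambda>I. abs_minor v (f I)) x = subset_poly R (\<lambda>I. abs_minor v' (f I)) x"
    if "\<And>I. I \<subseteq> R \<Longrightarrow> f I \<subseteq> insert i (insert j R)" for f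
    using that assms by (intro subset_poly_cong abs_minor_cong) blast+
  from this[of "\<lambda>I. I"] this[of "insert i"] this[of "insert j"] this[of "\<lambda>I. insert i (insert j I)"]
  have "subset_poly R (abs_minor v) x = subset_poly R (abs_minor v') x" "subset_poly R (\<lambda>I. abs_minor v (insert i I)) x = subset_poly R (\<lambda>I. abs_minor v' (insert i I)) x"
    "subset_poly R (\<lambda>I. abs_minor v (insert j I)) x = subset_poly R (\<lambda>I. abs_minor v' (insert j I)) x"
    "subset_poly R (\<lambda>I. abs_minor v (insert i (insert j I))) x = subset_poly R (\<lambda>I. abs_minor v' (insert i (insert j I))) x"
    by auto
  then show ?thesis by (simp only: rayleigh_at_def)
qed

text \<open>Unless \<open>k\<close> vanishes, some \<open>m\<close> in \<open>R\<close> completes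
  \<open>i\<close>, \<open>j\<close> to a basis. In its coordinates, including column
  \<open>i\<close> deletes row \<open>a\<close> and including column \<open>j\<close> deletes row
  \<open>b\<close>, so the four polynomials are exactly the sums in
  \<open>minor_inequality\<close>.\<close>

lemma rayleigh_at_dim_3:
  fixes v :: "nat \<Rightarrow> real^'n::finite"
  assumes n: "CARD('n) = 3" and R: "finite R" and i: "i \<notin> R" "j \<notin> R" "i \<noteq> j"
    and x: "\<And>l. l \<in> R \<Longrightarrow> 0 \<le> x l"
  shows "rayleigh_at v R i j x"
proof (cases "subset_poly R (\<lambda>I. abs_minor v (insert i (insert j I))) x = 0")
  case False
  then obtain I where I: "I \<subseteq> R" "abs_minor v (insert i (insert j I)) \<noteq> 0" by (elim subset_poly_neq_0E)
  have fI: "finite I" using I(1) R finite_subset by blast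
  have "i \<notin> I" "j \<notin> I" using I(1) i by auto
  then have "card I = 1" using abs_minor_card[OF I(2)] fI i n by auto
  then obtain m where m: "I = {m}" by (auto simp: card_1_singleton_iff)
  then have nz: "abs_minor v {i, j, m} \<noteq> 0" and mR: "m \<in> R" using I by auto
  text \<open>A copy \<open>f\<close> of \<open>m\<close> outside \<open>R\<close> keeps the reference basis disjoint from the columns exchanged into it.\<close>
  obtain f where f: "f \<notin> insert i (insert j R)" using R by (metis finite_insert ex_new_if_finite infinite_UNIV_nat)
  have mf: "m \<noteq> i" "m \<noteq> j" "f \<noteq> i" "f \<noteq> j" using mR f i by auto
  define v' where "v' = v(f := v m)"
  have "bij_betw (\<lambda>l. if l = m then f else l) {i, j, m} {i, j, f}"
    using mf by (auto simp: bij_betw_def inj_on_def)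
  then have "(\<Sum>l\<in>{i, j, f}. seg (v' l)) = (\<Sum>l\<in>{i, j, m}. seg (v l))"
    using mf i by (simp add: v'_def)
  then have nz: "abs_minor v' {i, j, f} \<noteq> 0" using nz mf i by (simp add: abs_minor_def n)
  then obtain \<beta> :: "'n \<Rightarrow> nat" where \<beta>: "bij_betw \<beta> UNIV {i, j, f}"
    using abs_minor_card[OF nz] finite_same_card_bij[of "UNIV :: 'n set" "{i, j, f}"] by auto
  obtain T :: "real^'n \<Rightarrow> real^'n" where T: "linear T" "det (matrix T) \<noteq> 0" "\<And>k. T (v' (\<beta> k)) = axis k 1"
    using exists_normalizing_map[OF \<beta> nz] by blast
  define u where "u i = T (v' i)" for i
  have ax: "u (\<beta> k) = axis k 1" for k using T(3) by (simp add: u_def)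
  obtain p q t where pqt: "\<beta> p = i" "\<beta> q = j" "\<beta> t = f"
    using \<beta> by (metis bij_betw_imp_surj_on imageE insertCI)
  then have d: "p \<noteq> q" "p \<noteq> t" "q \<noteq> t" using i f by auto
  define a b c where "a l = u l $ p" and "b l = u l $ q" and "c l = u l $ t" for l
  have notI: "l \<notin> {i, j, f}" if "l \<in> R" for l using that i f by auto
  have rayleigh_at_u: "rayleigh_at u R i j x"
  proof -
    have c1: "card I = 1" if "I \<subseteq> R" "abs_minor u (insert i (insert j I)) \<noteq> 0" for I
    proof -
      have "finite I" "i \<notin> I" "j \<notin> I" using that(1) R i finite_subset by auto
      then show "card I = 1" using abs_minor_card[OF that(2)] i n by auto
    qed
    have c2: "card I = 2" if "I \<subseteq> R" "abs_minor u (insert l I) \<noteq> 0" "l \<notin> R" for I l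
    proof -
      have "finite I" "l \<notin> I" using that R i finite_subset by auto
      then show ?thesis using abs_minor_card[OF that(2)] n by auto
    qed
    have g: "6 * subset_poly R (abs_minor u) x = minor_sum3 R x a b c"
    proof -
      have "subset_poly R (abs_minor u) x = subset_sum 3 R (\<lambda>I. abs_minor u I * (\<Prod>i\<in>I. x i))"
        using n abs_minor_card by (intro subset_poly_subset_sum R) fastforce
      moreover have "6 * subset_sum 3 R (\<lambda>I. abs_minor u I * (\<Prod>i\<in>I. x i)) =
          (\<Sum>l\<in>R. \<Sum>r\<in>R. \<Sum>s\<in>R. x l * x r * x s * \<bar>minor3 a b c l r s\<bar>)"
      proof (rule subset_sum_3[OF R])
        fix l r s assume *: "l \<in> R" "r \<in> R" "s \<in> R" "distinct [l, r, s]"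
        have "abs_minor u {l, r, s} = \<bar>minor3 a b c l r s\<bar>"
          unfolding a_def[abs_def] b_def[abs_def] c_def[abs_def]
          by (rule abs_minor_replace_3[OF \<beta> ax]) (use * pqt d notI in \<open>auto\<close>)
        then show "abs_minor u {l, r, s} * prod x {l, r, s} = x l * x r * x s * \<bar>minor3 a b c l r s\<bar>"
          using * by simp
      qed (simp_all add: minor3_same)
      ultimately show ?thesis by (simp add: minor_sum3_def)
    qed
    have h: "2 * subset_poly R (\<lambda>I. abs_minor u (insert k I)) x = minor_sum2 R x a' b'"
      if "k \<notin> R" and ab: "\<And>l r. l \<in> R \<Longrightarrow> r \<in> R \<Longrightarrow> l \<noteq> r \<Longrightarrow> abs_minor u {k, l, r} = \<bar>a' l * b' r - a' r * b' l\<bar>" for k a' b'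
    proof -
      have "subset_poly R (\<lambda>I. abs_minor u (insert k I)) x = subset_sum 2 R (\<lambda>I. abs_minor u (insert k I) * (\<Prod>i\<in>I. x i))"
        using c2 \<open>k \<notin> R\<close> by (intro subset_poly_subset_sum R) auto
      moreover have "2 * subset_sum 2 R (\<lambda>I. abs_minor u (insert k I) * (\<Prod>i\<in>I. x i)) = (\<Sum>l\<in>R. \<Sum>r\<in>R. x l * x r * \<bar>a' l * b' r - a' r * b' l\<bar>)"
        by (rule subset_sum_2[OF R]) (simp_all add: ab)
      ultimately show ?thesis by (simp add: minor_sum2_def)
    qed
    have hi: "2 * subset_poly R (\<lambda>I. abs_minor u (insert i I)) x = minor_sum2 R x b c"
    proof (rule h[OF i(1)])
      fix l r assume "l \<in> R" "r \<in> R" "l \<noteq> r"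
      then show "abs_minor u {i, l, r} = \<bar>b l * c r - b r * c l\<bar>"
        unfolding b_def c_def
        by (intro abs_minor_replace_2[OF \<beta> ax]) (use i mf d pqt notI[of l] notI[of r] in auto)
    qed
    have hj: "2 * subset_poly R (\<lambda>I. abs_minor u (insert j I)) x = minor_sum2 R x a c"
    proof (rule h[OF i(2)])
      fix l r assume "l \<in> R" "r \<in> R" "l \<noteq> r"
      then show "abs_minor u {j, l, r} = \<bar>a l * c r - a r * c l\<bar>"
        unfolding a_def c_def
        by (intro abs_minor_replace_2[OF \<beta> ax]) (use i mf d pqt notI[of l] notI[of r] in auto)
    qed
    have k: "subset_poly R (\<lambda>I. abs_minor u (insert i (insert j I))) x = minor_sum1 R x c"
    proof -
      have "subset_poly R (\<lambda>I. abs_minor u (insert i (insert j I))) x = (\<Sum>l\<in>R. abs_minor u {i, j, l} * (\<Prod>i\<in>{l}. x i))"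
        using c1 by (subst subset_poly_subset_sum[OF R, of _ 1]) (simp_all only: subset_sum_1[OF R])
      moreover have "abs_minor u {i, j, l} = \<bar>c l\<bar>" if "l \<in> R" for l
        unfolding c_def using i mf d pqt notI[OF that] by (intro abs_minor_replace_1[OF \<beta> ax]) auto
      ultimately show ?thesis by (simp add: minor_sum1_def mult.commute)
    qed
    have "2 * (6 * subset_poly R (abs_minor u) x) * subset_poly R (\<lambda>I. abs_minor u (insert i (insert j I))) x \<le>
        3 * (2 * subset_poly R (\<lambda>I. abs_minor u (insert j I)) x) * (2 * subset_poly R (\<lambda>I. abs_minor u (insert i I)) x)"
      unfolding g hi hj k by (rule minor_inequality[OF R x])
    then show ?thesis unfolding rayleigh_at_def by (simp add: mult.commute)
  qed
  then have "rayleigh_at v' R i j x" using rayleigh_at_linear[OF T(1,2)] by (simp add: u_def[abs_def])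
  moreover have "rayleigh_at v R i j x = rayleigh_at v' R i j x"
    by (rule rayleigh_at_cong) (use f in \<open>auto simp: v'_def\<close>)
  ultimately show ?thesis by simp
qed (use rayleigh_at_trivial x in blast)

lemma minor3_perm: "\<bar>minor3 a b c l r s\<bar> = \<bar>minor3 a b c r l s\<bar>" "\<bar>minor3 a b c l r s\<bar> = \<bar>minor3 a b c l s r\<bar>"
proof -
  have "minor3 a b c l r s = - minor3 a b c r l s" "minor3 a b c l r s = - minor3 a b c l s r"
    by (simp_all add: minor3_def algebra_simps)
  then show "\<bar>minor3 a b c l r s\<bar> = \<bar>minor3 a b c r l s\<bar>" "\<bar>minor3 a b c l r s\<bar> = \<bar>minor3 a b c l s r\<bar>" by simp_all
qed

text \<open>Corank three, by matroid duality: after normalizing a basis contained in \<open>R\<close>, the maximal minors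
  avoiding a set \<open>L\<close> of at most three vectors are the minors on the columns \<open>L\<close> of the
  three-row matrix \<open>(a, b, c)\<close> formed by \<open>v i\<close>, \<open>v j\<close> and the one vector \<open>v s\<close> outside the basis.\<close>
lemma rayleigh_at_corank_3:
  fixes v :: "nat \<Rightarrow> real^'n::finite"
  assumes n: "card R = CARD('n) + 1" and i: "i \<notin> R" "j \<notin> R" "i \<noteq> j"
    and x: "\<And>l. l \<in> R \<Longrightarrow> 0 < x l"
  shows "rayleigh_at v R i j x"
proof (cases "subset_poly R (abs_minor v) x = 0")
  case False
  have R: "finite R" using n by (intro card_ge_0_finite) simp
  from False obtain B where B: "B \<subseteq> R" "abs_minor v B \<noteq> 0" by (elim subset_poly_neq_0E)
  have fB: "finite B" using B(1) R finite_subset by blast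
  have "card (R - B) = 1" using abs_minor_card[OF B(2)] n B(1) fB by (simp add: card_Diff_subset)
  then obtain s where "R - B = {s}" by (auto simp: card_1_singleton_iff)
  then have s: "R = insert s B" "s \<notin> B" "s \<in> R" using B(1) by auto
  obtain \<beta> :: "'n \<Rightarrow> nat" where \<beta>: "bij_betw \<beta> UNIV B"
    using abs_minor_card[OF B(2)] finite_same_card_bij[of "UNIV :: 'n set" B] fB by auto
  obtain T :: "real^'n \<Rightarrow> real^'n" where T: "linear T" "det (matrix T) \<noteq> 0" "\<And>k. T (v (\<beta> k)) = axis k 1"
    using exists_normalizing_map[OF \<beta> B(2)] by blast
  define u where "u i = T (v i)" for i
  have ax: "u (\<beta> k) = axis k 1" for k using T(3) by (simp add: u_def)
  define \<gamma> where "\<gamma> = inv_into UNIV \<beta>"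
  have \<gamma>: "\<beta> (\<gamma> l) = l" if "l \<in> B" for l using \<beta> that by (simp add: \<gamma>_def bij_betw_inv_into_right)
  then have \<gamma>_inj: "\<gamma> l \<noteq> \<gamma> r" if "l \<in> B" "r \<in> B" "l \<noteq> r" for l r using that by metis
  \<comment> \<open>The rows are coefficients of linear relations: \<open>u i\<close> and
    \<open>u j\<close> are the combinations of the \<open>u l\<close>, \<open>l\<close> in
    \<open>R\<close>, with coefficients \<open>a\<close> and \<open>b\<close>, and the combination
    with coefficients \<open>c\<close> is 0, whence the entry -1 at \<open>s\<close>. Maximal minors
    of such a relation matrix are, up to sign, the complementary minors of the vectors.\<close>
  define a b c where "a l = (if l = s then 0 else u i $ \<gamma> l)" and "b l = (if l = s then 0 else u j $ \<gamma> l)"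
    and "c l = (if l = s then -1 else u s $ \<gamma> l)" for l
  have notB: "i \<notin> B" "j \<notin> B" "i \<noteq> s" "j \<noteq> s" using i s by auto
  have m1: "abs_minor u (R - {l}) = \<bar>c l\<bar>" if "l \<in> R" for l
  proof (cases "l = s")
    case True
    then show ?thesis using s abs_minor_replace_0[OF \<beta> ax] by (simp add: c_def)
  next
    case False
    then have "l \<in> B" using that s by auto
    then show ?thesis using False s \<gamma> by (simp add: c_def) (intro abs_minor_replace_1[OF \<beta> ax], auto)
  qed
  have m2: "abs_minor u (insert k (R - {l, r})) = \<bar>a' l * c r - a' r * c l\<bar>"
    if lr: "l \<in> R" "r \<in> R" "l \<noteq> r" and k: "k \<notin> R" and a': "\<And>l. a' l = (if l = s then 0 else u k $ \<gamma> l)" for k l r a'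
  proof -
    have kB: "k \<notin> B" "k \<noteq> s" using k s by auto
    have one: "abs_minor u (insert k (R - {s, l})) = \<bar>a' l\<bar>" if "l \<in> B" for l
    proof -
      have "l \<noteq> s" using that s by auto
      have "abs_minor u (insert k (R - {s, l})) = \<bar>u k $ \<gamma> l\<bar>"
        using s \<gamma>[OF that] kB by (intro abs_minor_replace_1[OF \<beta> ax]) auto
      then show ?thesis using \<open>l \<noteq> s\<close> by (simp add: a')
    qed
    consider "l = s" "r \<in> B" | "r = s" "l \<in> B" | "l \<in> B" "r \<in> B" using lr s by auto
    then show ?thesis
    proof cases
      case 1 then show ?thesis using one[of r] by (simp add: a' c_def)
    next
      case 2 then show ?thesis using one[of l] by (simp add: a' c_def insert_commute)
    next
      case 3
      then have ne: "l \<noteq> s" "r \<noteq> s" using s by auto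
      have "abs_minor u (insert k (R - {l, r})) = \<bar>u k $ \<gamma> l * u s $ \<gamma> r - u s $ \<gamma> l * u k $ \<gamma> r\<bar>"
        using s \<gamma> 3 kB lr ne \<gamma>_inj by (intro abs_minor_replace_2[OF \<beta> ax]) auto
      then show ?thesis using ne by (simp add: a' c_def mult.commute)
    qed
  qed
  have m3: "abs_minor u (insert i (insert j (R - {l, r, q}))) = \<bar>minor3 a b c l r q\<bar>"
    if lr: "l \<in> R" "r \<in> R" "q \<in> R" "distinct [l, r, q]" for l r q
  proof -
    have two: "abs_minor u (insert i (insert j (R - {s, l, r}))) = \<bar>minor3 a b c s l r\<bar>"
      if "l \<in> B" "r \<in> B" "l \<noteq> r" for l r
    proof -
      have ne: "l \<noteq> s" "r \<noteq> s" using that s by auto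
      have "abs_minor u (insert i (insert j (R - {s, l, r}))) = \<bar>u i $ \<gamma> l * u j $ \<gamma> r - u j $ \<gamma> l * u i $ \<gamma> r\<bar>"
        using s \<gamma> that notB i ne \<gamma>_inj by (intro abs_minor_replace_2[OF \<beta> ax]) auto
      then show ?thesis using ne
        by (simp add: a_def b_def c_def minor3_def) (metis abs_minus_commute mult.commute)
    qed
    consider "l = s" "r \<in> B" "q \<in> B" | "r = s" "l \<in> B" "q \<in> B" | "q = s" "l \<in> B" "r \<in> B"
      | "l \<in> B" "r \<in> B" "q \<in> B" using lr s by auto
    then show ?thesis
    proof cases
      case 1 then show ?thesis using two[of r q] lr by simp
    next
      case 2
      have "{l, r, q} = {s, l, q}" using 2 by auto
      then show ?thesis using two[of l q] lr 2 minor3_perm(1)[of a b c l s q] by simp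
    next
      case 3
      have "{l, r, q} = {s, l, r}" using 3 by auto
      then show ?thesis using two[of l r] lr 3 minor3_perm(1)[of a b c l s r] minor3_perm(2)[of a b c l r s] by simp
    next
      case 4
      then have ne: "l \<noteq> s" "r \<noteq> s" "q \<noteq> s" using s by auto
      have "abs_minor u (insert i (insert j (R - {l, r, q}))) =
          \<bar>minor3 (\<lambda>k. u k $ \<gamma> l) (\<lambda>k. u k $ \<gamma> r) (\<lambda>k. u k $ \<gamma> q) i j s\<bar>"
        using s \<gamma> 4 notB i ne lr \<gamma>_inj by (intro abs_minor_replace_3[OF \<beta> ax]) auto
      also have "minor3 (\<lambda>k. u k $ \<gamma> l) (\<lambda>k. u k $ \<gamma> r) (\<lambda>k. u k $ \<gamma> q) i j s = minor3 a b c l r q"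
        using ne by (simp add: minor3_def a_def b_def c_def algebra_simps)
      finally show ?thesis .
    qed
  qed
  have rayleigh_at_u: "rayleigh_at u R i j x"
  proof -
    define X where "X = (\<Prod>i\<in>R. x i)"
    define y where "y l = 1 / x l" for l
    have x0: "x l \<noteq> 0" if "l \<in> R" for l using x[OF that] by simp
    have y: "0 \<le> y l" if "l \<in> R" for l using x[OF that] by (simp add: y_def)
    have cRd: "card (insert k I) = Suc (card I)" if "I \<subseteq> R" "k \<notin> R" for I k
      using that R finite_subset by (subst card_insert_disjoint) auto
    have g: "subset_poly R (abs_minor u) x = X * minor_sum1 R y c"
    proof -
      have "subset_poly R (abs_minor u) x = X * subset_sum 1 R (\<lambda>L. abs_minor u (R - L) * (\<Prod>i\<in>L. y i))"
        unfolding X_def y_def using n by (intro subset_poly_subset_sum_complement R x0) (auto dest: abs_minor_card)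
      also have "subset_sum 1 R (\<lambda>L. abs_minor u (R - L) * (\<Prod>i\<in>L. y i)) = minor_sum1 R y c"
        unfolding subset_sum_1[OF R] minor_sum1_def using m1 by (intro sum.cong) (auto simp: mult.commute)
      finally show ?thesis .
    qed
    have h: "2 * subset_poly R (\<lambda>I. abs_minor u (insert k I)) x = X * minor_sum2 R y a' c"
      if k: "k \<notin> R" and a': "\<And>l. a' l = (if l = s then 0 else u k $ \<gamma> l)" for k a'
    proof -
      have "subset_poly R (\<lambda>I. abs_minor u (insert k I)) x = X * subset_sum 2 R (\<lambda>L. abs_minor u (insert k (R - L)) * (\<Prod>i\<in>L. y i))"
        unfolding X_def y_def using n k cRd
        by (intro subset_poly_subset_sum_complement[where c = "\<lambda>I. abs_minor u (insert k I)"] R x0) (auto dest!: abs_minor_card)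
      moreover have "2 * subset_sum 2 R (\<lambda>L. abs_minor u (insert k (R - L)) * (\<Prod>i\<in>L. y i)) =
          (\<Sum>l\<in>R. \<Sum>r\<in>R. y l * y r * \<bar>a' l * c r - a' r * c l\<bar>)"
        by (rule subset_sum_2[OF R]) (simp_all add: m2[OF _ _ _ k a'])
      ultimately show ?thesis by (simp add: minor_sum2_def)
    qed
    have k: "6 * subset_poly R (\<lambda>I. abs_minor u (insert i (insert j I))) x = X * minor_sum3 R y a b c"
    proof -
      have "card (insert i (insert j I)) = Suc (Suc (card I))" if "I \<subseteq> R" for I
      proof -
        have "finite I" "i \<notin> I" "j \<notin> I" using that R i finite_subset by auto
        then show ?thesis using i by simp
      qed
      then have "subset_poly R (\<lambda>I. abs_minor u (insert i (insert j I))) x =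
          X * subset_sum 3 R (\<lambda>L. abs_minor u (insert i (insert j (R - L))) * (\<Prod>i\<in>L. y i))"
        unfolding X_def y_def using n
        by (intro subset_poly_subset_sum_complement[where c = "\<lambda>I. abs_minor u (insert i (insert j I))"] R x0) (auto dest!: abs_minor_card)
      moreover have "6 * subset_sum 3 R (\<lambda>L. abs_minor u (insert i (insert j (R - L))) * (\<Prod>i\<in>L. y i)) =
          (\<Sum>l\<in>R. \<Sum>r\<in>R. \<Sum>s\<in>R. y l * y r * y s * \<bar>minor3 a b c l r s\<bar>)"
        by (rule subset_sum_3[OF R]) (simp_all add: m3 minor3_same mult.assoc)
      ultimately show ?thesis by (simp add: minor_sum3_def)
    qed
    have "0 \<le> X * X" by simp
    moreover have "2 * minor_sum3 R y a b c * minor_sum1 R y c \<le> 3 * minor_sum2 R y a c * minor_sum2 R y b c"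
      using y by (intro minor_inequality[OF R]) simp
    ultimately have "X * X * (2 * minor_sum3 R y a b c * minor_sum1 R y c) \<le> X * X * (3 * minor_sum2 R y a c * minor_sum2 R y b c)"
      by (intro mult_left_mono)
    then have "2 * subset_poly R (abs_minor u) x * (6 * subset_poly R (\<lambda>I. abs_minor u (insert i (insert j I))) x) \<le>
        3 * (2 * subset_poly R (\<lambda>I. abs_minor u (insert i I)) x) * (2 * subset_poly R (\<lambda>I. abs_minor u (insert j I)) x)"
      unfolding g h[OF i(1) a_def] h[OF i(2) b_def] k by (simp add: mult_ac)
    then show ?thesis unfolding rayleigh_at_def by simp
  qed
  then show ?thesis using rayleigh_at_linear[OF T(1,2)] by (simp add: u_def[abs_def])
qed (use rayleigh_at_trivial x less_imp_le in blast)

lemma tendsto_subset_poly: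
  assumes "\<And>i. i \<in> R \<Longrightarrow> ((\<lambda>e. x e i) \<longlongrightarrow> y i) F"
  shows "((\<lambda>e. subset_poly R c (x e)) \<longlongrightarrow> subset_poly R c y) F"
  unfolding subset_poly_def using assms by (intro tendsto_intros) auto

text \<open>Reduced to corank exactly three by adding zero vectors, which kill every minor
  containing them. The dual form substitutes \<open>1 / x\<close>, so zero coordinates are reached
  as limits of \<open>z l + e\<close> with \<open>e > 0\<close>.\<close>

lemma rayleigh_at_corank_le_3:
  fixes v :: "nat \<Rightarrow> real^'n::finite"
  assumes R: "finite R" and n: "card R \<le> CARD('n) + 1" and i: "i \<notin> R" "j \<notin> R" "i \<noteq> j"
    and x: "\<And>l. l \<in> R \<Longrightarrow> 0 \<le> x l"
  shows "rayleigh_at v R i j x"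
proof -
  obtain E where E: "finite E" "card E = CARD('n) + 1 - card R" "E \<inter> (R \<union> {i, j}) = {}"
  proof -
    have "infinite (- (R \<union> {i, j}))" using R by (simp add: Compl_eq_Diff_UNIV)
    then obtain E where "E \<subseteq> - (R \<union> {i, j})" "finite E" "card E = CARD('n) + 1 - card R"
      using infinite_arbitrarily_large by metis
    then show thesis using that by blast
  qed
  define S where "S = R \<union> E"
  have S: "card S = CARD('n) + 1" "finite S" "R \<subseteq> S"
    using R E n card_Un_disjoint[of R E] by (auto simp: S_def)
  define u where "u l = (if l \<in> E then 0 else v l)" for l
  have restrict: "subset_poly S (\<lambda>I. abs_minor u (f I)) x = subset_poly R (\<lambda>I. abs_minor v (f I)) x"
    if f: "\<And>I. I \<subseteq> f I" "\<And>I. f I \<subseteq> insert i (insert j I)" for f x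
  proof -
    have "subset_poly S (\<lambda>I. abs_minor u (f I)) x = (\<Sum>I\<in>Pow R. abs_minor u (f I) * (\<Prod>i\<in>I. x i))"
      unfolding subset_poly_def
    proof (intro sum.mono_neutral_right ballI)
      fix I assume "I \<in> Pow S - Pow R"
      then obtain l where "l \<in> I" "l \<in> E" by (auto simp: S_def)
      then have "abs_minor u (f I) = 0" using f(1) by (intro abs_minor_zero_vector[of l]) (auto simp: u_def)
      then show "abs_minor u (f I) * (\<Prod>i\<in>I. x i) = 0" by simp
    qed (use S in auto)
    also have "\<dots> = subset_poly R (\<lambda>I. abs_minor v (f I)) x"
      unfolding subset_poly_def
    proof (rule sum.cong[OF refl])
      fix I assume "I \<in> Pow R"
      then have "abs_minor u (f I) = abs_minor v (f I)" using f(2)[of I] E by (intro abs_minor_cong) (auto simp: u_def)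
      then show "abs_minor u (f I) * (\<Prod>i\<in>I. x i) = abs_minor v (f I) * (\<Prod>i\<in>I. x i)" by simp
    qed
    finally show ?thesis .
  qed
  define z where "z l = (if l \<in> R then x l else 0)" for l
  have z: "0 \<le> z l" for l using x by (simp add: z_def)
  have lim: "((\<lambda>e. subset_poly S c (\<lambda>l. z l + e)) \<longlongrightarrow> subset_poly S c z) (at_right 0)" for c
    by (rule tendsto_subset_poly) (auto intro!: tendsto_eq_intros)
  have "rayleigh_at u S i j (\<lambda>l. z l + e)" if "0 < e" for e
    using i E S z that by (intro rayleigh_at_corank_3) (auto simp: S_def add_nonneg_pos)
  then have "eventually (\<lambda>e. rayleigh_at u S i j (\<lambda>l. z l + e)) (at_right 0)"
    using eventually_at_right_less by (rule eventually_mono[rotated])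
  then have "rayleigh_at u S i j z"
    unfolding rayleigh_at_def by (intro tendsto_le[OF trivial_limit_at_right_real tendsto_mult[OF lim lim] tendsto_mult[OF lim lim]])
  moreover have "subset_poly R c z = subset_poly R c x" for c by (rule subset_poly_cong) (auto simp: z_def)
  moreover have "subset_poly S (abs_minor u) z = subset_poly R (abs_minor v) z" by (rule restrict[of "\<lambda>I. I"]) auto
  moreover have "subset_poly S (\<lambda>I. abs_minor u (insert i I)) z = subset_poly R (\<lambda>I. abs_minor v (insert i I)) z"
    by (rule restrict) auto
  moreover have "subset_poly S (\<lambda>I. abs_minor u (insert j I)) z = subset_poly R (\<lambda>I. abs_minor v (insert j I)) z"
    by (rule restrict) auto
  moreover have "subset_poly S (\<lambda>I. abs_minor u (insert i (insert j I))) z = subset_poly R (\<lambda>I. abs_minor v (insert i (insert j I))) z"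
    by (rule restrict) auto
  ultimately show ?thesis unfolding rayleigh_at_def by simp
qed

lemma rayleigh_at_dim_1:
  fixes v :: "nat \<Rightarrow> real^'n::finite"
  assumes n: "CARD('n) = 1" and R: "finite R" and i: "i \<notin> R" "j \<notin> R" "i \<noteq> j"
    and x: "\<And>l. l \<in> R \<Longrightarrow> 0 \<le> x l"
  shows "rayleigh_at v R i j x"
proof -
  have "abs_minor v (insert i (insert j I)) = 0" if "I \<subseteq> R" for I
  proof -
    have "finite I" "i \<notin> I" "j \<notin> I" using that R i finite_subset by auto
    then show ?thesis using i n abs_minor_card[of v "insert i (insert j I)"] by auto
  qed
  then have "subset_poly R (\<lambda>I. abs_minor v (insert i (insert j I))) x = 0" by (simp add: subset_poly_def)
  then show ?thesis using x by (intro rayleigh_at_trivial) auto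
qed

lemma rayleigh_at_low:
  fixes v :: "nat \<Rightarrow> real^'n::finite"
  assumes n: "CARD('n) \<le> 3 \<or> card R \<le> CARD('n) + 1" and R: "finite R"
    and i: "i \<notin> R" "j \<notin> R" "i \<noteq> j" and x: "\<And>l. l \<in> R \<Longrightarrow> 0 \<le> x l"
  shows "rayleigh_at v R i j x"
proof -
  have "0 < CARD('n)" by simp
  then consider "CARD('n) = 1" | "CARD('n) = 2" | "CARD('n) = 3" | "card R \<le> CARD('n) + 1"
    using n by linarith
  then show ?thesis
  proof cases
    case 1 then show ?thesis using R i x by (intro rayleigh_at_dim_1)
  next
    case 2 then show ?thesis using R i x by (intro rayleigh_at_dim_2)
  next
    case 3 then show ?thesis using R i x by (intro rayleigh_at_dim_3)
  next
    case 4 then show ?thesis using R i x by (intro rayleigh_at_corank_le_3)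
  qed
qed

section \<open>Partial derivatives of multiaffine functions\<close>

lemma partial_deriv_affine:
  assumes "\<And>t. p (x(i := t)) = a + t * b"
  shows "partial_deriv i p x = b"
  unfolding partial_deriv_def assms
  by (rule DERIV_imp_deriv) (auto intro!: derivative_eq_intros)

lemma subset_poly_fun_upd: "k \<notin> A \<Longrightarrow> subset_poly A c (x(k := t)) = subset_poly A c x"
  by (intro subset_poly_cong) auto

text \<open>In the difference \<open>(hi + x j * k) * (hj + x i * k) - p x * k\<close> the terms
  with \<open>x i\<close> and \<open>x j\<close> cancel, leaving
  \<open>hi * hj - g * k\<close>.\<close>

lemma rayleigh_iff_subset_poly:
  fixes c :: "nat set \<Rightarrow> real"
  assumes "i < m" "j < m" "i \<noteq> j"
  defines "R \<equiv> {..<m} - {i, j}"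
  defines "p \<equiv> multiaffine m c"
  shows "partial_deriv i p x * partial_deriv j p x \<ge> p x * partial_deriv i (partial_deriv j p) x \<longleftrightarrow>
     subset_poly R c x * subset_poly R (\<lambda>I. c (insert i (insert j I))) x \<le>
     subset_poly R (\<lambda>I. c (insert i I)) x * subset_poly R (\<lambda>I. c (insert j I)) x"
proof -
  define g hi hj k where "g x = subset_poly R c x" and "hi x = subset_poly R (\<lambda>I. c (insert i I)) x"
    and "hj x = subset_poly R (\<lambda>I. c (insert j I)) x" and "k x = subset_poly R (\<lambda>I. c (insert i (insert j I))) x" for x
  have R: "finite R" "i \<notin> R" "j \<notin> R" by (auto simp: R_def)
  have set: "{..<m} = insert j (insert i R)" using assms by (auto simp: R_def)
  have p: "p x = g x + x i * hi x + x j * (hj x + x i * k x)" for x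
  proof -
    have "p x = subset_poly (insert i R) c x + x j * subset_poly (insert i R) (\<lambda>I. c (insert j I)) x"
      unfolding p_def multiaffine_subset_poly set using R assms by (intro subset_poly_insert) auto
    also have "subset_poly (insert i R) c x = g x + x i * hi x"
      unfolding g_def hi_def using R by (intro subset_poly_insert) auto
    also have "subset_poly (insert i R) (\<lambda>I. c (insert j I)) x = hj x + x i * k x"
      unfolding hj_def k_def using R by (subst subset_poly_insert) (auto simp: insert_commute)
    finally show ?thesis .
  qed
  have inv: "g (x(l := t)) = g x" "hi (x(l := t)) = hi x" "hj (x(l := t)) = hj x" "k (x(l := t)) = k x"
    if "l = i \<or> l = j" for x l t
    using that R by (auto simp: g_def hi_def hj_def k_def subset_poly_fun_upd)
  have di: "partial_deriv i p x = hi x + x j * k x" for x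
    by (rule partial_deriv_affine[where a = "g x + x j * hj x"])
      (use assms(1-3) in \<open>simp add: p inv algebra_simps\<close>)
  have dj: "partial_deriv j p x = hj x + x i * k x" for x
    by (rule partial_deriv_affine[where a = "g x + x i * hi x"])
      (use assms(1-3) in \<open>simp add: p inv algebra_simps\<close>)
  have dij: "partial_deriv i (partial_deriv j p) x = k x"
    by (rule partial_deriv_affine[where a = "hj x"]) (use assms(1-3) in \<open>simp add: dj inv\<close>)
  have "partial_deriv i p x * partial_deriv j p x - p x * partial_deriv i (partial_deriv j p) x
      = hi x * hj x - g x * k x"
    unfolding di dj dij p by (simp add: algebra_simps)
  then show ?thesis unfolding g_def hi_def hj_def k_def by linarith
qed

lemma segment_sum_indicator:
  assumes "I \<subseteq> {..<m}"
  shows "segment_sum m v (indicator I) = (\<Sum>i\<in>I. seg (v i))"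
  unfolding segment_sum_alt using assms by (intro sum.mono_neutral_cong_right) (auto simp: set_zero)

lemma vol_segment_sum_multiaffine:
  fixes v :: "nat \<Rightarrow> real^'n::finite"
  assumes "x \<in> nonneg_orthant m"
  shows "vol (segment_sum m v x) = multiaffine m (abs_minor v) x"
proof -
  have "vol (segment_sum m v x) =
      subset_poly {..<m} (\<lambda>I. if card I = CARD('n) then vol (segment_sum m v (indicator I)) else 0) x"
    using vol_segment_sum[OF assms, of v] by simp
  also have "\<dots> = subset_poly {..<m} (abs_minor v) x"
    by (intro subset_poly_cong) (simp_all add: abs_minor_def segment_sum_indicator)
  finally show ?thesis by (simp add: multiaffine_subset_poly)
qed

lemma all_volume_polynomials_rayleigh_low:
  assumes "CARD('n::finite) \<le> m" "min CARD('n) (m - CARD('n)) \<le> 3"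
  shows "all_volume_polynomials_rayleigh TYPE('n) m"
  unfolding all_volume_polynomials_rayleigh_def rayleigh_polynomial_def
proof (intro allI exI conjI impI)
  fix v :: "nat \<Rightarrow> real^'n"
  show "0 \<le> abs_minor v I" for I by simp
  show "abs_minor v I = 0" if "card I \<noteq> CARD('n)" for I using that by (simp add: abs_minor_def)
  show "\<forall>x\<in>nonneg_orthant m. vol (segment_sum m v x) = multiaffine m (abs_minor v) x"
    using vol_segment_sum_multiaffine by blast
  show "rayleigh_inequalities m (multiaffine m (abs_minor v))"
    unfolding rayleigh_inequalities_def
  proof (intro ballI allI impI)
    fix x i j assume x: "x \<in> nonneg_orthant m" and ij: "i < m" "j < m" "i \<noteq> j"
    \<comment> \<open>Two indices are removed, so \<open>m - n \<le> 3\<close> is the condition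
      \<open>card R \<le> n + 1\<close> of \<open>rayleigh_at_low\<close>.\<close>
    have "card ({..<m} - {i, j}) = m - 2" using ij by (simp add: card_Diff_subset)
    then have "rayleigh_at v ({..<m} - {i, j}) i j x"
      using assms x ij by (intro rayleigh_at_low) (auto simp: nonneg_orthant_def)
    then show "partial_deriv i (multiaffine m (abs_minor v)) x * partial_deriv j (multiaffine m (abs_minor v)) x
        \<ge> multiaffine m (abs_minor v) x * partial_deriv i (partial_deriv j (multiaffine m (abs_minor v))) x"
      unfolding rayleigh_iff_subset_poly[OF ij] rayleigh_at_def .
  qed
qed

section \<open>Hausdorff measure of subsets of coordinate subspaces\<close>

definition cover_weight :: "nat \<Rightarrow> 'a::metric_space set \<Rightarrow> ennreal" where
  "cover_weight d U = (if U = {} then 0 else ennreal (diameter U ^ d))"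

definition fine_cover :: "real \<Rightarrow> 'a::metric_space set \<Rightarrow> (nat \<Rightarrow> 'a set) \<Rightarrow> bool" where
  "fine_cover \<delta> S U \<longleftrightarrow> S \<subseteq> (\<Union>i. U i) \<and> (\<forall>i. bounded (U i) \<and> diameter (U i) \<le> \<delta>)"

lemma hausdorff_pre_alt: "hausdorff_pre d \<delta> S = (INF U \<in> {U. fine_cover \<delta> S U}. \<Sum>i. cover_weight d (U i))"
  by (simp add: hausdorff_pre_def fine_cover_def cover_weight_def)

lemma hausdorff_pre_le: "fine_cover \<delta> S U \<Longrightarrow> hausdorff_pre d \<delta> S \<le> (\<Sum>i. cover_weight d (U i))"
  unfolding hausdorff_pre_alt by (rule INF_lower) simp

lemma hausdorff_pre_ge: "(\<And>U. fine_cover \<delta> S U \<Longrightarrow> x \<le> (\<Sum>i. cover_weight d (U i))) \<Longrightarrow> x \<le> hausdorff_pre d \<delta> S"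
  unfolding hausdorff_pre_alt by (rule INF_greatest) simp

lemma hausdorff_pre_approx:
  assumes "hausdorff_pre d \<delta> S \<noteq> top" "0 < e"
  obtains U where "fine_cover \<delta> S U" "(\<Sum>i. cover_weight d (U i)) \<le> hausdorff_pre d \<delta> S + ennreal e"
proof -
  from INF_approx_ennreal[OF assms(2) hausdorff_pre_alt[of d \<delta> S]] assms(1)
  obtain U where "fine_cover \<delta> S U" "(\<Sum>i. cover_weight d (U i)) < hausdorff_pre d \<delta> S + ennreal e" by auto
  then show thesis using that less_imp_le by blast
qed

lemma hausdorff_pre_mono: "S \<subseteq> T \<Longrightarrow> hausdorff_pre d \<delta> S \<le> hausdorff_pre d \<delta> T"
  by (rule hausdorff_pre_ge, rule hausdorff_pre_le) (auto simp: fine_cover_def)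

lemma hausdorff_pre_antimono: "\<delta> \<le> \<delta>' \<Longrightarrow> hausdorff_pre d \<delta>' S \<le> hausdorff_pre d \<delta> S"
  by (rule hausdorff_pre_ge, rule hausdorff_pre_le) (auto simp: fine_cover_def intro: order_trans)

lemma hausdorff_pre_empty: "0 < \<delta> \<Longrightarrow> hausdorff_pre d \<delta> {} = 0"
  using hausdorff_pre_le[of \<delta> "{}" "\<lambda>_. {}" d] by (simp add: fine_cover_def cover_weight_def)

lemma hausdorff_pre_UN:
  "hausdorff_pre d \<delta> (\<Union>i. A i) \<le> (\<Sum>i. hausdorff_pre d \<delta> (A i))"
proof (rule ennreal_le_epsilon)
  fix e :: real assume fin: "(\<Sum>i. hausdorff_pre d \<delta> (A i)) < top" and "0 < e"
  have ne: "hausdorff_pre d \<delta> (A i) \<noteq> top" for i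
    using ennreal_suminf_lessD[OF fin, of i] by simp
  have "\<exists>U. fine_cover \<delta> (A i) U \<and> (\<Sum>j. cover_weight d (U j)) \<le> hausdorff_pre d \<delta> (A i) + ennreal (e * (1/2) ^ Suc i)" for i
    by (rule hausdorff_pre_approx[OF ne[of i], of "e * (1/2) ^ Suc i"]) (use \<open>0 < e\<close> in auto)
  then obtain U where U: "\<And>i. fine_cover \<delta> (A i) (U i)"
    "\<And>i. (\<Sum>j. cover_weight d (U i j)) \<le> hausdorff_pre d \<delta> (A i) + ennreal (e * (1/2) ^ Suc i)" by metis
  define V where "V k = (case prod_decode k of (i, j) \<Rightarrow> U i j)" for k
  have "fine_cover \<delta> (\<Union>i. A i) V"
    unfolding fine_cover_def
  proof
    show "(\<Union>i. A i) \<subseteq> (\<Union>k. V k)"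
    proof
      fix x assume "x \<in> (\<Union>i. A i)"
      then obtain i j where "x \<in> U i j" using U(1) by (force simp: fine_cover_def)
      then have "x \<in> V (prod_encode (i, j))" by (simp add: V_def)
      then show "x \<in> (\<Union>k. V k)" by blast
    qed
  qed (use U(1) in \<open>auto simp: V_def fine_cover_def split: prod.split\<close>)
  then have "hausdorff_pre d \<delta> (\<Union>i. A i) \<le> (\<Sum>k. cover_weight d (V k))" by (rule hausdorff_pre_le)
  also have "\<dots> = (\<Sum>k. (\<lambda>(i, j). cover_weight d (U i j)) (prod_decode k))"
    by (simp add: V_def case_prod_beta)
  also have "\<dots> = (\<Sum>i. \<Sum>j. cover_weight d (U i j))"
    using suminf_ennreal_2dimen[of "\<lambda>i. \<Sum>j. cover_weight d (U i j)" "\<lambda>(i, j). cover_weight d (U i j)"] by (simp add: o_def)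
  also have "\<dots> \<le> (\<Sum>i. hausdorff_pre d \<delta> (A i) + ennreal (e * (1/2) ^ Suc i))"
    using U(2) by (intro suminf_le) auto
  also have "\<dots> = (\<Sum>i. hausdorff_pre d \<delta> (A i)) + (\<Sum>i. ennreal (e * (1/2) ^ Suc i))"
    by (intro suminf_add[symmetric]) auto
  also have "(\<Sum>i. ennreal (e * (1/2) ^ Suc i)) = ennreal e"
    using \<open>0 < e\<close> sums_mult[OF power_half_series, of e] by (intro suminf_ennreal_eq) auto
  finally show "hausdorff_pre d \<delta> (\<Union>i. A i) \<le> (\<Sum>i. hausdorff_pre d \<delta> (A i)) + ennreal e" .
qed

lemma hausdorff_pre_finite_UN:
  assumes "finite I" "0 < \<delta>"
  shows "hausdorff_pre d \<delta> (\<Union>i\<in>I. A i) \<le> (\<Sum>i\<in>I. hausdorff_pre d \<delta> (A i))"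
  using assms(1)
proof (induction I rule: finite_induct)
  case (insert a I)
  define B where "B k = (if k = (0::nat) then A a else if k = 1 then (\<Union>i\<in>I. A i) else {})" for k
  have "(\<Union>i\<in>insert a I. A i) \<subseteq> (\<Union>k. B k)" by (auto simp: B_def split: if_splits)
  then have "hausdorff_pre d \<delta> (\<Union>i\<in>insert a I. A i) \<le> hausdorff_pre d \<delta> (\<Union>k. B k)"
    by (rule hausdorff_pre_mono)
  also have "\<dots> \<le> (\<Sum>k. hausdorff_pre d \<delta> (B k))" by (rule hausdorff_pre_UN)
  also have "\<dots> = (\<Sum>k\<in>{0, 1}. hausdorff_pre d \<delta> (B k))"
    using assms(2) by (intro suminf_finite) (auto simp: B_def hausdorff_pre_empty)
  also have "\<dots> = hausdorff_pre d \<delta> (A a) + hausdorff_pre d \<delta> (\<Union>i\<in>I. A i)" by (simp add: B_def)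
  also have "\<dots> \<le> hausdorff_pre d \<delta> (A a) + (\<Sum>i\<in>I. hausdorff_pre d \<delta> (A i))"
    by (intro add_left_mono insert.IH)
  finally show ?case using insert.hyps by simp
qed (use assms(2) in \<open>simp add: hausdorff_pre_empty\<close>)

section \<open>Similarities\<close>

lemma diameter_similarity:
  assumes "\<And>x y. dist (f x) (f y) = r * dist x y" "0 < r" "U \<noteq> {}" "bounded U"
  shows "bounded (f ` U)" "diameter (f ` U) = r * diameter U"
proof -
  have le: "dist (f x) (f y) \<le> r * diameter U" if "x \<in> U" "y \<in> U" for x y
    using assms diameter_bounded_bound[OF assms(4) that] by (simp add: mult_left_mono)
  obtain z where z: "z \<in> U" using assms(3) by auto
  show b: "bounded (f ` U)"
    unfolding bounded_def using le[OF z] by (intro exI[of _ "f z"] exI[of _ "r * diameter U"]) auto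
  have "diameter (f ` U) \<le> r * diameter U"
    unfolding diameter_def[of "f ` U"] using z le by (auto intro!: cSUP_least)
  moreover have "diameter U \<le> diameter (f ` U) / r"
  proof -
    have "dist x y \<le> diameter (f ` U) / r" if "x \<in> U" "y \<in> U" for x y
      using diameter_bounded_bound[OF b, of "f x" "f y"] that assms by (simp add: field_simps)
    then show ?thesis unfolding diameter_def[of U] using z by (auto intro!: cSUP_least)
  qed
  ultimately show "diameter (f ` U) = r * diameter U" using assms(2) by (simp add: field_simps)
qed

lemma hausdorff_pre_similarity:
  assumes f: "\<And>x y. dist (f x) (f y) = r * dist x y" and r: "0 < r"
  shows "hausdorff_pre d (r * \<delta>) (f ` S) \<le> ennreal (r ^ d) * hausdorff_pre d \<delta> S"
proof (cases "hausdorff_pre d \<delta> S = top")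
  case True
  then show ?thesis using r by (simp add: ennreal_mult_top)
next
  case False
  have le: "hausdorff_pre d (r * \<delta>) (f ` S) \<le> ennreal (r ^ d) * (\<Sum>i. cover_weight d (U i))" if U: "fine_cover \<delta> S U" for U
  proof -
    have diam: "bounded (f ` U i) \<and> diameter (f ` U i) \<le> r * \<delta> \<and> cover_weight d (f ` U i) = ennreal (r ^ d) * cover_weight d (U i)" for i
    proof (cases "U i = {}")
      case True
      then have "0 \<le> \<delta>" using U by (auto simp: fine_cover_def dest: spec[of _ i])
      then show ?thesis using True r by (simp add: cover_weight_def)
    next
      case False
      have "bounded (U i)" "diameter (U i) \<le> \<delta>" using U by (auto simp: fine_cover_def)
      then show ?thesis using diameter_similarity[OF f r False] False r
          diameter_ge_0[of "U i"] by (auto simp: cover_weight_def power_mult_distrib ennreal_mult)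
    qed
    moreover have "f ` S \<subseteq> (\<Union>i. f ` U i)" using U unfolding fine_cover_def by blast
    ultimately have "fine_cover (r * \<delta>) (f ` S) (\<lambda>i. f ` U i)" by (simp add: fine_cover_def)
    from hausdorff_pre_le[OF this, of d] show ?thesis using diam by simp
  qed
  show ?thesis
  proof (rule ennreal_le_epsilon)
    fix e :: real assume "0 < e"
    then obtain U where U: "fine_cover \<delta> S U"
      "(\<Sum>i. cover_weight d (U i)) \<le> hausdorff_pre d \<delta> S + ennreal (e / r ^ d)"
      using hausdorff_pre_approx[OF False, of "e / r ^ d"] r by auto
    have "hausdorff_pre d (r * \<delta>) (f ` S) \<le> ennreal (r ^ d) * (hausdorff_pre d \<delta> S + ennreal (e / r ^ d))"
      using le[OF U(1)] mult_left_mono[OF U(2)] by (rule order_trans) simp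
    also have "\<dots> = ennreal (r ^ d) * hausdorff_pre d \<delta> S + ennreal e"
      using r \<open>0 < e\<close> by (simp add: distrib_left flip: ennreal_mult')
    finally show "hausdorff_pre d (r * \<delta>) (f ` S) \<le> ennreal (r ^ d) * hausdorff_pre d \<delta> S + ennreal e" .
  qed
qed

section \<open>The Hausdorff measure before normalization\<close>

abbreviation "hmeasure \<equiv> hausdorff_unnormalised"

lemma hausdorff_pre_le_hmeasure: "0 < \<delta> \<Longrightarrow> hausdorff_pre d \<delta> S \<le> hmeasure d S"
  unfolding hausdorff_unnormalised_def by (rule SUP_upper) simp

lemma hmeasure_le: "(\<And>\<delta>. 0 < \<delta> \<Longrightarrow> hausdorff_pre d \<delta> S \<le> x) \<Longrightarrow> hmeasure d S \<le> x"
  unfolding hausdorff_unnormalised_def by (rule SUP_least) simp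

lemma hmeasure_mono: "S \<subseteq> T \<Longrightarrow> hmeasure d S \<le> hmeasure d T"
  by (intro hmeasure_le order_trans[OF hausdorff_pre_mono hausdorff_pre_le_hmeasure])

lemma hmeasure_empty [simp]: "hmeasure d {} = 0"
proof -
  have "hmeasure d {} \<le> 0" by (rule hmeasure_le) (simp add: hausdorff_pre_empty)
  then show ?thesis by simp
qed

lemma hmeasure_UN: "hmeasure d (\<Union>i. A i) \<le> (\<Sum>i. hmeasure d (A i))"
proof (rule hmeasure_le)
  fix \<delta> :: real assume "0 < \<delta>"
  have "hausdorff_pre d \<delta> (\<Union>i. A i) \<le> (\<Sum>i. hausdorff_pre d \<delta> (A i))" by (rule hausdorff_pre_UN)
  also have "\<dots> \<le> (\<Sum>i. hmeasure d (A i))" using \<open>0 < \<delta>\<close> by (intro suminf_le hausdorff_pre_le_hmeasure) auto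
  finally show "hausdorff_pre d \<delta> (\<Union>i. A i) \<le> (\<Sum>i. hmeasure d (A i))" .
qed

lemma hmeasure_Un: "hmeasure d (A \<union> B) \<le> hmeasure d A + hmeasure d B"
proof (rule hmeasure_le)
  fix \<delta> :: real assume "0 < \<delta>"
  then have "hausdorff_pre d \<delta> (\<Union>X\<in>{A, B}. X) \<le> (\<Sum>X\<in>{A, B}. hausdorff_pre d \<delta> X)"
    by (intro hausdorff_pre_finite_UN) auto
  also have "\<dots> \<le> hausdorff_pre d \<delta> A + hausdorff_pre d \<delta> B" by (cases "A = B") auto
  also have "\<dots> \<le> hmeasure d A + hmeasure d B" using \<open>0 < \<delta>\<close> by (intro add_mono hausdorff_pre_le_hmeasure)
  finally show "hausdorff_pre d \<delta> (A \<union> B) \<le> hmeasure d A + hmeasure d B" by simp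
qed

lemma hmeasure_similarity:
  assumes f: "\<And>x y. dist (f x) (f y) = r * dist x y" and r: "0 < r"
  shows "hmeasure d (f ` S) \<le> ennreal (r ^ d) * hmeasure d S"
proof (rule hmeasure_le)
  fix \<delta> :: real assume "0 < \<delta>"
  have "hausdorff_pre d (r * (\<delta> / r)) (f ` S) \<le> ennreal (r ^ d) * hausdorff_pre d (\<delta> / r) S"
    by (rule hausdorff_pre_similarity[OF f r])
  also have "\<dots> \<le> ennreal (r ^ d) * hmeasure d S"
    using \<open>0 < \<delta>\<close> r by (intro mult_left_mono hausdorff_pre_le_hmeasure) auto
  finally show "hausdorff_pre d \<delta> (f ` S) \<le> ennreal (r ^ d) * hmeasure d S" using r by simp
qed

lemma hmeasure_isometry:
  assumes f: "\<And>x y. dist (f x) (f y) = dist x y" and surj: "surj f"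
  shows "hmeasure d (f ` S) = hmeasure d S"
proof (rule antisym)
  show "hmeasure d (f ` S) \<le> hmeasure d S" using hmeasure_similarity[of f 1 d S] f by simp
  have "inj f" by (metis f dist_eq_0_iff injI)
  then have "hmeasure d S = hmeasure d (inv f ` f ` S)" by (simp add: image_comp)
  also have "\<dots> \<le> ennreal (1 ^ d) * hmeasure d (f ` S)"
  proof (rule hmeasure_similarity)
    fix x y
    have "dist (inv f x) (inv f y) = dist (f (inv f x)) (f (inv f y))" by (rule f[symmetric])
    then show "dist (inv f x) (inv f y) = 1 * dist x y" by (simp add: surj_f_inv_f[OF surj])
  qed simp
  finally show "hmeasure d S \<le> hmeasure d (f ` S)" by simp
qed

section \<open>The normalizing constant is finite and positive\<close>

lemma mem_cbox_sum_Basis: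
  assumes "D \<subseteq> Basis"
  shows "x \<in> cbox 0 (\<Sum>D) \<longleftrightarrow> (\<forall>b\<in>Basis. 0 \<le> x \<bullet> b \<and> x \<bullet> b \<le> (if b \<in> D then 1 else 0))"
  using inner_sum_subset_Basis[OF assms, of _ "\<lambda>_. 1"] by (simp add: mem_box)

text \<open>The cube is covered by \<open>2 ^ d\<close> copies of itself at half size, each of
  weight factor \<open>(1/2) ^ d\<close>, so halving the scale does not increase the premeasure. The
  trivial cover by the cube itself then bounds all scales. In the cover, \<open>B\<close> collects
  the coordinates above 1/2.\<close>

lemma hmeasure_unit_cube_finite:
  assumes D: "D \<subseteq> (Basis :: 'a::euclidean_space set)"
  shows "hmeasure (card D) (cbox 0 (\<Sum>D)) < top"
proof -
  define d where "d = card D"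
  define Q where "Q = cbox 0 (\<Sum>D)"
  have fD: "finite D" using D finite_subset[OF _ finite_Basis] by blast
  have half: "hausdorff_pre d (\<delta> / 2) Q \<le> hausdorff_pre d \<delta> Q" if "0 < \<delta>" for \<delta>
  proof -
    define f where "f B x = (1/2) *\<^sub>R (\<Sum>B + x)" for B and x :: 'a
    have "Q \<subseteq> (\<Union>B\<in>Pow D. f B ` Q)"
    proof
      fix x assume x: "x \<in> Q"
      define B where "B = {b \<in> D. 1/2 < x \<bullet> b}"
      have B: "B \<in> Pow D" "B \<subseteq> Basis" using D by (auto simp: B_def)
      have "2 *\<^sub>R x - \<Sum>B \<in> Q"
        unfolding Q_def mem_cbox_sum_Basis[OF D]
      proof
        fix b :: 'a assume b: "b \<in> Basis"
        have "\<Sum>B \<bullet> b = (if b \<in> B then 1 else 0)"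
          using inner_sum_subset_Basis[OF B(2) b, of "\<lambda>_. 1"] by simp
        moreover have "0 \<le> x \<bullet> b" "x \<bullet> b \<le> (if b \<in> D then 1 else 0)"
          using x b unfolding Q_def mem_cbox_sum_Basis[OF D] by auto
        ultimately show "0 \<le> (2 *\<^sub>R x - \<Sum>B) \<bullet> b \<and> (2 *\<^sub>R x - \<Sum>B) \<bullet> b \<le> (if b \<in> D then 1 else 0)"
          by (auto simp: inner_diff_left B_def split: if_splits)
      qed
      moreover have "x = f B (2 *\<^sub>R x - \<Sum>B)" by (simp add: f_def)
      ultimately show "x \<in> (\<Union>B\<in>Pow D. f B ` Q)" using B(1) by blast
    qed
    then have "hausdorff_pre d (\<delta> / 2) Q \<le> hausdorff_pre d (\<delta> / 2) (\<Union>B\<in>Pow D. f B ` Q)"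
      by (rule hausdorff_pre_mono)
    also have "\<dots> \<le> (\<Sum>B\<in>Pow D. hausdorff_pre d (\<delta> / 2) (f B ` Q))"
      using fD that by (intro hausdorff_pre_finite_UN) auto
    also have "\<dots> \<le> (\<Sum>B\<in>Pow D. ennreal ((1/2) ^ d) * hausdorff_pre d \<delta> Q)"
    proof (rule sum_mono)
      fix B
      have "dist (f B x) (f B y) = (1/2) * dist x y" for x y
        by (simp add: f_def dist_norm flip: scaleR_diff_right)
      from hausdorff_pre_similarity[of "f B", OF this, of d \<delta> Q]
      show "hausdorff_pre d (\<delta> / 2) (f B ` Q) \<le> ennreal ((1/2) ^ d) * hausdorff_pre d \<delta> Q" by simp
    qed
    also have "\<dots> = ennreal (2 ^ d) * (ennreal ((1/2) ^ d) * hausdorff_pre d \<delta> Q)"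
      using fD ennreal_power[of 2 "card D"] by (simp add: card_Pow d_def)
    also have "\<dots> = hausdorff_pre d \<delta> Q"
      by (simp add: mult.assoc[symmetric] power_mult_distrib[symmetric] flip: ennreal_mult)
    finally show ?thesis .
  qed
  define r where "r = diameter Q + 1"
  have bQ: "bounded Q" by (simp add: Q_def)
  have "0 < r" using diameter_ge_0[OF bQ] by (simp add: r_def)
  have "hausdorff_pre d (r / 2 ^ k) Q \<le> hausdorff_pre d r Q" for k
  proof (induction k)
    case (Suc k)
    have "hausdorff_pre d (r / 2 ^ Suc k) Q = hausdorff_pre d (r / 2 ^ k / 2) Q" by (simp add: mult.commute)
    also have "\<dots> \<le> hausdorff_pre d (r / 2 ^ k) Q" using \<open>0 < r\<close> by (intro half) simp
    also have "\<dots> \<le> hausdorff_pre d r Q" by (rule Suc.IH)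
    finally show ?case .
  qed simp
  moreover have "hausdorff_pre d r Q \<le> ennreal (diameter Q ^ d)"
  proof -
    have "fine_cover r Q (\<lambda>i. if i = 0 then Q else {})"
      using bQ \<open>0 < r\<close> by (auto simp: fine_cover_def r_def)
    then have "hausdorff_pre d r Q \<le> (\<Sum>i. cover_weight d (if i = 0 then Q else {}))" by (rule hausdorff_pre_le)
    also have "\<dots> = (\<Sum>i\<in>{0::nat}. cover_weight d (if i = 0 then Q else {}))"
      by (intro suminf_finite) (auto simp: cover_weight_def)
    also have "\<dots> \<le> ennreal (diameter Q ^ d)" by (simp add: cover_weight_def)
    finally show ?thesis .
  qed
  ultimately have bound: "hausdorff_pre d (r / 2 ^ k) Q \<le> ennreal (diameter Q ^ d)" for k
    using order_trans by blast
  have "hmeasure d Q \<le> ennreal (diameter Q ^ d)"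
  proof (rule hmeasure_le)
    fix \<delta> :: real assume "0 < \<delta>"
    then obtain k where k: "(1/2) ^ k < \<delta> / r"
      using real_arch_pow_inv[of "\<delta> / r" "1/2"] \<open>0 < r\<close> by auto
    then have "r / 2 ^ k \<le> \<delta>" using \<open>0 < r\<close> by (simp add: field_simps power_one_over)
    then show "hausdorff_pre d \<delta> Q \<le> ennreal (diameter Q ^ d)"
      using hausdorff_pre_antimono bound order_trans by blast
  qed
  then show ?thesis unfolding d_def Q_def by (rule le_less_trans) simp
qed

lemma emeasure_cbox_subset_Basis:
  assumes D: "D \<subseteq> (Basis :: 'a::euclidean_space set)"
    and D1: "\<And>b. b \<in> D \<Longrightarrow> (u - l) \<bullet> b = s" and D2: "\<And>b. b \<in> Basis - D \<Longrightarrow> (u - l) \<bullet> b = t"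
    and "0 \<le> s" "0 \<le> t"
  shows "emeasure lborel (cbox l u) = ennreal (s ^ card D * t ^ card (Basis - D))"
proof -
  have "l \<bullet> b \<le> u \<bullet> b" if "b \<in> Basis" for b
    using D1[of b] D2[of b] assms(4,5) that by (cases "b \<in> D") (auto simp: inner_diff_left)
  then have "emeasure lborel (cbox l u) = (\<Prod>b\<in>Basis. (u - l) \<bullet> b)" by simp
  also have "(\<Prod>b\<in>Basis. (u - l) \<bullet> b) = (\<Prod>b\<in>Basis - D. (u - l) \<bullet> b) * (\<Prod>b\<in>D. (u - l) \<bullet> b)"
    by (rule prod.subset_diff[OF D finite_Basis])
  also have "\<dots> = s ^ card D * t ^ card (Basis - D)" using D1 D2 by simp
  finally show ?thesis .
qed

text \<open>A covering set of diameter \<open>r\<close> lies in a cube of side \<open>2 r\<close> in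
  the directions \<open>D\<close>; times a unit cube in the other directions this is a box of volume
  \<open>(2 r) ^ d\<close>. The boxes cover the full unit cube, so the weights sum to at least
  \<open>(1/2) ^ d\<close>.\<close>

lemma hmeasure_unit_cube_pos:
  assumes D: "D \<subseteq> (Basis :: 'a::euclidean_space set)"
  shows "0 < hmeasure (card D) (cbox 0 (\<Sum>D))"
proof -
  define d where "d = card D"
  define Q where "Q = cbox 0 (\<Sum>D)"
  have pre: "ennreal ((1/2) ^ d) \<le> hausdorff_pre d 1 Q"
  proof (rule hausdorff_pre_ge)
    fix U assume U: "fine_cover 1 Q U"
    define p where "p i = (SOME x. x \<in> U i)" for i
    define r where "r i = diameter (U i)" for i
    define lo where "lo i = (\<Sum>b\<in>D. (p i \<bullet> b - r i) *\<^sub>R b)" for i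
    define hi where "hi i = (\<Sum>b\<in>D. (p i \<bullet> b + r i) *\<^sub>R b) + \<Sum>(Basis - D)" for i
    define B where "B i = (if U i = {} then {} else cbox (lo i) (hi i))" for i
    have r: "0 \<le> r i" for i using U by (simp add: r_def fine_cover_def diameter_ge_0)
    have lo: "lo i \<bullet> b = (if b \<in> D then p i \<bullet> b - r i else 0)"
      and hi: "hi i \<bullet> b = (if b \<in> D then p i \<bullet> b + r i else 1)" if "b \<in> Basis" for i b
      using that inner_sum_subset_Basis[OF D that] inner_sum_subset_Basis[of "Basis - D" b "\<lambda>_. 1"]
      by (auto simp: lo_def hi_def inner_add_left)
    have cover: "cbox 0 One \<subseteq> (\<Union>i. B i)"
    proof
      fix x :: 'a assume x: "x \<in> cbox 0 One"
      define y where "y = (\<Sum>b\<in>D. (x \<bullet> b) *\<^sub>R b)"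
      have yb: "y \<bullet> b = (if b \<in> D then x \<bullet> b else 0)" if "b \<in> Basis" for b
        unfolding y_def by (rule inner_sum_subset_Basis[OF D that])
      have "y \<in> Q" using x unfolding Q_def mem_cbox_sum_Basis[OF D] by (auto simp: mem_box yb)
      then obtain i where i: "y \<in> U i" using U by (auto simp: fine_cover_def)
      then have "p i \<in> U i" unfolding p_def by (rule someI)
      then have "dist y (p i) \<le> r i" using i U by (auto simp: r_def fine_cover_def intro: diameter_bounded_bound)
      then have "\<bar>(y - p i) \<bullet> b\<bar> \<le> r i" if "b \<in> Basis" for b
        using Basis_le_norm[OF that, of "y - p i"] by (simp add: dist_norm)
      then have close: "\<bar>y \<bullet> b - p i \<bullet> b\<bar> \<le> r i" if "b \<in> Basis" for b
        using that by (simp add: inner_diff_left)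
      have "x \<in> cbox (lo i) (hi i)"
        unfolding mem_box
      proof
        fix b :: 'a assume b: "b \<in> Basis"
        show "lo i \<bullet> b \<le> x \<bullet> b \<and> x \<bullet> b \<le> hi i \<bullet> b"
          using x b lo[OF b] hi[OF b] close[OF b] yb[OF b] by (auto simp: mem_box)
      qed
      then show "x \<in> (\<Union>i. B i)" using i by (auto simp: B_def)
    qed
    have "emeasure lborel (B i) \<le> ennreal (2 ^ d) * cover_weight d (U i)" for i
    proof (cases "U i = {}")
      case False
      have "emeasure lborel (cbox (lo i) (hi i)) = ennreal ((2 * r i) ^ card D * 1 ^ card (Basis - D))"
        using lo hi D r by (intro emeasure_cbox_subset_Basis[OF D]) (auto simp: inner_diff_left subset_iff)
      then show ?thesis using False r[of i]
        by (simp add: B_def cover_weight_def r_def d_def power_mult_distrib flip: ennreal_mult)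
    qed (simp add: B_def)
    then have "(\<Sum>i. emeasure lborel (B i)) \<le> (\<Sum>i. ennreal (2 ^ d) * cover_weight d (U i))"
      by (intro suminf_le) auto
    moreover have "1 \<le> (\<Sum>i. emeasure lborel (B i))"
    proof -
      have "1 = emeasure lborel (cbox 0 One :: 'a set)" by simp
      also have "\<dots> \<le> emeasure lborel (\<Union>i. B i)" using cover by (intro emeasure_mono) (auto simp: B_def)
      also have "\<dots> \<le> (\<Sum>i. emeasure lborel (B i))"
        by (intro emeasure_subadditive_countably) (auto simp: B_def)
      finally show ?thesis .
    qed
    ultimately have "1 \<le> ennreal (2 ^ d) * (\<Sum>i. cover_weight d (U i))" by simp
    then have "ennreal ((1/2) ^ d) * 1 \<le> ennreal ((1/2) ^ d) * (ennreal (2 ^ d) * (\<Sum>i. cover_weight d (U i)))"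
      by (rule mult_left_mono) simp
    also have "\<dots> = (\<Sum>i. cover_weight d (U i))"
      by (simp add: mult.assoc[symmetric] power_mult_distrib[symmetric] flip: ennreal_mult)
    finally show "ennreal ((1/2) ^ d) \<le> (\<Sum>i. cover_weight d (U i))" by simp
  qed
  have "0 < ennreal ((1/2) ^ d)" by simp
  also note pre
  also have "hausdorff_pre d 1 Q \<le> hmeasure d Q" by (rule hausdorff_pre_le_hmeasure) simp
  finally show ?thesis by (simp add: d_def Q_def)
qed

text \<open>The intervals of \<open>measurable_outer_intervals_bounded\<close> have sides that are
  dyadic fractions of those of the frame. The frame is taken to be a cube, so the intervals are
  cubes and hence similar to the unit cube. The index set \<open>J\<close> accommodates finite
  families.\<close>

lemma exists_cube_cover:
  fixes S :: "'a::euclidean_space set"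
  assumes S: "S \<in> lmeasurable" "bounded S" and e: "0 < e"
  obtains u :: "nat \<Rightarrow> 'a" and s :: "nat \<Rightarrow> real" and J
  where "\<And>i. i \<in> J \<Longrightarrow> 0 < s i" "S \<subseteq> (\<Union>i\<in>J. cbox (u i) (u i + s i *\<^sub>R One))"
    "(\<Sum>i. if i \<in> J then ennreal (s i ^ DIM('a)) else 0) \<le> ennreal (vol S + e)"
proof -
  obtain L where L: "0 < L" "\<And>x. x \<in> S \<Longrightarrow> norm x \<le> L"
    using S(2) unfolding bounded_pos by auto
  have sub: "S \<subseteq> cbox (- L *\<^sub>R One) (L *\<^sub>R One)"
  proof
    fix x assume "x \<in> S"
    have "\<bar>x \<bullet> b\<bar> \<le> L" if "b \<in> Basis" for b
      using Basis_le_norm[OF that, of x] L(2)[OF \<open>x \<in> S\<close>] by simp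
    then have "- L \<le> x \<bullet> b \<and> x \<bullet> b \<le> L" if "b \<in> Basis" for b
      using that by (simp add: abs_le_iff minus_le_iff)
    then show "x \<in> cbox (- L *\<^sub>R One) (L *\<^sub>R One)" by (simp add: mem_box)
  qed
  show thesis
  proof (rule measurable_outer_intervals_bounded[OF S(1) sub e])
    fix \<D> :: "'a set set"
    assume \<D>: "countable \<D>"
      "\<And>K. K \<in> \<D> \<Longrightarrow> K \<subseteq> cbox (- L *\<^sub>R One) (L *\<^sub>R One) \<and> K \<noteq> {} \<and> (\<exists>c d. K = cbox c d)"
      "pairwise (\<lambda>A B. interior A \<inter> interior B = {}) \<D>"
      "\<And>u v. cbox u v \<in> \<D> \<Longrightarrow> \<exists>n. \<forall>i\<in>Basis. v \<bullet> i - u \<bullet> i = ((L *\<^sub>R One) \<bullet> i - (- L *\<^sub>R One) \<bullet> i) / 2 ^ n"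
      "\<And>K. \<lbrakk>K \<in> \<D>; box (- L *\<^sub>R One) (L *\<^sub>R One) \<noteq> {}\<rbrakk> \<Longrightarrow> interior K \<noteq> {}"
      "S \<subseteq> \<Union>\<D>" "\<Union>\<D> \<in> lmeasurable" "vol (\<Union>\<D>) \<le> vol S + e"
    define J where "J = to_nat_on \<D> ` \<D>"
    define K where "K = from_nat_into \<D>"
    have KJ: "K i \<in> \<D>" if "i \<in> J" for i using that \<D>(1) by (auto simp: J_def K_def)
    have K_inj: "K i \<noteq> K j" if "i \<in> J" "j \<in> J" "i \<noteq> j" for i j
      using that \<D>(1) by (auto simp: J_def K_def)
    have K_surj: "\<exists>i\<in>J. K i = C" if "C \<in> \<D>" for C using that \<D>(1) by (auto simp: J_def K_def)
    have "\<exists>u s. 0 < s \<and> K i = cbox u (u + s *\<^sub>R One)" if i: "i \<in> J" for i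
    proof -
      obtain c d where cd: "K i = cbox c d" using \<D>(2)[OF KJ[OF i]] by blast
      then have "cbox c d \<in> \<D>" using KJ[OF i] by simp
      from \<D>(4)[OF this] obtain n
        where n: "\<forall>b\<in>Basis. d \<bullet> b - c \<bullet> b = ((L *\<^sub>R One) \<bullet> b - (- L *\<^sub>R One) \<bullet> b) / 2 ^ n" ..
      define s where "s = 2 * L / 2 ^ n"
      have "d = c + s *\<^sub>R One"
      proof (rule euclidean_eqI)
        fix b :: 'a assume b: "b \<in> Basis"
        then have "d \<bullet> b - c \<bullet> b = (L + L) / 2 ^ n" using n by simp
        then show "d \<bullet> b = (c + s *\<^sub>R One) \<bullet> b" using b by (simp add: s_def inner_add_left)
      qed
      moreover have "0 < s" using L by (simp add: s_def)
      ultimately show ?thesis using cd by blast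
    qed
    then obtain u s where us: "\<And>i. i \<in> J \<Longrightarrow> 0 < s i \<and> K i = cbox (u i) (u i + s i *\<^sub>R One)" by metis
    show thesis
    proof
      show "0 < s i" if "i \<in> J" for i using us[OF that] by simp
      show "S \<subseteq> (\<Union>i\<in>J. cbox (u i) (u i + s i *\<^sub>R One))"
      proof
        fix x assume "x \<in> S"
        then obtain C where "C \<in> \<D>" "x \<in> C" using \<D>(6) by blast
        then obtain i where "i \<in> J" "x \<in> K i" using K_surj by blast
        then show "x \<in> (\<Union>i\<in>J. cbox (u i) (u i + s i *\<^sub>R One))" using us by auto
      qed
      define B where "B i = (if i \<in> J then interior (K i) else {})" for i
      have B: "emeasure lebesgue (B i) = (if i \<in> J then ennreal (s i ^ DIM('a)) else 0)" for i
      proof (cases "i \<in> J")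
        case True
        then show ?thesis using us[OF True]
          by (simp add: B_def interior_cbox inner_diff_left inner_add_left)
      qed (simp add: B_def)
      have "(\<Sum>i. if i \<in> J then ennreal (s i ^ DIM('a)) else 0) = (\<Sum>i. emeasure lebesgue (B i))"
        by (simp add: B)
      also have "\<dots> = emeasure lebesgue (\<Union>i. B i)"
      proof (rule suminf_emeasure)
        show "disjoint_family B"
          unfolding disjoint_family_on_def
        proof (intro ballI impI)
          fix i j :: nat assume "i \<noteq> j"
          then show "B i \<inter> B j = {}"
            using \<D>(3) KJ K_inj unfolding pairwise_def B_def by simp
        qed
      qed (auto simp: B_def)
      also have "\<dots> \<le> emeasure lebesgue (\<Union>\<D>)"
      proof (rule emeasure_mono)
        show "(\<Union>i. B i) \<subseteq> \<Union>\<D>" using KJ interior_subset by (fastforce simp: B_def split: if_splits)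
      qed (use \<D>(7) in \<open>auto dest: fmeasurableD\<close>)
      also have "\<dots> = ennreal (vol (\<Union>\<D>))" using \<D>(7) by (simp add: emeasure_eq_measure2)
      also have "\<dots> \<le> ennreal (vol S + e)" using \<D>(8) by (rule ennreal_leI)
      finally show "(\<Sum>i. if i \<in> J then ennreal (s i ^ DIM('a)) else 0) \<le> ennreal (vol S + e)" .
    qed
  qed
qed

text \<open>The cylinder over \<open>S\<close> is covered by cubes; on average over the unit cube, the slices of these
  cubes cover \<open>S\<close> with total \<open>d\<close>-dimensional volume at most the volume of the cylinder.\<close>
lemma hmeasure_le_cylinder:
  fixes S :: "'a::euclidean_space set"
  assumes D: "D \<subseteq> Basis" and S: "\<And>x b. x \<in> S \<Longrightarrow> b \<in> Basis - D \<Longrightarrow> x \<bullet> b = 0"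
    and cyl: "S + cbox 0 (\<Sum>(Basis - D)) \<in> lmeasurable" "bounded (S + cbox 0 (\<Sum>(Basis - D)))"
  shows "hmeasure (card D) S \<le> ennreal (vol (S + cbox 0 (\<Sum>(Basis - D)))) * hmeasure (card D) (cbox 0 (\<Sum>D))"
proof -
  define d where "d = card D"
  define Q where "Q = cbox 0 (\<Sum>D)"
  define V where "V = vol (S + cbox 0 (\<Sum>(Basis - D)))"
  have V0: "0 \<le> V" by (simp add: V_def)
  have "hmeasure d Q < top" unfolding d_def Q_def by (rule hmeasure_unit_cube_finite[OF D])
  then obtain q where q: "hmeasure d Q = ennreal q" "0 \<le> q"
    using ennreal_enn2real[of "hmeasure d Q"] enn2real_nonneg[of "hmeasure d Q"] by metis
  have card: "card D + card (Basis - D) = DIM('a)"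
    using card_mono[OF finite_Basis D] card_Diff_subset[OF finite_subset[OF D finite_Basis] D] by linarith
  have bound: "hmeasure d S \<le> ennreal (V + e) * hmeasure d Q" if e: "0 < e" for e
  proof -
    show ?thesis
    proof (rule exists_cube_cover[OF cyl half_gt_zero[OF e], folded V_def])
      fix u :: "nat \<Rightarrow> 'a" and s J
      assume us: "\<And>i. i \<in> J \<Longrightarrow> 0 < s i"
        "S + cbox 0 (\<Sum>(Basis - D)) \<subseteq> (\<Union>i\<in>J. cbox (u i) (u i + s i *\<^sub>R One))"
        "(\<Sum>i. if i \<in> J then ennreal (s i ^ DIM('a)) else 0) \<le> ennreal (V + e / 2)"
      define lo where "lo i = (\<Sum>b\<in>Basis - D. (u i \<bullet> b) *\<^sub>R b)" for i
      define hi where "hi i = \<Sum>D + (\<Sum>b\<in>Basis - D. (u i \<bullet> b + s i) *\<^sub>R b)" for i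
      define A where "A i = (if i \<in> J then cbox (lo i) (hi i) \<inter> cbox 0 One else {})" for i
      define w where "w i = (if i \<in> J then ennreal (s i ^ d) else 0)" for i
      \<comment> \<open>\<open>G \<tau>\<close> is the total d-dimensional volume of the cubes met
        by the slice at height \<open>\<tau>\<close>. Only the coordinates of \<open>\<tau>\<close>
        outside \<open>D\<close> matter; letting it range over the whole unit cube keeps to a single
        Lebesgue measure.\<close>
      define G where "G \<tau> = (\<Sum>i. w i * indicator (A i) \<tau>)" for \<tau>
      have lo: "lo i \<bullet> b = (if b \<in> D then 0 else u i \<bullet> b)"
        and hi: "hi i \<bullet> b = (if b \<in> D then 1 else u i \<bullet> b + s i)" if "b \<in> Basis" for i b
        using that inner_sum_subset_Basis[of "Basis - D" b] inner_sum_subset_Basis[OF D that, of "\<lambda>_. 1"]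
        by (auto simp: lo_def hi_def inner_add_left)
      have A_le: "w i * emeasure lborel (A i) \<le> (if i \<in> J then ennreal (s i ^ DIM('a)) else 0)" for i
      proof (cases "i \<in> J")
        case True
        then have s: "0 < s i" by (rule us(1))
        have "emeasure lborel (A i) \<le> emeasure lborel (cbox (lo i) (hi i))"
          using True by (intro emeasure_mono) (auto simp: A_def)
        also have "\<dots> = ennreal (1 ^ card D * s i ^ card (Basis - D))"
          using s lo hi D by (intro emeasure_cbox_subset_Basis[OF D]) (auto simp: inner_diff_left subset_iff)
        finally have "w i * emeasure lborel (A i) \<le> ennreal (s i ^ d) * ennreal (s i ^ card (Basis - D))"
          using True by (simp add: w_def mult_left_mono)
        also have "\<dots> = ennreal (s i ^ DIM('a))"
          using s card by (simp add: d_def flip: ennreal_mult power_add)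
        finally show ?thesis using True by simp
      qed (simp add: w_def)
      have "\<exists>\<tau>\<in>cbox 0 One. G \<tau> \<le> ennreal (V + e)"
      proof (rule ccontr)
        assume "\<not> (\<exists>\<tau>\<in>cbox 0 One. G \<tau> \<le> ennreal (V + e))"
        then have less: "ennreal (V + e) * indicator (cbox 0 One) \<tau> \<le> G \<tau>" for \<tau>
          by (auto simp: indicator_def not_le less_imp_le)
        have "ennreal (V + e) = (\<integral>\<^sup>+\<tau>. ennreal (V + e) * indicator (cbox 0 One :: 'a set) \<tau> \<partial>lborel)"
          by (simp add: nn_integral_cmult_indicator)
        also have "\<dots> \<le> (\<integral>\<^sup>+\<tau>. G \<tau> \<partial>lborel)" by (intro nn_integral_mono less)
        also have "\<dots> = (\<Sum>i. \<integral>\<^sup>+\<tau>. w i * indicator (A i) \<tau> \<partial>lborel)"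
          unfolding G_def by (intro nn_integral_suminf) (auto simp: A_def)
        also have "\<dots> = (\<Sum>i. w i * emeasure lborel (A i))"
          by (intro suminf_cong nn_integral_cmult_indicator) (auto simp: A_def)
        also have "\<dots> \<le> (\<Sum>i. if i \<in> J then ennreal (s i ^ DIM('a)) else 0)"
          using A_le by (intro suminf_le) auto
        also have "\<dots> \<le> ennreal (V + e / 2)" by (rule us(3))
        finally show False using e V0 by (simp add: ennreal_le_iff)
      qed
      then obtain \<tau> where \<tau>: "\<tau> \<in> cbox 0 One" "G \<tau> \<le> ennreal (V + e)" by blast
      define p where "p i = (\<Sum>b\<in>D. (u i \<bullet> b) *\<^sub>R b)" for i
      define P where "P i = (if i \<in> J \<and> \<tau> \<in> A i then (\<lambda>x. p i + s i *\<^sub>R x) ` Q else {})" for i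
      have P: "hmeasure d (P i) \<le> w i * indicator (A i) \<tau> * hmeasure d Q" for i
      proof (cases "i \<in> J \<and> \<tau> \<in> A i")
        case True
        have "dist (p i + s i *\<^sub>R x) (p i + s i *\<^sub>R y) = s i * dist x y" for x y
          using us(1)[of i] True by (simp add: dist_norm flip: scaleR_diff_right)
        from hmeasure_similarity[of "\<lambda>x. p i + s i *\<^sub>R x", OF this, of d Q]
        show ?thesis using True us(1) by (simp add: P_def w_def)
      qed (auto simp: P_def)
      have "S \<subseteq> (\<Union>i. P i)"
      proof
        fix x assume x: "x \<in> S"
        define t where "t = (\<Sum>b\<in>Basis - D. (\<tau> \<bullet> b) *\<^sub>R b)"
        have t: "t \<bullet> b = (if b \<in> D then 0 else \<tau> \<bullet> b)" if "b \<in> Basis" for b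
          using that inner_sum_subset_Basis[of "Basis - D" b] by (auto simp: t_def)
        have "t \<in> cbox 0 (\<Sum>(Basis - D))"
          using \<tau>(1) by (subst mem_cbox_sum_Basis) (auto simp: mem_box t)
        then have "x + t \<in> S + cbox 0 (\<Sum>(Basis - D))" using x by blast
        then obtain i where i: "i \<in> J" "x + t \<in> cbox (u i) (u i + s i *\<^sub>R One)" using us(2) by blast
        have s: "0 < s i" using us(1) i by simp
        have ib: "u i \<bullet> b \<le> x \<bullet> b + t \<bullet> b" "x \<bullet> b + t \<bullet> b \<le> u i \<bullet> b + s i" if "b \<in> Basis" for b
          using i(2) that by (auto simp: mem_box inner_add_left)
        have "\<tau> \<in> cbox (lo i) (hi i)"
          unfolding mem_box
        proof
          fix b :: 'a assume b: "b \<in> Basis"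
          show "lo i \<bullet> b \<le> \<tau> \<bullet> b \<and> \<tau> \<bullet> b \<le> hi i \<bullet> b"
            using ib[OF b] t[OF b] lo[OF b] hi[OF b] S[OF x, of b] \<tau>(1) b by (auto simp: mem_box)
        qed
        then have "\<tau> \<in> A i" using \<tau>(1) i by (simp add: A_def)
        have "(1 / s i) *\<^sub>R (x - p i) \<in> Q"
          unfolding Q_def mem_cbox_sum_Basis[OF D]
        proof
          fix b :: 'a assume b: "b \<in> Basis"
          have "p i \<bullet> b = (if b \<in> D then u i \<bullet> b else 0)"
            unfolding p_def by (rule inner_sum_subset_Basis[OF D b])
          then show "0 \<le> ((1 / s i) *\<^sub>R (x - p i)) \<bullet> b \<and> ((1 / s i) *\<^sub>R (x - p i)) \<bullet> b \<le> (if b \<in> D then 1 else 0)"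
            using ib[OF b] t[OF b] S[OF x, of b] b s by (auto simp: inner_diff_left field_simps)
        qed
        moreover have "x = p i + s i *\<^sub>R ((1 / s i) *\<^sub>R (x - p i))" using s by simp
        ultimately have "x \<in> (\<lambda>x. p i + s i *\<^sub>R x) ` Q" by (rule rev_image_eqI)
        then have "x \<in> P i" using i \<open>\<tau> \<in> A i\<close> by (simp add: P_def)
        then show "x \<in> (\<Union>i. P i)" by blast
      qed
      then have "hmeasure d S \<le> hmeasure d (\<Union>i. P i)" by (rule hmeasure_mono)
      also have "\<dots> \<le> (\<Sum>i. hmeasure d (P i))" by (rule hmeasure_UN)
      also have "\<dots> \<le> (\<Sum>i. w i * indicator (A i) \<tau> * hmeasure d Q)" using P by (intro suminf_le) auto
      also have "\<dots> = G \<tau> * hmeasure d Q" by (simp add: G_def)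
      also have "\<dots> \<le> ennreal (V + e) * hmeasure d Q" by (rule mult_right_mono[OF \<tau>(2)]) simp
      finally show "hmeasure d S \<le> ennreal (V + e) * hmeasure d Q" .
    qed
  qed
  have "hmeasure d S \<le> ennreal V * hmeasure d Q"
  proof (rule ennreal_le_epsilon)
    fix e :: real assume e: "0 < e"
    have "hmeasure d S \<le> ennreal ((V + e / (q + 1)) * q)"
      using bound[of "e / (q + 1)"] e q V0 by (simp add: ennreal_mult)
    also have "(V + e / (q + 1)) * q \<le> V * q + e"
      using e q(2) by (simp add: field_simps)
    also have "ennreal (V * q + e) = ennreal V * hmeasure d Q + ennreal e"
      using V0 q e by (simp add: ennreal_mult)
    finally show "hmeasure d S \<le> ennreal V * hmeasure d Q + ennreal e" by (simp add: ennreal_leI)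
  qed
  then show ?thesis by (simp add: d_def Q_def V_def)
qed

lemma plus_cbox_mem_iff:
  assumes D: "D \<subseteq> (Basis :: 'a::euclidean_space set)"
    and S: "\<And>x b. x \<in> S \<Longrightarrow> b \<in> Basis - D \<Longrightarrow> x \<bullet> b = 0"
  shows "y \<in> S + cbox 0 (\<Sum>(Basis - D)) \<longleftrightarrow>
    (\<Sum>b\<in>D. (y \<bullet> b) *\<^sub>R b) \<in> S \<and> (\<forall>b\<in>Basis - D. 0 \<le> y \<bullet> b \<and> y \<bullet> b \<le> 1)"
proof -
  define p where "p = (\<Sum>b\<in>D. (y \<bullet> b) *\<^sub>R b)"
  have p: "p \<bullet> b = (if b \<in> D then y \<bullet> b else 0)" if "b \<in> Basis" for b
    unfolding p_def by (rule inner_sum_subset_Basis[OF D that])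
  have sub: "Basis - D \<subseteq> Basis" by blast
  show ?thesis
    unfolding p_def[symmetric]
  proof
    assume "y \<in> S + cbox 0 (\<Sum>(Basis - D))"
    then obtain x z where xz: "x \<in> S" "z \<in> cbox 0 (\<Sum>(Basis - D))" "y = x + z" by (auto simp: set_plus_mem_iff)
    have z: "0 \<le> z \<bullet> b \<and> z \<bullet> b \<le> (if b \<in> D then 0 else 1)" if "b \<in> Basis" for b
      using xz(2) that unfolding mem_cbox_sum_Basis[OF sub] by (auto split: if_splits)
    have "p = x"
    proof (rule euclidean_eqI)
      fix b :: 'a assume b: "b \<in> Basis"
      show "p \<bullet> b = x \<bullet> b" using p[OF b] z[OF b] S[OF xz(1), of b] b xz(3) by (auto simp: inner_add_left split: if_splits)
    qed
    moreover have "0 \<le> y \<bullet> b \<and> y \<bullet> b \<le> 1" if "b \<in> Basis - D" for b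
      using that S[OF xz(1) that] z[of b] xz(3) by (simp add: inner_add_left)
    ultimately show "p \<in> S \<and> (\<forall>b\<in>Basis - D. 0 \<le> y \<bullet> b \<and> y \<bullet> b \<le> 1)"
      using xz(1) by blast
  next
    assume *: "p \<in> S \<and> (\<forall>b\<in>Basis - D. 0 \<le> y \<bullet> b \<and> y \<bullet> b \<le> 1)"
    have "y - p \<in> cbox 0 (\<Sum>(Basis - D))"
      unfolding mem_cbox_sum_Basis[OF sub] using * p by (auto simp: inner_diff_left)
    then have "p + (y - p) \<in> S + cbox 0 (\<Sum>(Basis - D))" using * by blast
    then show "y \<in> S + cbox 0 (\<Sum>(Basis - D))" by simp
  qed
qed

text \<open>The lower bound follows from the upper bound applied to the complement of \<open>S\<close> in a large cube.\<close>
lemma hmeasure_eq_cylinder: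
  fixes S :: "'a::euclidean_space set"
  assumes D: "D \<subseteq> Basis" and S: "\<And>x b. x \<in> S \<Longrightarrow> b \<in> Basis - D \<Longrightarrow> x \<bullet> b = 0"
    and cyl: "S + cbox 0 (\<Sum>(Basis - D)) \<in> lmeasurable" "bounded (S + cbox 0 (\<Sum>(Basis - D)))"
    and bS: "bounded S"
  shows "hmeasure (card D) S = ennreal (vol (S + cbox 0 (\<Sum>(Basis - D)))) * hmeasure (card D) (cbox 0 (\<Sum>D))"
proof (rule antisym)
  define d where "d = card D"
  define Q where "Q = cbox 0 (\<Sum>D)"
  define C where "C = cbox 0 (\<Sum>(Basis - D))"
  have "hmeasure d Q < top" unfolding d_def Q_def by (rule hmeasure_unit_cube_finite[OF D])
  then obtain q where q: "hmeasure d Q = ennreal q" "0 \<le> q"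
    using ennreal_enn2real[of "hmeasure d Q"] enn2real_nonneg[of "hmeasure d Q"] by metis
  obtain L where L: "0 < L" "\<And>x. x \<in> S \<Longrightarrow> norm x \<le> L"
    using bS unfolding bounded_pos by auto
  \<comment> \<open>\<open>f\<close> maps the unit cube \<open>Q\<close> onto the cube
    \<open>R\<close> of side \<open>2 * L\<close> around the origin in the directions
    \<open>D\<close>, which contains \<open>S\<close>.\<close>
  define f where "f x = - L *\<^sub>R \<Sum>D + (2 * L) *\<^sub>R x" for x :: 'a
  define R where "R = f ` Q"
  have SumD: "\<Sum>D \<bullet> b = (if b \<in> D then 1 else 0)" if "b \<in> Basis" for b
    using inner_sum_subset_Basis[OF D that, of "\<lambda>_. 1"] by simp
  have R: "x \<in> R \<longleftrightarrow> (\<forall>b\<in>Basis. if b \<in> D then \<bar>x \<bullet> b\<bar> \<le> L else x \<bullet> b = 0)" for x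
  proof
    assume "x \<in> R"
    then obtain z where z: "x = f z" "\<forall>b\<in>Basis. 0 \<le> z \<bullet> b \<and> z \<bullet> b \<le> (if b \<in> D then 1 else 0)"
      unfolding R_def Q_def using mem_cbox_sum_Basis[OF D] by blast
    show "\<forall>b\<in>Basis. if b \<in> D then \<bar>x \<bullet> b\<bar> \<le> L else x \<bullet> b = 0"
    proof
      fix b :: 'a assume b: "b \<in> Basis"
      have "0 \<le> z \<bullet> b" "z \<bullet> b \<le> (if b \<in> D then 1 else 0)" using z(2) b by auto
      moreover have "L * (z \<bullet> b) \<le> L * (if b \<in> D then 1 else 0)" "0 \<le> L * (z \<bullet> b)"
        using L(1) calculation by (auto intro: mult_left_mono)
      ultimately show "if b \<in> D then \<bar>x \<bullet> b\<bar> \<le> L else x \<bullet> b = 0"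
        using L(1) by (auto simp: z(1) f_def inner_diff_left SumD[OF b] abs_le_iff split: if_splits)
    qed
  next
    assume x: "\<forall>b\<in>Basis. if b \<in> D then \<bar>x \<bullet> b\<bar> \<le> L else x \<bullet> b = 0"
    define z where "z = (1 / (2 * L)) *\<^sub>R (x + L *\<^sub>R \<Sum>D)"
    have "x = f z" using L(1) by (simp add: f_def z_def)
    moreover have "z \<in> Q"
      unfolding Q_def mem_cbox_sum_Basis[OF D]
    proof
      fix b :: 'a assume b: "b \<in> Basis"
      then have "if b \<in> D then \<bar>x \<bullet> b\<bar> \<le> L else x \<bullet> b = 0" using x by blast
      then show "0 \<le> z \<bullet> b \<and> z \<bullet> b \<le> (if b \<in> D then 1 else 0)"
        using L(1) by (auto simp: z_def inner_add_left SumD[OF b] field_simps abs_le_iff split: if_splits)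
    qed
    ultimately show "x \<in> R" by (auto simp: R_def)
  qed
  have SR: "S \<subseteq> R"
  proof
    fix x assume "x \<in> S"
    then show "x \<in> R"
      unfolding R using L(2)[OF \<open>x \<in> S\<close>] S Basis_le_norm[of _ x] by (auto intro: order_trans)
  qed
  have R0: "x \<bullet> b = 0" if "x \<in> R" "b \<in> Basis - D" for x b using that R[of x] by auto
  define l where "l = - L *\<^sub>R \<Sum>D"
  define h where "h = L *\<^sub>R \<Sum>D + \<Sum>(Basis - D)"
  have lb: "l \<bullet> b = (if b \<in> D then - L else 0)" and hb: "h \<bullet> b = (if b \<in> D then L else 1)" if "b \<in> Basis" for b
    using that SumD[OF that] inner_sum_subset_Basis[of "Basis - D" b "\<lambda>_. 1"]
    by (auto simp: l_def h_def inner_add_left)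
  have mem_RC: "y \<in> R + C \<longleftrightarrow> (\<Sum>b\<in>D. (y \<bullet> b) *\<^sub>R b) \<in> R \<and> (\<forall>b\<in>Basis - D. 0 \<le> y \<bullet> b \<and> y \<bullet> b \<le> 1)" for y
    unfolding C_def by (rule plus_cbox_mem_iff[OF D]) (rule R0)
  have mem_SC: "y \<in> S + C \<longleftrightarrow> (\<Sum>b\<in>D. (y \<bullet> b) *\<^sub>R b) \<in> S \<and> (\<forall>b\<in>Basis - D. 0 \<le> y \<bullet> b \<and> y \<bullet> b \<le> 1)" for y
    unfolding C_def by (rule plus_cbox_mem_iff[OF D]) (rule S)
  have mem_RSC: "y \<in> (R - S) + C \<longleftrightarrow> (\<Sum>b\<in>D. (y \<bullet> b) *\<^sub>R b) \<in> R - S \<and> (\<forall>b\<in>Basis - D. 0 \<le> y \<bullet> b \<and> y \<bullet> b \<le> 1)" for y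
    unfolding C_def by (rule plus_cbox_mem_iff[OF D]) (use R0 in blast)
  have RC: "R + C = cbox l h"
  proof (intro set_eqI)
    fix y
    have "(\<Sum>b\<in>D. (y \<bullet> b) *\<^sub>R b) \<in> R \<longleftrightarrow> (\<forall>b\<in>D. \<bar>y \<bullet> b\<bar> \<le> L)"
      using D unfolding R by (auto simp: inner_sum_subset_Basis[OF D])
    moreover have "y \<in> cbox l h \<longleftrightarrow> (\<forall>b\<in>Basis. if b \<in> D then \<bar>y \<bullet> b\<bar> \<le> L else 0 \<le> y \<bullet> b \<and> y \<bullet> b \<le> 1)"
      unfolding mem_box by (rule ball_cong[OF refl]) (auto simp: lb hb abs_le_iff)
    ultimately show "y \<in> R + C \<longleftrightarrow> y \<in> cbox l h"
      unfolding mem_RC using D by auto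
  qed
  have vRC: "vol (R + C) = (2 * L) ^ d"
  proof -
    have "emeasure lborel (cbox l h) = ennreal ((2 * L) ^ card D * 1 ^ card (Basis - D))"
      using lb hb L(1) D by (intro emeasure_cbox_subset_Basis[OF D]) (auto simp: inner_diff_left subset_iff)
    then show ?thesis using L(1) by (simp add: RC measure_def d_def)
  qed
  have diff: "(R - S) + C = (R + C) - (S + C)"
    unfolding set_eq_iff Diff_iff mem_RC mem_SC mem_RSC by blast
  have sub: "S + C \<subseteq> R + C" by (rule set_plus_mono2[OF SR order_refl])
  have SC: "S + C \<in> lmeasurable" using cyl(1) by (simp add: C_def)
  have vdiff: "vol ((R - S) + C) = (2 * L) ^ d - vol (S + C)"
    unfolding diff vRC[symmetric] using SC sub by (intro measurable_measure_Diff) (auto simp: RC fmeasurableD)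
  have h1: "hmeasure d (R - S) \<le> ennreal (vol ((R - S) + C)) * hmeasure d Q"
    unfolding d_def Q_def C_def
  proof (rule hmeasure_le_cylinder[OF D])
    show "(R - S) + cbox 0 (\<Sum>(Basis - D)) \<in> lmeasurable"
      unfolding C_def[symmetric] diff using SC by (auto simp: RC)
    show "bounded ((R - S) + cbox 0 (\<Sum>(Basis - D)))"
      unfolding C_def[symmetric] diff RC by (rule bounded_subset[of "cbox l h"]) auto
  qed (use R0 in auto)
  have h2: "ennreal ((2 * L) ^ d) * hmeasure d Q \<le> hmeasure d R"
  proof -
    define g where "g x = (1 / (2 * L)) *\<^sub>R (x + L *\<^sub>R \<Sum>D)" for x :: 'a
    have "g (f x) = x" for x using L(1) by (simp add: f_def g_def)
    then have "Q = g ` R" unfolding R_def image_image by simp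
    moreover have "hmeasure d (g ` R) \<le> ennreal ((1 / (2 * L)) ^ d) * hmeasure d R"
    proof (rule hmeasure_similarity)
      fix x y
      have "g x - g y = (1 / (2 * L)) *\<^sub>R (x - y)" by (simp add: g_def algebra_simps)
      then show "dist (g x) (g y) = 1 / (2 * L) * dist x y" using L(1) by (simp add: dist_norm)
    qed (use L(1) in simp)
    ultimately have "ennreal ((2 * L) ^ d) * hmeasure d Q \<le> ennreal ((2 * L) ^ d) * (ennreal ((1 / (2 * L)) ^ d) * hmeasure d R)"
      by (simp add: mult_left_mono)
    also have "\<dots> = hmeasure d R"
    proof -
      have "(2 * L) ^ d * (1 / (2 * L)) ^ d = ((2 * L) * (1 / (2 * L))) ^ d" by (rule power_mult_distrib[symmetric])
      also have "(2 * L) * (1 / (2 * L)) = 1" using L(1) by simp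
      finally have "ennreal ((2 * L) ^ d) * ennreal ((1 / (2 * L)) ^ d) = 1"
        using L(1) by (subst ennreal_mult[symmetric]) auto
      then show ?thesis unfolding mult.assoc[symmetric] by simp
    qed
    finally show ?thesis .
  qed
  \<comment> \<open>By subadditivity, what the complement \<open>R - S\<close> cannot contribute to
    the measure of \<open>R\<close> must come from \<open>S\<close>.\<close>
  have h3: "hmeasure d R \<le> hmeasure d S + hmeasure d (R - S)"
    using hmeasure_Un[of d S "R - S"] SR by (simp add: Un_absorb1)
  have le: "ennreal ((2 * L) ^ d) * hmeasure d Q \<le> hmeasure d S + ennreal ((2 * L) ^ d - vol (S + C)) * hmeasure d Q"
    using order_trans[OF h2 order_trans[OF h3 add_left_mono[OF h1]]] unfolding vdiff .
  have vle: "vol (S + C) \<le> (2 * L) ^ d" using vdiff measure_nonneg[of lebesgue "(R - S) + C"] by linarith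
  have "ennreal (vol (S + C)) * hmeasure d Q \<le> hmeasure d S"
  proof (cases "hmeasure d S")
    case (real s)
    have "ennreal ((2 * L) ^ d * q) \<le> ennreal (s + ((2 * L) ^ d - vol (S + C)) * q)"
      using le q real vle L(1) by (simp add: ennreal_mult)
    then have "(2 * L) ^ d * q \<le> s + ((2 * L) ^ d - vol (S + C)) * q"
      using real q vle by (subst (asm) ennreal_le_iff) auto
    then have "vol (S + C) * q \<le> s" by (simp add: algebra_simps)
    then show ?thesis using real q by (simp add: ennreal_leI flip: ennreal_mult)
  qed simp
  then show "ennreal (vol (S + cbox 0 (\<Sum>(Basis - D)))) * hmeasure (card D) (cbox 0 (\<Sum>D)) \<le> hmeasure (card D) S"
    by (simp add: d_def Q_def C_def)
qed (rule hmeasure_le_cylinder[OF assms(1-4)])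

text \<open>\<open>D\<close> is the very choice made in \<open>unit_cube\<close>, so the constant of
  \<open>hmeasure_eq_cylinder\<close> cancels in the quotient; it can be cancelled because it is
  finite and positive.\<close>

lemma hausdorff_eq_cylinder:
  fixes S :: "'a::euclidean_space set" and d :: nat
  defines "D \<equiv> (SOME D. D \<subseteq> (Basis :: 'a set) \<and> card D = d)"
  assumes d: "d \<le> DIM('a)" and S: "\<And>x b. x \<in> S \<Longrightarrow> b \<in> Basis - D \<Longrightarrow> x \<bullet> b = 0" and cS: "convex_body S"
  shows "hausdorff d S = vol (S + cbox 0 (\<Sum>(Basis - D)))"
proof -
  have "\<exists>D. D \<subseteq> (Basis :: 'a set) \<and> card D = d" using d by (metis obtain_subset_with_card_n)
  then have D: "D \<subseteq> Basis" "card D = d" unfolding D_def by (metis (mono_tags, lifting) someI_ex)+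
  define q where "q = hmeasure d (cbox 0 (\<Sum>D))"
  have q: "q < top" "0 < q"
    unfolding q_def using hmeasure_unit_cube_finite[OF D(1)] hmeasure_unit_cube_pos[OF D(1)] D(2) by auto
  have cyl: "convex_body (S + cbox 0 (\<Sum>(Basis - D)))"
    using cS inner_sum_subset_Basis[of "Basis - D" _ "\<lambda>_. 1"]
    by (intro convex_body_plus) (auto simp: convex_body_def box_ne_empty)
  have "hmeasure d S = ennreal (vol (S + cbox 0 (\<Sum>(Basis - D)))) * q"
    unfolding q_def D(2)[symmetric] using cyl cS S
    by (intro hmeasure_eq_cylinder D) (auto simp: convex_body_def compact_imp_bounded lmeasurable_compact)
  then show ?thesis
    using q enn2real_positive_iff[of q]
    by (simp add: hausdorff_def unit_cube_def D_def[symmetric] q_def[symmetric] enn2real_mult)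
qed

section \<open>Projections\<close>

text \<open>The reflection in the hyperplane orthogonal to \<open>a - b\<close>. Fixing that
  hyperplane pointwise, it moves one vector without disturbing those orthogonal to both
  \<open>a\<close> and \<open>b\<close>. For \<open>a = b\<close> the formula gives the
  identity.\<close>

lemma exists_reflection:
  fixes a b :: "real^'n"
  assumes "norm a = norm b"
  obtains f where "orthogonal_transformation f" "f a = b" "\<And>x. x \<bullet> (a - b) = 0 \<Longrightarrow> f x = x"
proof -
  define z where "z = a - b"
  define f where "f x = x - (2 * (x \<bullet> z) / (z \<bullet> z)) *\<^sub>R z" for x
  have ff: "f x \<bullet> f y = x \<bullet> y" for x y
  proof (cases "z \<bullet> z = 0")
    case False
    then show ?thesis
      by (simp add: f_def inner_diff_left inner_diff_right inner_commute field_simps)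
  qed (simp add: f_def)
  have "linear f"
    by (rule linearI) (simp_all add: f_def inner_add_left algebra_simps add_divide_distrib)
  then have "orthogonal_transformation f" using ff by (simp add: orthogonal_transformation_def)
  moreover have "f a = b"
  proof (cases "a = b")
    case False
    have "a \<bullet> a = b \<bullet> b" using assms by (simp add: norm_eq)
    then have "2 * (a \<bullet> z) = z \<bullet> z"
      by (simp add: z_def inner_diff_left inner_diff_right inner_commute)
    moreover have "z \<bullet> z \<noteq> 0" using False by (simp add: z_def)
    ultimately show ?thesis by (simp add: f_def z_def)
  qed (simp add: f_def z_def)
  moreover have "f x = x" if "x \<bullet> (a - b) = 0" for x using that by (simp add: f_def z_def)
  ultimately show thesis using that by blast
qed

lemma orthogonal_transformation_vol:
  fixes f :: "real^'n::finite \<Rightarrow> real^'n"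
  assumes "orthogonal_transformation f" "S \<in> lmeasurable"
  shows "vol (f ` S) = vol S"
  using assms by (simp add: vol_linear_image orthogonal_transformation_linear)

lemma hausdorff_isometry:
  fixes f :: "'a::euclidean_space \<Rightarrow> 'a"
  assumes "\<And>x y. dist (f x) (f y) = dist x y" "surj f"
  shows "hausdorff d (f ` S) = hausdorff d S"
  by (simp add: hausdorff_def hmeasure_isometry[of f, OF assms])

lemma convex_body_linear_image: "linear f \<Longrightarrow> convex_body A \<Longrightarrow> convex_body (f ` A)"
  unfolding convex_body_def linear_conv_bounded_linear
  by (auto simp: linear_continuous_on intro!: compact_continuous_image convex_linear_image bounded_linear.linear)

text \<open>Thickening \<open>S\<close> by a unit cube \<open>K\<close> in orthogonal directions
  turns lower-dimensional measure into volume. The map \<open>f\<close> carries the directions of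
  \<open>K\<close> to the coordinate directions that \<open>unit_cube\<close> leaves out.\<close>

lemma hausdorff_orthonormal:
  fixes f :: "real^'n::finite \<Rightarrow> real^'n"
  assumes f: "orthogonal_transformation f" and S: "convex_body S"
    and D: "d \<le> CARD('n)" "E = Basis - (SOME D. D \<subseteq> (Basis :: (real^'n) set) \<and> card D = d)"
    and K: "convex_body K" "f ` K = cbox 0 (\<Sum>E)"
    and orth: "\<And>x b. x \<in> S \<Longrightarrow> b \<in> E \<Longrightarrow> f x \<bullet> b = 0"
  shows "hausdorff d S = vol (S + K)"
proof -
  have lin: "linear f" using f by (rule orthogonal_transformation_linear)
  have "hausdorff d S = hausdorff d (f ` S)"
    using orthogonal_transformation_isometry[THEN iffD1, OF f] orthogonal_transformation_surj[OF f]
    by (intro hausdorff_isometry[symmetric]) blast+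
  also have "\<dots> = vol (f ` S + cbox 0 (\<Sum>E))"
    using D orth convex_body_linear_image[OF lin S] unfolding D(2) by (intro hausdorff_eq_cylinder) auto
  also have "f ` S + cbox 0 (\<Sum>E) = f ` (S + K)"
    by (simp add: linear_image_set_plus[OF lin] K)
  also have "vol \<dots> = vol (S + K)"
    using S K by (intro orthogonal_transformation_vol[OF f] convex_body_lmeasurable convex_body_plus)
  finally show ?thesis .
qed

lemma some_subset_Basis:
  assumes "d \<le> DIM('a::euclidean_space)"
  defines "D \<equiv> SOME D. D \<subseteq> (Basis :: 'a set) \<and> card D = d"
  shows "D \<subseteq> Basis" "card (Basis - D) = DIM('a) - d"
proof -
  have "\<exists>D. D \<subseteq> (Basis :: 'a set) \<and> card D = d" using assms(1) by (metis obtain_subset_with_card_n)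
  then have D: "D \<subseteq> Basis" "card D = d" unfolding D_def by (metis (mono_tags, lifting) someI_ex)+
  then show "D \<subseteq> Basis" "card (Basis - D) = DIM('a) - d"
    by (simp_all add: card_Diff_subset[OF finite_subset[OF D(1) finite_Basis] D(1)])
qed

lemma hausdorff_hyperplane:
  fixes S :: "(real^'n::finite) set"
  assumes u: "norm u = 1" and S: "convex_body S" "\<And>x. x \<in> S \<Longrightarrow> x \<bullet> u = 0"
  shows "hausdorff (CARD('n) - 1) S = vol (S + seg u)"
proof -
  define E where "E = Basis - (SOME D. D \<subseteq> (Basis :: (real^'n) set) \<and> card D = CARD('n) - 1)"
  have "card E = DIM(real^'n) - (CARD('n) - 1)"
    unfolding E_def by (rule some_subset_Basis(2)) simp
  moreover have "0 < CARD('n)" by simp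
  ultimately have "card E = 1" by simp
  then obtain e where E: "E = {e}" by (auto simp: card_1_singleton_iff)
  have EB: "E \<subseteq> Basis" by (auto simp: E_def)
  then have e: "e \<in> Basis" by (simp add: E)
  obtain f where f: "orthogonal_transformation f" "f u = e"
    using orthogonal_transformation_exists_1[OF u norm_Basis[OF e]] by metis
  show ?thesis
  proof (rule hausdorff_orthonormal[OF f(1) S(1) _ E_def])
    have "f ` seg u = (\<Sum>b\<in>E. seg b)"
      by (simp add: linear_image_seg[OF orthogonal_transformation_linear[OF f(1)]] f E)
    then show "f ` seg u = cbox 0 (\<Sum>E)" by (simp only: sum_seg_Basis[OF EB])
    show "f x \<bullet> b = 0" if "x \<in> S" "b \<in> E" for x b
      using that f S(2) E unfolding orthogonal_transformation_def by (metis singletonD)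
  qed auto
qed

lemma hausdorff_codim_2:
  fixes S :: "(real^'n::finite) set"
  assumes u: "norm u = 1" "norm w = 1" "orthogonal u w"
    and S: "convex_body S" "\<And>x. x \<in> S \<Longrightarrow> x \<bullet> u = 0" "\<And>x. x \<in> S \<Longrightarrow> x \<bullet> w = 0"
    and n: "2 \<le> CARD('n)"
  shows "hausdorff (CARD('n) - 2) S = vol (S + (seg u + seg w))"
proof -
  define E where "E = Basis - (SOME D. D \<subseteq> (Basis :: (real^'n) set) \<and> card D = CARD('n) - 2)"
  have "card E = DIM(real^'n) - (CARD('n) - 2)"
    unfolding E_def by (rule some_subset_Basis(2)) simp
  then have "card E = 2" using n by simp
  then obtain e1 e2 where E: "E = {e1, e2}" "e1 \<noteq> e2" by (auto simp: card_2_iff)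
  have EB: "E \<subseteq> Basis" by (auto simp: E_def)
  then have e: "e1 \<in> Basis" "e2 \<in> Basis" by (simp_all add: E)
  have e12: "e1 \<bullet> e2 = 0" using E e by (simp add: inner_Basis)
  obtain g where g: "orthogonal_transformation g" "g u = e1"
    using orthogonal_transformation_exists_1[OF u(1) norm_Basis[OF e(1)]] by metis
  have gw: "norm (g w) = norm e2" "e1 \<bullet> g w = 0"
    using g u e unfolding orthogonal_transformation_def orthogonal_def
    by (metis norm_Basis norm_eq, metis)
  \<comment> \<open>Both \<open>g w\<close> and \<open>e2\<close> are orthogonal to
    \<open>e1\<close>, so the reflection taking one to the other keeps \<open>g u = e1\<close> in
    place.\<close>
  obtain h where h: "orthogonal_transformation h" "h (g w) = e2" "\<And>x. x \<bullet> (g w - e2) = 0 \<Longrightarrow> h x = x"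
    using exists_reflection[OF gw(1)] by metis
  define f where "f = h \<circ> g"
  have f: "orthogonal_transformation f" "f u = e1" "f w = e2"
    using g h gw e12 orthogonal_transformation_compose[OF h(1) g(1)] by (auto simp: f_def inner_diff_right)
  have lin: "linear f" using f(1) by (rule orthogonal_transformation_linear)
  show ?thesis
  proof (rule hausdorff_orthonormal[OF f(1) S(1) _ E_def])
    have "f ` (seg u + seg w) = (\<Sum>b\<in>E. seg b)"
      by (simp add: linear_image_set_plus[OF lin] linear_image_seg[OF lin] f E)
    then show "f ` (seg u + seg w) = cbox 0 (\<Sum>E)" by (simp only: sum_seg_Basis[OF EB])
    show "f x \<bullet> b = 0" if "x \<in> S" "b \<in> E" for x b
    proof -
      have "f x \<bullet> f u = 0" "f x \<bullet> f w = 0"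
        using f(1) S that unfolding orthogonal_transformation_def by auto
      then show ?thesis using that E f by auto
    qed
  qed (auto intro: convex_body_plus)
qed

section \<open>Formulas for orthogonal projections\<close>

lemma orth_proj_eqI:
  assumes "y \<in> U\<^sup>\<bottom>" "x - y \<in> (U\<^sup>\<bottom>)\<^sup>\<bottom>"
  shows "orth_proj (U\<^sup>\<bottom>) x = y"
  unfolding orth_proj_def
proof (rule the_equality)
  fix z assume z: "z \<in> U\<^sup>\<bottom> \<and> x - z \<in> (U\<^sup>\<bottom>)\<^sup>\<bottom>"
  have "y - z \<in> U\<^sup>\<bottom>"
    using assms(1) z by (auto simp: orthogonal_comp_def orthogonal_def inner_diff_right)
  then have "(y - z) \<bullet> (x - y) = 0" "(y - z) \<bullet> (x - z) = 0"
    using assms(2) z by (auto simp: orthogonal_comp_def orthogonal_def)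
  then have "(y - z) \<bullet> (y - z) = 0" by (simp add: inner_diff_right)
  then show "z = y" by simp
qed (use assms in blast)

definition proj1 :: "'a::real_inner \<Rightarrow> 'a \<Rightarrow> 'a" where
  "proj1 u x = x - (x \<bullet> u) *\<^sub>R u"

lemma linear_proj1: "linear (proj1 u)"
  by (rule linearI) (simp_all add: proj1_def inner_add_left algebra_simps)

lemma proj1_orth: "norm u = 1 \<Longrightarrow> proj1 u x \<bullet> u = 0"
  by (simp add: proj1_def inner_diff_left norm_eq_1)

lemma orth_proj_1:
  assumes "norm u = 1"
  shows "orth_proj ({u}\<^sup>\<bottom>) = proj1 u"
proof
  fix x
  show "orth_proj ({u}\<^sup>\<bottom>) x = proj1 u x"
    using assms proj1_orth[OF assms, of x]
    by (intro orth_proj_eqI) (auto simp: orthogonal_comp_def orthogonal_def inner_commute proj1_def)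
qed

lemma orth_proj_2:
  assumes "norm u = 1" "norm w = 1" "orthogonal u w"
  shows "orth_proj ({u, w}\<^sup>\<bottom>) = proj1 w \<circ> proj1 u"
proof
  fix x
  have uw: "u \<bullet> w = 0" "w \<bullet> u = 0" using assms(3) by (auto simp: orthogonal_def inner_commute)
  have P: "proj1 w (proj1 u x) = x - (x \<bullet> u) *\<^sub>R u - (x \<bullet> w) *\<^sub>R w"
    by (simp add: proj1_def inner_diff_left uw)
  have "u \<bullet> u = 1" "w \<bullet> w = 1" using assms by (auto simp: norm_eq_1)
  then have "u \<bullet> proj1 w (proj1 u x) = 0" "w \<bullet> proj1 w (proj1 u x) = 0"
    by (simp_all add: P inner_diff_right uw inner_commute)
  moreover have "y \<bullet> (x - proj1 w (proj1 u x)) = 0" if "u \<bullet> y = 0" "w \<bullet> y = 0" for y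
    using that by (simp add: P inner_add_right inner_commute)
  ultimately show "orth_proj ({u, w}\<^sup>\<bottom>) x = (proj1 w \<circ> proj1 u) x"
    unfolding o_def by (intro orth_proj_eqI) (auto simp: orthogonal_comp_def orthogonal_def)
qed

section \<open>Growth of the volume of long cylinders\<close>

lemma vol_hyperplane:
  assumes "u \<noteq> 0" "\<And>x. x \<in> A \<Longrightarrow> x \<bullet> u = 0"
  shows "vol A = 0"
proof -
  have "negligible {x. u \<bullet> x = 0}" by (rule negligible_hyperplane) (use assms in simp)
  then have "negligible A" by (rule negligible_subset) (use assms(2) in \<open>auto simp: inner_commute\<close>)
  then show ?thesis by (rule negligible_imp_measure0)
qed

lemma seg_scaleR_memI: "0 \<le> r \<Longrightarrow> r \<le> t \<Longrightarrow> r *\<^sub>R v \<in> seg (t *\<^sub>R v)"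
  by (auto simp: seg_scaleR_eq)

lemma linear_growth_le:
  fixes a b c d :: real
  assumes "\<And>t. 0 \<le> t \<Longrightarrow> a + t * b \<le> c + t * d"
  shows "b \<le> d"
proof (rule ccontr)
  assume "\<not> b \<le> d"
  then have bd: "0 < b - d" by simp
  define t where "t = (\<bar>c - a\<bar> + 1) / (b - d)"
  have "0 \<le> t" using bd by (simp add: t_def)
  have "t * (b - d) = \<bar>c - a\<bar> + 1" using bd by (simp add: t_def)
  then show False using assms[OF \<open>0 \<le> t\<close>] by (simp add: algebra_simps)
qed

text \<open>The points of \<open>A\<close> have heights between \<open>-R\<close> and
  \<open>R\<close> over the projection, and an extension by \<open>2 * R\<close> absorbs this spread
  in both directions. Besides the growth rates, the case \<open>t = 0\<close> of the first bound
  shows that a body of positive volume has positive shadow.\<close>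

lemma vol_cylinder_bounds:
  fixes A :: "'a::euclidean_space set"
  assumes A: "convex_body A" and u: "norm u = 1"
  defines "g \<equiv> vol (proj1 u ` A + seg u)"
  obtains R where "0 < R" "\<And>t. 0 \<le> t \<Longrightarrow> vol A + t * shadow u A \<le> 2 * R * g + t * g"
    "\<And>t. 0 \<le> t \<Longrightarrow> 0 + t * g \<le> (vol A + 2 * R * shadow u A) + t * shadow u A"
proof -
  let ?P = "proj1 u ` A"
  have P: "convex_body ?P" using A by (rule convex_body_linear_image[OF linear_proj1])
  have volP: "vol ?P = 0"
    using u proj1_orth by (intro vol_hyperplane[of u]) auto
  have g: "shadow u ?P = g" by (simp add: g_def shadow_def volP)
  obtain R where R: "0 < R" "\<And>x. x \<in> A \<Longrightarrow> norm x \<le> R"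
    using A compact_imp_bounded[of A] by (auto simp: convex_body_def bounded_pos)
  have xu: "- R \<le> x \<bullet> u" "x \<bullet> u \<le> R" if "x \<in> A" for x
    using Cauchy_Schwarz_ineq2[of x u] R(2)[OF that] u by auto
  have t2: "0 \<le> 2 * R + t" if "0 \<le> t" for t using that R(1) by simp
  have 1: "vol A + t * shadow u A \<le> 2 * R * g + t * g" if t: "0 \<le> t" for t
  proof -
    have "A + seg (t *\<^sub>R u) \<subseteq> {- R *\<^sub>R u} + (?P + seg ((2 * R + t) *\<^sub>R u))"
    proof
      fix y assume "y \<in> A + seg (t *\<^sub>R u)"
      then obtain x r where x: "x \<in> A" "0 \<le> r" "r \<le> t" "y = x + r *\<^sub>R u"
        using t by (auto simp: set_plus_mem_iff seg_scaleR_eq)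
      have "(R + x \<bullet> u + r) *\<^sub>R u \<in> seg ((2 * R + t) *\<^sub>R u)"
        using x xu[OF x(1)] by (intro seg_scaleR_memI) auto
      then have "- R *\<^sub>R u + (proj1 u x + (R + x \<bullet> u + r) *\<^sub>R u) \<in> {- R *\<^sub>R u} + (?P + seg ((2 * R + t) *\<^sub>R u))"
        using x(1) by (intro set_plus_intro) auto
      also have "- R *\<^sub>R u + (proj1 u x + (R + x \<bullet> u + r) *\<^sub>R u) = y"
        by (simp add: x(4) proj1_def algebra_simps)
      finally show "y \<in> {- R *\<^sub>R u} + (?P + seg ((2 * R + t) *\<^sub>R u))" .
    qed
    then have "vol (A + seg (t *\<^sub>R u)) \<le> vol ({- R *\<^sub>R u} + (?P + seg ((2 * R + t) *\<^sub>R u)))"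
      using A P by (intro vol_mono convex_body_plus) auto
    then show ?thesis
      unfolding vol_translate vol_plus_seg[OF A t] vol_plus_seg[OF P t2[OF t]] volP g
      by (simp add: algebra_simps)
  qed
  have 2: "0 + t * g \<le> (vol A + 2 * R * shadow u A) + t * shadow u A" if t: "0 \<le> t" for t
  proof -
    have "?P + seg (t *\<^sub>R u) \<subseteq> {- R *\<^sub>R u} + (A + seg ((2 * R + t) *\<^sub>R u))"
    proof
      fix y assume "y \<in> ?P + seg (t *\<^sub>R u)"
      then obtain x r where x: "x \<in> A" "0 \<le> r" "r \<le> t" "y = proj1 u x + r *\<^sub>R u"
        using t by (auto simp: set_plus_mem_iff seg_scaleR_eq)
      have "(R - x \<bullet> u + r) *\<^sub>R u \<in> seg ((2 * R + t) *\<^sub>R u)"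
        using x xu[OF x(1)] by (intro seg_scaleR_memI) auto
      then have "- R *\<^sub>R u + (x + (R - x \<bullet> u + r) *\<^sub>R u) \<in> {- R *\<^sub>R u} + (A + seg ((2 * R + t) *\<^sub>R u))"
        using x(1) by (intro set_plus_intro) auto
      also have "- R *\<^sub>R u + (x + (R - x \<bullet> u + r) *\<^sub>R u) = y"
        by (simp add: x(4) proj1_def algebra_simps)
      finally show "y \<in> {- R *\<^sub>R u} + (A + seg ((2 * R + t) *\<^sub>R u))" .
    qed
    then have "vol (?P + seg (t *\<^sub>R u)) \<le> vol ({- R *\<^sub>R u} + (A + seg ((2 * R + t) *\<^sub>R u)))"
      using A P by (intro vol_mono convex_body_plus) auto
    then show ?thesis
      unfolding vol_translate vol_plus_seg[OF A t2[OF t]] vol_plus_seg[OF P t] volP g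
      by (simp add: algebra_simps)
  qed
  show thesis using that[OF R(1) 1 2] by blast
qed

text \<open>Both sides are linear growth rates of volumes of long cylinders, those of \<open>A + [0, t u]\<close> and
  \<open>proj1 u ` A + [0, t u]\<close>, which contain each other after a bounded extension in direction \<open>u\<close>.\<close>
lemma shadow_eq_projection:
  fixes A :: "'a::euclidean_space set"
  assumes A: "convex_body A" and u: "norm u = 1"
  shows "shadow u A = vol (proj1 u ` A + seg u)"
proof (rule vol_cylinder_bounds[OF A u])
  fix R
  assume 1: "\<And>t. 0 \<le> t \<Longrightarrow> vol A + t * shadow u A
      \<le> 2 * R * vol (proj1 u ` A + seg u) + t * vol (proj1 u ` A + seg u)"
    and 2: "\<And>t. 0 \<le> t \<Longrightarrow> 0 + t * vol (proj1 u ` A + seg u)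
      \<le> (vol A + 2 * R * shadow u A) + t * shadow u A"
  show ?thesis using linear_growth_le[OF 1] linear_growth_le[OF 2] by simp
qed

lemma shadow_pos:
  fixes A :: "'a::euclidean_space set"
  assumes A: "convex_body A" and u: "norm u = 1" and "vol A \<noteq> 0"
  shows "0 < shadow u A"
proof (rule vol_cylinder_bounds[OF A u])
  fix R :: real
  assume "0 < R" and 1: "\<And>t. 0 \<le> t \<Longrightarrow> vol A + t * shadow u A
      \<le> 2 * R * vol (proj1 u ` A + seg u) + t * vol (proj1 u ` A + seg u)"
  have "vol A \<le> 2 * R * shadow u A" using 1[of 0] by (simp add: shadow_eq_projection[OF A u])
  moreover have "0 < vol A" using assms(3) by (simp add: less_le)
  ultimately have "0 < R * shadow u A" by linarith
  then show ?thesis using \<open>0 < R\<close> by (simp add: zero_less_mult_iff)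
qed

section \<open>Projections measured by volume increments\<close>

lemma aff_dim_full:
  fixes A :: "'a::euclidean_space set"
  assumes "vol A \<noteq> 0"
  shows "aff_dim A = int DIM('a)"
proof (rule ccontr)
  assume "aff_dim A \<noteq> int DIM('a)"
  then have less: "aff_dim A < int DIM('a)" using aff_dim_le_DIM[of A] by simp
  have "A \<noteq> {}" using assms by auto
  then obtain a where "a \<in> A" by auto
  then have "aff_dim A = int (dim ((+) (- a) ` A))" by (intro aff_dim_eq_dim) (rule hull_inc)
  then have "negligible ((+) (- a) ` A)" using less by (intro negligible_lowdim) simp
  then have "vol ((+) (- a) ` A) = 0" by (rule negligible_imp_measure0)
  then show False using assms measure_translation[of "- a" A] by simp
qed

lemma hausdorff_projection_1:
  fixes A :: "(real^'n::finite) set"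
  assumes "convex_body A" "norm u = 1"
  shows "hausdorff (CARD('n) - 1) (orth_proj ({u}\<^sup>\<bottom>) ` A) = shadow u A"
  unfolding orth_proj_1[OF assms(2)] shadow_eq_projection[OF assms]
  using assms by (intro hausdorff_hyperplane convex_body_linear_image linear_proj1) (auto simp: proj1_orth)

lemma orthonormal_pair_CARD:
  fixes u w :: "real^'n::finite"
  assumes u: "norm u = 1" "norm w = 1" "orthogonal u w"
  shows "2 \<le> CARD('n)"
proof -
  have "u \<noteq> w" "u \<noteq> 0" "w \<noteq> 0" using u by (auto simp: orthogonal_def)
  then have "independent {u, w}"
    using u(3) by (intro pairwise_orthogonal_independent) (auto simp: pairwise_def orthogonal_commute)
  then have "card {u, w} \<le> DIM(real^'n)" using independent_card_le by blast
  then show ?thesis using \<open>u \<noteq> w\<close> by simp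
qed

text \<open>A mixed second difference of the volume. The shadow formula for \<open>w\<close> is
  applied to the cylinder of direction \<open>u\<close> over the projection of \<open>A\<close>; as
  \<open>u\<close> and \<open>w\<close> are orthogonal, projecting along one leaves the segment of
  the other unchanged.\<close>

lemma hausdorff_projection_2:
  fixes A :: "(real^'n::finite) set"
  assumes A: "convex_body A" and u: "norm u = 1" "norm w = 1" "orthogonal u w"
  shows "hausdorff (CARD('n) - 2) (orth_proj ({u, w}\<^sup>\<bottom>) ` A) = shadow u (A + seg w) - shadow u A"
proof -
  have uw: "u \<bullet> w = 0" "w \<bullet> u = 0" using u(3) by (auto simp: orthogonal_def inner_commute)
  have n: "2 \<le> CARD('n)" by (rule orthonormal_pair_CARD[OF u])
  let ?P = "proj1 u ` A"
  have P: "convex_body ?P" using A by (rule convex_body_linear_image[OF linear_proj1])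
  have p: "proj1 w u = u" "proj1 u w = w" by (simp_all add: proj1_def uw)
  have "hausdorff (CARD('n) - 2) ((proj1 w \<circ> proj1 u) ` A) = vol ((proj1 w \<circ> proj1 u) ` A + (seg u + seg w))"
  proof (rule hausdorff_codim_2[OF u])
    show "convex_body ((proj1 w \<circ> proj1 u) ` A)"
      unfolding image_comp[symmetric] by (rule convex_body_linear_image[OF linear_proj1 P])
    show "x \<bullet> w = 0" if "x \<in> (proj1 w \<circ> proj1 u) ` A" for x
      using that proj1_orth[OF u(2)] by auto
    show "x \<bullet> u = 0" if "x \<in> (proj1 w \<circ> proj1 u) ` A" for x
      using that proj1_orth[OF u(1)] by (auto simp: proj1_def[of w] inner_diff_left uw)
  qed (rule n)
  also have "(proj1 w \<circ> proj1 u) ` A + (seg u + seg w) = proj1 w ` (?P + seg u) + seg w"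
    by (simp add: image_comp linear_image_set_plus[OF linear_proj1] linear_image_seg[OF linear_proj1] p add.assoc)
  also have "vol \<dots> = shadow w (?P + seg u)"
    using P u by (intro shadow_eq_projection[symmetric] convex_body_plus) auto
  also have "\<dots> = vol (?P + seg w + seg u) - vol (?P + seg u)"
    by (simp add: shadow_def ac_simps)
  also have "?P + seg w = proj1 u ` (A + seg w)"
    by (simp add: linear_image_set_plus[OF linear_proj1] linear_image_seg[OF linear_proj1] p)
  also have "vol (proj1 u ` (A + seg w) + seg u) = shadow u (A + seg w)"
    using A u by (intro shadow_eq_projection[symmetric] convex_body_plus) auto
  also have "vol (?P + seg u) = shadow u A" using A u by (intro shadow_eq_projection[symmetric])
  finally show ?thesis by (simp add: orth_proj_2[OF u])
qed

section \<open>The chain of implications\<close>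

lemma singleton_plus_singleton: "{a} + {b} = {a + b}" by (auto simp: set_plus_def)

definition restrict_below :: "nat \<Rightarrow> (nat \<Rightarrow> real) \<Rightarrow> nat \<Rightarrow> real" where
  "restrict_below k y i = (if i < k then y i else 0)"

lemma multiaffine_nonneg:
  "(\<And>I. I \<subseteq> {..<m} \<Longrightarrow> 0 \<le> c I) \<Longrightarrow> x \<in> nonneg_orthant m \<Longrightarrow> 0 \<le> multiaffine m c x"
  unfolding multiaffine_subset_poly by (rule subset_poly_nonneg) (auto simp: nonneg_orthant_def)

lemma multiaffine_mono:
  assumes "\<And>I. I \<subseteq> {..<m} \<Longrightarrow> 0 \<le> c I" "x \<in> nonneg_orthant m" "\<And>i. i < m \<Longrightarrow> x i \<le> y i"
  shows "multiaffine m c x \<le> multiaffine m c y"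
  unfolding multiaffine_def using assms
  by (intro sum_mono mult_left_mono prod_mono) (auto simp: nonneg_orthant_def)

lemma multiaffine_cong: "(\<And>i. i < m \<Longrightarrow> x i = y i) \<Longrightarrow> multiaffine m c x = multiaffine m c y"
  unfolding multiaffine_subset_poly by (rule subset_poly_cong) auto

text \<open>The integrated form of nonpositive mixed second derivatives of the logarithm, written as
  a product so that it also makes sense where the polynomial vanishes.\<close>

definition log_submodular :: "nat \<Rightarrow> (nat set \<Rightarrow> real) \<Rightarrow> (nat \<Rightarrow> real) \<Rightarrow> (nat \<Rightarrow> real) \<Rightarrow> (nat \<Rightarrow> real) \<Rightarrow> bool" where
  "log_submodular m c x y z \<longleftrightarrow>
     multiaffine m c x * multiaffine m c (\<lambda>i. x i + y i + z i) \<le>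
     multiaffine m c (\<lambda>i. x i + y i) * multiaffine m c (\<lambda>i. x i + z i)"

lemma log_submodular_commute: "log_submodular m c x y z = log_submodular m c x z y"
  by (simp add: log_submodular_def mult.commute add.assoc add.commute add.left_commute)

text \<open>The growth factor caused by adding \<open>z\<close> decreases along consecutive steps
  \<open>y\<close> and \<open>y'\<close>. The intermediate value \<open>b\<close> can be cancelled
  unless it is 0, in which case monotonicity forces the value at \<open>x\<close> to be 0
  too.\<close>

lemma log_submodular_trans:
  assumes c: "\<And>I. I \<subseteq> {..<m} \<Longrightarrow> 0 \<le> c I"
    and orth: "x \<in> nonneg_orthant m" "y \<in> nonneg_orthant m" "y' \<in> nonneg_orthant m" "z \<in> nonneg_orthant m"
    and 1: "log_submodular m c x y z" and 2: "log_submodular m c (\<lambda>i. x i + y i) y' z"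
  shows "log_submodular m c x (\<lambda>i. y i + y' i) z"
proof -
  define p where "p = multiaffine m c"
  define a b d e f g where "a = p x" and "b = p (\<lambda>i. x i + y i)" and "d = p (\<lambda>i. x i + z i)"
    and "e = p (\<lambda>i. x i + y i + z i)" and "f = p (\<lambda>i. x i + y i + y' i)" and "g = p (\<lambda>i. x i + y i + y' i + z i)"
  have nn: "0 \<le> a" "0 \<le> b" "0 \<le> d" "0 \<le> f"
    unfolding a_def b_def d_def f_def p_def using orth
    by (auto intro!: multiaffine_nonneg c simp: nonneg_orthant_def)
  have ab: "a \<le> b"
    unfolding a_def b_def p_def using orth by (intro multiaffine_mono c) (auto simp: nonneg_orthant_def)
  have i1: "a * e \<le> b * d" and i2: "b * g \<le> f * e"
    using 1 2 by (simp_all add: log_submodular_def a_def b_def d_def e_def f_def g_def p_def)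
  have "a * g \<le> f * d"
  proof (cases "b = 0")
    case True
    then have "a = 0" using nn ab by simp
    then show ?thesis using nn by simp
  next
    case False
    have "b * (a * g) \<le> a * (f * e)" using mult_left_mono[OF i2 nn(1)] by (simp add: mult_ac)
    also have "\<dots> \<le> f * (b * d)" using mult_left_mono[OF i1 nn(4)] by (simp add: mult_ac)
    finally have "b * (a * g) \<le> b * (f * d)" by (simp add: mult_ac)
    then show ?thesis using False nn by simp
  qed
  then show ?thesis by (simp add: log_submodular_def a_def f_def d_def g_def p_def add.assoc)
qed

text \<open>The two sides differ by \<open>s * t * (hi * hj - g * k)\<close> if
  \<open>i \<noteq> j\<close>; if \<open>i = j\<close>, being affine in this variable makes the
  difference \<open>s * t * h\<^sup>2\<close>.\<close>

lemma log_submodular_elementary: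
  assumes ray: "rayleigh_inequalities m (multiaffine m c)"
    and x: "x \<in> nonneg_orthant m" and ij: "i < m" "j < m" and st: "0 \<le> s" "0 \<le> t"
  shows "log_submodular m c x ((\<lambda>_. 0)(i := s)) ((\<lambda>_. 0)(j := t))"
proof (cases "i = j")
  case True
  define R where "R = {..<m} - {i}"
  have set: "{..<m} = insert i R" "finite R" "i \<notin> R" using ij by (auto simp: R_def)
  define g h where "g = subset_poly R c x" and "h = subset_poly R (\<lambda>I. c (insert i I)) x"
  have p: "multiaffine m c y = g + y i * h" if y: "\<And>l. l \<noteq> i \<Longrightarrow> y l = x l" for y
  proof -
    have "y l = x l" if "l \<in> R" for l using that set(3) by (intro y) auto
    then have "subset_poly R c y = g" "subset_poly R (\<lambda>I. c (insert i I)) y = h"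
      unfolding g_def h_def by (auto intro!: subset_poly_cong)
    then show ?thesis unfolding multiaffine_subset_poly set(1) using set by (simp add: subset_poly_insert)
  qed
  have "0 \<le> s * t * h\<^sup>2" using st by simp
  then show ?thesis
    unfolding log_submodular_def using True by (simp add: p algebra_simps power2_eq_square)
next
  case False
  define R where "R = {..<m} - {i, j}"
  have R: "finite R" "i \<notin> R" "j \<notin> R" by (auto simp: R_def)
  have set: "{..<m} = insert j (insert i R)" using ij by (auto simp: R_def)
  define g hi hj k where "g = subset_poly R c x" and "hi = subset_poly R (\<lambda>I. c (insert i I)) x"
    and "hj = subset_poly R (\<lambda>I. c (insert j I)) x" and "k = subset_poly R (\<lambda>I. c (insert i (insert j I))) x"
  have p: "multiaffine m c y = g + y i * hi + y j * (hj + y i * k)" if y: "\<And>l. l \<noteq> i \<Longrightarrow> l \<noteq> j \<Longrightarrow> y l = x l" for y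
  proof -
    have "y l = x l" if "l \<in> R" for l using that R by (intro y) auto
    then have eq: "subset_poly R c' y = subset_poly R c' x" for c' by (intro subset_poly_cong) auto
    have "multiaffine m c y = subset_poly (insert i R) c y + y j * subset_poly (insert i R) (\<lambda>I. c (insert j I)) y"
      unfolding multiaffine_subset_poly set using R False by (intro subset_poly_insert) auto
    also have "subset_poly (insert i R) c y = g + y i * hi"
      unfolding g_def hi_def using R by (simp add: subset_poly_insert eq)
    also have "subset_poly (insert i R) (\<lambda>I. c (insert j I)) y = hj + y i * k"
      unfolding hj_def k_def using R by (simp add: subset_poly_insert eq insert_commute)
    finally show ?thesis .
  qed
  have "g * k \<le> hi * hj"
    using ray x ij False rayleigh_iff_subset_poly[OF ij False, of c x]
    unfolding rayleigh_inequalities_def g_def hi_def hj_def k_def R_def by blast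
  then have "0 \<le> s * t * (hi * hj - g * k)" using st by simp
  then show ?thesis
    unfolding log_submodular_def using False by (simp add: p algebra_simps)
qed

text \<open>Both increments are resolved into coordinate steps: \<open>one\<close> accumulates the
  coordinates of \<open>y\<close> against a single coordinate step, and \<open>two\<close>
  accumulates those of \<open>z\<close> against all of \<open>y\<close>. The base points move within
  the orthant, where the Rayleigh inequalities hold.\<close>

lemma log_submodular_rayleigh:
  assumes c: "\<And>I. I \<subseteq> {..<m} \<Longrightarrow> 0 \<le> c I"
    and ray: "rayleigh_inequalities m (multiaffine m c)"
    and orth: "x \<in> nonneg_orthant m" "y \<in> nonneg_orthant m" "z \<in> nonneg_orthant m"
  shows "log_submodular m c x y z"
proof -
  have restrict_below_Suc: "restrict_below (Suc k) y = (\<lambda>i. restrict_below k y i + ((\<lambda>_. 0)(k := y k)) i)" for k y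
    by (auto simp: restrict_below_def fun_eq_iff less_Suc_eq)
  have restrict_below_orth: "restrict_below k y \<in> nonneg_orthant m" if "y \<in> nonneg_orthant m" for k y
    using that by (auto simp: restrict_below_def nonneg_orthant_def)
  have unit_orth: "(\<lambda>_. 0)(k := t) \<in> nonneg_orthant m" if "0 \<le> t" for k t
    using that by (auto simp: nonneg_orthant_def)
  have zero: "log_submodular m c x (\<lambda>_. 0) z" for x z by (simp add: log_submodular_def mult.commute)
  have one: "log_submodular m c x (restrict_below k y) ((\<lambda>_. 0)(j := t))"
    if "x \<in> nonneg_orthant m" "y \<in> nonneg_orthant m" "k \<le> m" "j < m" "0 \<le> t" for x y k j t
    using that(3)
  proof (induction k)
    case 0
    have "restrict_below 0 y = (\<lambda>_. 0)" by (simp add: restrict_below_def fun_eq_iff)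
    then show ?case using zero by simp
  next
    case (Suc k)
    have yk: "0 \<le> y k" using that(2) Suc.prems by (simp add: nonneg_orthant_def)
    have xt: "(\<lambda>i. x i + restrict_below k y i) \<in> nonneg_orthant m"
      using that(1) restrict_below_orth[OF that(2)] by (auto simp: nonneg_orthant_def)
    show ?case
      unfolding restrict_below_Suc
    proof (rule log_submodular_trans[OF c that(1) restrict_below_orth[OF that(2)] unit_orth[OF yk] unit_orth[OF that(5)]])
      show "log_submodular m c x (restrict_below k y) ((\<lambda>_. 0)(j := t))" using Suc.prems by (intro Suc.IH) simp
      show "log_submodular m c (\<lambda>i. x i + restrict_below k y i) ((\<lambda>_. 0)(k := y k)) ((\<lambda>_. 0)(j := t))"
        using Suc.prems by (intro log_submodular_elementary[OF ray xt _ that(4) yk that(5)]) simp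
    qed
  qed
  have two: "log_submodular m c x (restrict_below k z) (restrict_below m y)" if "k \<le> m" for k
    using that
  proof (induction k)
    case 0
    have "restrict_below 0 z = (\<lambda>_. 0)" by (simp add: restrict_below_def fun_eq_iff)
    then show ?case using zero by simp
  next
    case (Suc k)
    have zk: "0 \<le> z k" using orth(3) Suc.prems by (simp add: nonneg_orthant_def)
    have xt: "(\<lambda>i. x i + restrict_below k z i) \<in> nonneg_orthant m"
      using orth(1) restrict_below_orth[OF orth(3)] by (auto simp: nonneg_orthant_def)
    have "log_submodular m c (\<lambda>i. x i + restrict_below k z i) ((\<lambda>_. 0)(k := z k)) (restrict_below m y)"
      using one[OF xt orth(2) order_refl _ zk, of k] Suc.prems log_submodular_commute by auto
    then show ?case
      unfolding restrict_below_Suc using Suc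
      by (intro log_submodular_trans[OF c orth(1) restrict_below_orth[OF orth(3)] unit_orth[OF zk] restrict_below_orth[OF orth(2)]]) auto
  qed
  have "log_submodular m c x (restrict_below m z) (restrict_below m y) = log_submodular m c x z y"
    unfolding log_submodular_def
    by (intro arg_cong2[of _ _ _ _ "(\<le>)"] arg_cong2[of _ _ _ _ "(*)"] multiaffine_cong) (auto simp: restrict_below_def)
  then show ?thesis using two[of m] log_submodular_commute by simp
qed

lemma rayleigh_imp_sum_volume:
  assumes "all_volume_polynomials_rayleigh TYPE('n::finite) m"
  shows "sum_volume_inequality TYPE('n) m"
  unfolding sum_volume_inequality_def
proof (intro allI impI)
  fix v :: "nat \<Rightarrow> real^'n" and A B C
  assume "zonotope m v A" "zonotope m v B" "zonotope m v C"
  then obtain a x b y t z where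
    A: "A = {a} + segment_sum m v x" "x \<in> nonneg_orthant m" and
    B: "B = {b} + segment_sum m v y" "y \<in> nonneg_orthant m" and
    C: "C = {t} + segment_sum m v z" "z \<in> nonneg_orthant m"
    unfolding zonotope_def by metis
  have orth: "(\<lambda>i. x i + y i) \<in> nonneg_orthant m" "(\<lambda>i. x i + z i) \<in> nonneg_orthant m"
    "(\<lambda>i. x i + y i + z i) \<in> nonneg_orthant m"
    using A B C by (auto simp: nonneg_orthant_def)
  have AB: "A + B = {a + b} + segment_sum m v (\<lambda>i. x i + y i)"
    unfolding A(1) B(1) segment_sum_plus[OF A(2) B(2), symmetric]
    by (simp add: add.assoc add.left_commute singleton_plus_singleton[symmetric])
  have AC: "A + C = {a + t} + segment_sum m v (\<lambda>i. x i + z i)"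
    unfolding A(1) C(1) segment_sum_plus[OF A(2) C(2), symmetric]
    by (simp add: add.assoc add.left_commute singleton_plus_singleton[symmetric])
  have ABC: "A + B + C = {a + b + t} + segment_sum m v (\<lambda>i. x i + y i + z i)"
    unfolding AB C(1) segment_sum_plus[OF orth(1) C(2), symmetric]
    by (simp add: add.assoc add.left_commute singleton_plus_singleton[symmetric])
  obtain c d where c: "\<forall>I\<subseteq>{..<m}. 0 \<le> c I"
    and f: "\<forall>x\<in>nonneg_orthant m. vol (segment_sum m v x) = multiaffine m c x"
    and ray: "rayleigh_inequalities m (multiaffine m c)"
    using assms unfolding all_volume_polynomials_rayleigh_def rayleigh_polynomial_def by blast
  have "log_submodular m c x y z" using c by (intro log_submodular_rayleigh ray A B C) auto
  moreover have "vol A = multiaffine m c x" using f A(2) by (simp add: A(1))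
  moreover have "vol (A + B) = multiaffine m c (\<lambda>i. x i + y i)"
    unfolding AB vol_translate using f orth(1) by blast
  moreover have "vol (A + C) = multiaffine m c (\<lambda>i. x i + z i)"
    unfolding AC vol_translate using f orth(2) by blast
  moreover have "vol (A + B + C) = multiaffine m c (\<lambda>i. x i + y i + z i)"
    unfolding ABC vol_translate using f orth(3) by blast
  ultimately show "vol A * vol (A + B + C) \<le> vol (A + B) * vol (A + C)"
    by (simp only: log_submodular_def)
qed

section \<open>Segments as additional summands\<close>

lemma zonotope_mono:
  assumes "zonotope k v A" "k \<le> l" "\<And>i. i < k \<Longrightarrow> v' i = v i"
  shows "zonotope l v' A"
proof -
  obtain t x where A: "A = {t} + segment_sum k v x" "x \<in> nonneg_orthant k"
    using assms(1) unfolding zonotope_def by blast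
  have "segment_sum l v' (restrict_below k x) = segment_sum k v x"
    unfolding segment_sum_alt using assms(2,3)
    by (intro sum.mono_neutral_cong_right) (auto simp: restrict_below_def set_zero)
  moreover have "restrict_below k x \<in> nonneg_orthant l" using A(2) by (auto simp: restrict_below_def nonneg_orthant_def)
  ultimately show ?thesis unfolding zonotope_def A(1) by metis
qed

lemma zonotope_seg:
  assumes "i < k"
  shows "zonotope k v (seg (v i))"
proof -
  have "segment_sum k v (indicator {i}) = seg (v i)"
    using assms by (subst segment_sum_indicator) auto
  moreover have "indicator {i} \<in> nonneg_orthant k" by (simp add: nonneg_orthant_def)
  moreover have "seg (v i) = {0} + seg (v i)" by simp
  ultimately show ?thesis unfolding zonotope_def by metis
qed

lemma zonotope_plus:
  assumes "zonotope k v A" "zonotope k v B"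
  shows "zonotope k v (A + B)"
proof -
  obtain a x b y where A: "A = {a} + segment_sum k v x" "x \<in> nonneg_orthant k"
    and B: "B = {b} + segment_sum k v y" "y \<in> nonneg_orthant k"
    using assms unfolding zonotope_def by metis
  have "A + B = {a + b} + segment_sum k v (\<lambda>i. x i + y i)"
    unfolding A(1) B(1) segment_sum_plus[OF A(2) B(2), symmetric]
    by (simp add: add.assoc add.left_commute singleton_plus_singleton[symmetric])
  moreover have "(\<lambda>i. x i + y i) \<in> nonneg_orthant k" using A B by (auto simp: nonneg_orthant_def)
  ultimately show ?thesis unfolding zonotope_def by metis
qed

lemma vol_plus_seg_shadow: "vol (A + seg u) = vol A + shadow u A"
  by (simp add: shadow_def)

text \<open>The projection of \<open>A + B\<close> contains a translate of the projection of
  \<open>A\<close>.\<close>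

lemma shadow_mono:
  assumes "convex_body A" "convex_body B" "norm u = 1"
  shows "shadow u A \<le> shadow u (A + B)"
proof -
  obtain b where b: "b \<in> B" using assms(2) by (auto simp: convex_body_def)
  have "{proj1 u b} + (proj1 u ` A + seg u) \<subseteq> proj1 u ` (A + B) + seg u"
    using b unfolding linear_image_set_plus[OF linear_proj1]
    by (metis (no_types, lifting) add.assoc add.commute imageI order_refl set_plus_mono2 singletonD subsetI)
  moreover have "convex_body ({proj1 u b} + (proj1 u ` A + seg u))" "convex_body (proj1 u ` (A + B) + seg u)"
    using assms by (auto intro!: convex_body_plus convex_body_linear_image linear_proj1)
  ultimately have "vol ({proj1 u b} + (proj1 u ` A + seg u)) \<le> vol (proj1 u ` (A + B) + seg u)"
    by (rule vol_mono)
  then show ?thesis using assms by (simp add: shadow_eq_projection convex_body_plus)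
qed

text \<open>Assertion 2 with \<open>C = [0, u]\<close>, where \<open>u\<close> occupies the one
  additional place among the \<open>m\<close> vectors. After every \<open>|X + [0, u]|\<close> is
  written as volume plus shadow, the products of the two volumes cancel.\<close>

lemma sum_volume_imp_projection_ratio:
  assumes "sum_volume_inequality TYPE('n::finite) m" "1 \<le> m"
  shows "projection_ratio_inequality TYPE('n) m"
  unfolding projection_ratio_inequality_def
proof (intro allI impI)
  fix v :: "nat \<Rightarrow> real^'n" and A B and u :: "real^'n"
  assume z: "zonotope (m - 1) v A" "zonotope (m - 1) v B" and u: "norm u = 1"
  have cb: "convex_body A" "convex_body B" "convex_body (A + B)" using z by (auto intro: convex_body_zonotope convex_body_plus)
  define v' where "v' = v(m - 1 := u)"
  have "zonotope m v' A" "zonotope m v' B" using z by (auto intro: zonotope_mono simp: v'_def)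
  moreover have "zonotope m v' (seg u)" using zonotope_seg[of "m - 1" m v'] assms(2) by (simp add: v'_def)
  ultimately have "vol A * vol (A + B + seg u) \<le> vol (A + B) * vol (A + seg u)"
    using assms(1) unfolding sum_volume_inequality_def by blast
  then have le: "vol A * shadow u (A + B) \<le> vol (A + B) * shadow u A"
    unfolding vol_plus_seg_shadow[of "A + B"] vol_plus_seg_shadow[of A] by (simp add: algebra_simps)
  have mono: "shadow u A \<le> shadow u (A + B)" by (rule shadow_mono[OF cb(1,2) u])
  show "vol A / hausdorff (CARD('n) - 1) (orth_proj ({u}\<^sup>\<bottom>) ` A)
      \<le> vol (A + B) / hausdorff (CARD('n) - 1) (orth_proj ({u}\<^sup>\<bottom>) ` (A + B))"
    unfolding hausdorff_projection_1[OF cb(1) u] hausdorff_projection_1[OF cb(3) u]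
  proof (cases "shadow u A = 0")
    case False
    then have "0 < shadow u A" using shadow_nonneg[OF cb(1), of u] by simp
    then show "vol A / shadow u A \<le> vol (A + B) / shadow u (A + B)"
      using le mono by (simp add: divide_le_eq le_divide_eq)
  next
    \<comment> \<open>The left quotient is then 0 by the convention for division by 0.\<close>
    case True
    then show "vol A / shadow u A \<le> vol (A + B) / shadow u (A + B)"
      using shadow_nonneg[OF cb(3), of u] by simp
  qed
qed

text \<open>Assertion 3 with \<open>B = [0, w]\<close>, where \<open>w\<close> occupies the
  additional place. Clearing denominators leaves the increment of the shadow under adding
  \<open>w\<close>, which is the projection of codimension two. If \<open>A\<close> has volume 0,
  the left side vanishes; otherwise \<open>A\<close> is full-dimensional.\<close>

lemma projection_ratio_imp_two_projections:
  assumes "projection_ratio_inequality TYPE('n::finite) m" "CARD('n) \<le> m"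
  shows "two_projections_inequality TYPE('n) m"
  unfolding two_projections_inequality_def
proof (intro allI impI)
  fix v :: "nat \<Rightarrow> real^'n" and A and u w :: "real^'n"
  assume z: "zonotope (m - 2) v A" and u: "norm u = 1" "norm w = 1" "orthogonal u w"
  have A: "convex_body A" and Aw: "convex_body (A + seg w)" using z by (auto intro: convex_body_zonotope convex_body_plus)
  have n: "2 \<le> CARD('n)" by (rule orthonormal_pair_CARD[OF u])
  define v' where "v' = v(m - 2 := w)"
  have "zonotope (m - 1) v' A" using z by (auto intro: zonotope_mono simp: v'_def)
  moreover have "zonotope (m - 1) v' (seg w)"
    using zonotope_seg[of "m - 2" "m - 1" v'] assms(2) n by (simp add: v'_def)
  ultimately have ratio: "vol A / shadow u A \<le> vol (A + seg w) / shadow u (A + seg w)" if "aff_dim A = int CARD('n)"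
    using assms(1) u that unfolding projection_ratio_inequality_def
    using hausdorff_projection_1[OF A u(1)] hausdorff_projection_1[OF Aw u(1)] by metis
  show "vol A * hausdorff (CARD('n) - 2) (orth_proj ({u, w}\<^sup>\<bottom>) ` A)
      \<le> hausdorff (CARD('n) - 1) (orth_proj ({u}\<^sup>\<bottom>) ` A) * hausdorff (CARD('n) - 1) (orth_proj ({w}\<^sup>\<bottom>) ` A)"
    unfolding hausdorff_projection_1[OF A u(1)] hausdorff_projection_1[OF A u(2)] hausdorff_projection_2[OF A u]
  proof (cases "vol A = 0")
    case True
    then show "vol A * (shadow u (A + seg w) - shadow u A) \<le> shadow u A * shadow w A"
      using shadow_nonneg[OF A] by simp
  next
    case False
    then have "aff_dim A = int CARD('n)" using aff_dim_full[of A] by simp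
    note ratio = ratio[OF this]
    have "0 < vol A" using False by (simp add: less_le)
    have "0 < shadow u A" using shadow_pos[OF A u(1)] False by simp
    then have "0 < shadow u (A + seg w)" using shadow_mono[OF A convex_body_seg u(1), of w] by linarith
    then have "vol A * shadow u (A + seg w) \<le> (vol A + shadow w A) * shadow u A"
      using ratio \<open>0 < shadow u A\<close> by (simp add: vol_plus_seg_shadow field_simps)
    then show "vol A * (shadow u (A + seg w) - shadow u A) \<le> shadow u A * shadow w A"
      by (simp add: algebra_simps)
  qed
qed

section \<open>The counterexample\<close>

text \<open>Laplace expansion along the rows \<open>a\<close> and \<open>b\<close>: six products of
  complementary two-by-two minors, which are shorter to evaluate than 24 permutations.\<close>

lemma det_axis_columns_4:
  fixes w :: "'n::finite \<Rightarrow> real^'n"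
  assumes "distinct [a, b, c, d]" "\<And>k. k \<notin> {a, b, c, d} \<Longrightarrow> w k = axis k 1"
  defines "m2 \<equiv> \<lambda>i j p q. w i $ p * w j $ q - w j $ p * w i $ q"
  shows "det (\<chi> r k. w k $ r) =
    m2 a b a b * m2 c d c d - m2 a c a b * m2 b d c d + m2 a d a b * m2 b c c d +
    m2 b c a b * m2 a d c d - m2 b d a b * m2 a c c d + m2 c d a b * m2 a b c d"
proof -
  have ne: "a \<noteq> b" "b \<noteq> a" "a \<noteq> c" "c \<noteq> a" "b \<noteq> c" "c \<noteq> b"
    "a \<noteq> d" "d \<noteq> a" "b \<noteq> d" "d \<noteq> b" "c \<noteq> d" "d \<noteq> c" using assms(1) by auto
  have f: "finite {b, c, d}" "a \<notin> {b, c, d}" "finite {c, d}" "b \<notin> {c, d}" "finite {d}" "c \<notin> {d}" using assms by auto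
  show ?thesis
    apply (subst det_axis_columns[of "{a,b,c,d}" w], use assms in force)
    unfolding sum_over_permutations_insert[OF f(1,2)] sum_over_permutations_insert[OF f(3,4)]
      sum_over_permutations_insert[OF f(5,6)] permutes_sing m2_def
    using ne
    by (simp add: sign_swap_id permutation_swap_id permutation_compose sign_compose sign_id Transposition.transpose_def)
      (simp add: algebra_simps)
qed


text \<open>Pascal's recursion, which evaluates sums over the subsets of an explicitly listed
  set.\<close>

lemma subset_sum_insert:
  assumes "finite A" "a \<notin> A"
  shows "subset_sum (Suc k) (insert a A) F = subset_sum (Suc k) A F + subset_sum k A (\<lambda>J. F (insert a J))"
proof -
  have fin: "finite {I. I \<subseteq> A \<and> P I}" for P
    by (rule rev_finite_subset[OF finite_Collect_subsets[OF assms(1)]]) auto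
  have nin: "a \<notin> J" "finite J" if "J \<subseteq> A" for J using that assms finite_subset[OF that assms(1)] by auto
  have "{I. I \<subseteq> insert a A \<and> card I = Suc k} =
      {I. I \<subseteq> A \<and> card I = Suc k} \<union> insert a ` {J. J \<subseteq> A \<and> card J = k}" (is "?L = ?M \<union> ?N")
  proof (intro set_eqI iffI)
    fix I assume I: "I \<in> ?L"
    show "I \<in> ?M \<union> ?N"
    proof (cases "a \<in> I")
      case True
      have "I - {a} \<subseteq> A" using I by auto
      moreover have "card (I - {a}) = k" using I True by simp
      moreover have "I = insert a (I - {a})" using True by blast
      ultimately show ?thesis by blast
    qed (use I in auto)
  next
    fix I assume "I \<in> ?M \<union> ?N"
    then show "I \<in> ?L" using nin by auto
  qed
  moreover have "inj_on (insert a) {J. J \<subseteq> A \<and> card J = k}"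
    using nin(1) by (intro inj_onI) (metis (no_types, lifting) insert_ident mem_Collect_eq)
  moreover have "?M \<inter> ?N = {}" using nin(1) by auto
  ultimately show ?thesis
    unfolding subset_sum_def using fin by (simp add: sum.union_disjoint sum.reindex)
qed

lemma subset_sum_Suc_empty: "subset_sum (Suc k) {} F = 0"
proof -
  have "{I :: nat set. I \<subseteq> {} \<and> card I = Suc k} = {}" by auto
  then show ?thesis by (simp only: subset_sum_def sum.empty)
qed

text \<open>The unit cube in the directions outside \<open>J\<close>. Adding it to sets in the span
  of the axes in \<open>J\<close> turns their volume in dimension \<open>card J\<close> into volume
  in the whole space.\<close>

definition axes_sum :: "'n set \<Rightarrow> (real^'n::finite) set" where
  "axes_sum J = (\<Sum>k\<in>-J. seg (axis k 1))"

lemma convex_body_axes_sum [simp]: "convex_body (axes_sum J)"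
  unfolding axes_sum_def by (rule convex_body_sum) auto

definition minor4 :: "(nat \<Rightarrow> real) \<Rightarrow> (nat \<Rightarrow> real) \<Rightarrow> (nat \<Rightarrow> real) \<Rightarrow> (nat \<Rightarrow> real) \<Rightarrow> nat \<Rightarrow> nat \<Rightarrow> nat \<Rightarrow> nat \<Rightarrow> real" where
  "minor4 p q r s i j k l =
    (p i * q j - p j * q i) * (r k * s l - r l * s k) - (p i * q k - p k * q i) * (r j * s l - r l * s j) +
    (p i * q l - p l * q i) * (r j * s k - r k * s j) + (p j * q k - p k * q j) * (r i * s l - r l * s i) -
    (p j * q l - p l * q j) * (r i * s k - r k * s i) + (p k * q l - p l * q k) * (r i * s j - r j * s i)"

lemma vol_axes_sum_plus:
  fixes V :: "nat \<Rightarrow> real^'n::finite"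
  assumes abcd: "distinct [a, b, c, d]" and ijkl: "distinct [i, j, k, l]"
  shows "vol (axes_sum {a, b, c, d} + (\<Sum>x\<in>{i, j, k, l}. seg (V x))) =
    \<bar>minor4 (\<lambda>x. V x $ a) (\<lambda>x. V x $ b) (\<lambda>x. V x $ c) (\<lambda>x. V x $ d) i j k l\<bar>"
proof -
  define w where "w = (\<lambda>k. axis k 1)(a := V i, b := V j, c := V k, d := V l)"
  have w: "w a = V i" "w b = V j" "w c = V k" "w d = V l" using abcd by (auto simp: w_def)
  have "(\<Sum>k\<in>UNIV. seg (w k)) = (\<Sum>k\<in>UNIV - {a, b, c, d}. seg (w k)) + (\<Sum>k\<in>{a, b, c, d}. seg (w k))"
    by (rule sum.subset_diff) auto
  also have "(\<Sum>k\<in>UNIV - {a, b, c, d}. seg (w k)) = axes_sum {a, b, c, d}"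
    unfolding axes_sum_def by (intro sum.cong) (auto simp: w_def)
  also have "(\<Sum>k\<in>{a, b, c, d}. seg (w k)) = (\<Sum>x\<in>{i, j, k, l}. seg (V x))"
    using abcd ijkl by (simp add: w)
  finally have "vol (axes_sum {a, b, c, d} + (\<Sum>x\<in>{i, j, k, l}. seg (V x))) = \<bar>det (\<chi> r k. w k $ r)\<bar>"
    using vol_parallelepiped[of w] by simp
  also have "det (\<chi> r k. w k $ r) = minor4 (\<lambda>x. V x $ a) (\<lambda>x. V x $ b) (\<lambda>x. V x $ c) (\<lambda>x. V x $ d) i j k l"
  proof -
    have ax: "\<And>k. k \<notin> {a, b, c, d} \<Longrightarrow> w k = axis k 1" by (simp add: w_def)
    show ?thesis using det_axis_columns_4[where w = w, OF abcd ax] unfolding w minor4_def .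
  qed
  finally show ?thesis .
qed

text \<open>The stretching by 2 in the directions \<open>J\<close> fixes the complementary unit cube.\<close>
lemma vol_axes_sum_homogeneous:
  fixes V :: "nat \<Rightarrow> real^'n::finite"
  assumes V: "\<And>i k. k \<notin> J \<Longrightarrow> V i $ k = 0"
  shows "vol (axes_sum J + segment_sum m V (\<lambda>i. 2 * x i)) = 2 ^ card J * vol (axes_sum J + segment_sum m V x)"
proof -
  define s where "s k = (if k \<in> J then 2 else 1 :: real)" for k
  define L where "L x = (\<chi> k. s k * x $ k)" for x :: "real^'n"
  have lin: "linear L" by (rule linearI) (simp_all add: L_def vec_eq_iff algebra_simps)
  have Lx: "L (axis k 1) = axis k 1" if "k \<notin> J" for k
    using that by (simp add: L_def vec_eq_iff axis_def s_def)
  have LV: "L (V i) = 2 *\<^sub>R V i" for i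
    using V by (simp add: L_def vec_eq_iff s_def)
  have "L ` axes_sum J = axes_sum J"
    unfolding axes_sum_def linear_image_sum[OF lin finite] linear_image_seg[OF lin]
    by (intro sum.cong) (auto simp: Lx)
  moreover have "L ` segment_sum m V x = segment_sum m V (\<lambda>i. 2 * x i)"
    by (simp add: linear_image_segment_sum[OF lin] LV) (simp add: segment_sum_alt mult.commute)
  ultimately have "vol (axes_sum J + segment_sum m V (\<lambda>i. 2 * x i)) = vol (L ` (axes_sum J + segment_sum m V x))"
    by (simp add: linear_image_set_plus[OF lin])
  also have "\<dots> = \<bar>prod s UNIV\<bar> * vol (axes_sum J + segment_sum m V x)"
    unfolding L_def[abs_def] by (intro measure_stretch convex_body_lmeasurable convex_body_plus) auto
  also have "prod s UNIV = 2 ^ card J"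
    by (simp add: s_def prod.If_cases)
  finally show ?thesis by simp
qed

text \<open>The volume polynomial with the cube as fixed body, evaluated at the indicator of
  \<open>M\<close>; its degree is \<open>card J\<close>, as the cube fills the other
  directions.\<close>

lemma vol_axes_sum_subset_sum:
  fixes V :: "nat \<Rightarrow> real^'n::finite"
  assumes V: "\<And>i k. k \<notin> J \<Longrightarrow> V i $ k = 0" and M: "M \<subseteq> {..<m}"
  shows "vol (axes_sum J + (\<Sum>i\<in>M. seg (V i))) =
    subset_sum (card J) M (\<lambda>I. vol (axes_sum J + (\<Sum>i\<in>I. seg (V i))))"
proof -
  let ?c = "\<lambda>I. if card I = card J then vol (axes_sum J + segment_sum m V (indicator I)) else 0"
  have fM: "finite M" using M by (rule finite_subset) simp
  have "vol (axes_sum J + (\<Sum>i\<in>M. seg (V i))) = vol (axes_sum J + segment_sum m V (indicator M))"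
    using M by (simp add: segment_sum_indicator)
  also have "\<dots> = subset_poly {..<m} ?c (indicator M)"
    by (intro vol_plus_segment_sum_subset_poly vol_axes_sum_homogeneous V) (auto simp: nonneg_orthant_def)
  also have "\<dots> = (\<Sum>I\<in>Pow M. ?c I)"
    unfolding subset_poly_def
  proof (rule sum.mono_neutral_cong_right)
    show "\<forall>I\<in>Pow {..<m} - Pow M. ?c I * (\<Prod>i\<in>I. indicator M i) = 0"
    proof
      fix I assume I: "I \<in> Pow {..<m} - Pow M"
      then obtain i where "i \<in> I" "i \<notin> M" by blast
      moreover have "finite I" using I finite_subset[of I "{..<m}"] by simp
      ultimately have "(\<Prod>i\<in>I. indicator M i :: real) = 0" by (intro prod_zero bexI[of _ i]) auto
      then show "?c I * (\<Prod>i\<in>I. indicator M i) = 0" by simp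
    qed
    show "?c I * (\<Prod>i\<in>I. indicator M i) = ?c I" if "I \<in> Pow M" for I
    proof -
      have "(\<Prod>i\<in>I. indicator M i :: real) = 1" using that by (intro prod.neutral) auto
      then show ?thesis by simp
    qed
  qed (use M in auto)
  also have "\<dots> = subset_sum (card J) M (\<lambda>I. vol (axes_sum J + (\<Sum>i\<in>I. seg (V i))))"
    unfolding subset_sum_def using fM M
    by (intro sum.mono_neutral_cong_right) (auto simp: segment_sum_indicator)
  finally show ?thesis .
qed

text \<open>The counterexample, found by computer search: in the notation \<open>f = g + x\<^sub>6 h\<^sub>6 + x\<^sub>7 h\<^sub>7 + x\<^sub>6 x\<^sub>7 k\<close>
  for the volume polynomial of the eight columns at \<open>x\<^sub>0 = \<dots> = x\<^sub>5 = 1\<close>, it has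
  \<open>g = k = 14\<close>, \<open>h\<^sub>6 = 16\<close>, \<open>h\<^sub>7 = 12\<close>, so that \<open>g k = 196 > 192 = h\<^sub>6 h\<^sub>7\<close>.\<close>

definition cex_a :: "nat \<Rightarrow> real" where "cex_a i = [1, 1, 1, 1, 1, 1, 1, 0] ! i"
definition cex_b :: "nat \<Rightarrow> real" where "cex_b i = [1, 1, -1, 0, 0, 0, 0, 1] ! i"
definition cex_c :: "nat \<Rightarrow> real" where "cex_c i = [1, 1, 0, 1, 1, 0, 0, 0] ! i"
definition cex_d :: "nat \<Rightarrow> real" where "cex_d i = [0, -1, 1, 0, 1, 1, 0, 0] ! i"

lemma set_06: "{..<6::nat} = {0, 1, 2, 3, 4, 5}" by auto

definition cex_minor :: "nat \<Rightarrow> nat \<Rightarrow> nat \<Rightarrow> nat \<Rightarrow> real" where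
  "cex_minor i j k l = \<bar>minor4 cex_a cex_b cex_c cex_d i j k l\<bar>"

lemma cex_minor_values:
  assumes F: "\<And>i j k l. distinct [i, j, k, l] \<Longrightarrow> F {i, j, k, l} = cex_minor i j k l"
  shows "subset_sum 4 {..<6} F = 14"
    "subset_sum 3 {..<6} (\<lambda>I. F (insert 6 I)) * subset_sum 3 {..<6} (\<lambda>I. F (insert 7 I)) = 192"
    "subset_sum 2 {..<6} (\<lambda>I. F (insert 6 (insert 7 I))) = 14"
proof -
  have sym: "subset_sum 2 A H = subset_sum (Suc (Suc 0)) A H" "subset_sum 3 A H = subset_sum (Suc (Suc (Suc 0))) A H"
    "subset_sum 4 A H = subset_sum (Suc (Suc (Suc (Suc 0)))) A H" for A H
    by (simp_all add: numeral_eq_Suc)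
  show "subset_sum 4 {..<6} F = 14"
    unfolding set_06 sym
    by (simp add: subset_sum_insert subset_sum_Suc_empty subset_sum_0 F)
      (simp add: cex_minor_def minor4_def cex_a_def cex_b_def cex_c_def cex_d_def)
  have "subset_sum 3 {..<6} (\<lambda>I. F (insert 6 I)) = 16"
    unfolding set_06 sym
    by (simp add: subset_sum_insert subset_sum_Suc_empty subset_sum_0 F)
      (simp add: cex_minor_def minor4_def cex_a_def cex_b_def cex_c_def cex_d_def)
  moreover have "subset_sum 3 {..<6} (\<lambda>I. F (insert 7 I)) = 12"
    unfolding set_06 sym
    by (simp add: subset_sum_insert subset_sum_Suc_empty subset_sum_0 F)
      (simp add: cex_minor_def minor4_def cex_a_def cex_b_def cex_c_def cex_d_def)
  ultimately show "subset_sum 3 {..<6} (\<lambda>I. F (insert 6 I)) * subset_sum 3 {..<6} (\<lambda>I. F (insert 7 I)) = 192" by simp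
  show "subset_sum 2 {..<6} (\<lambda>I. F (insert 6 (insert 7 I))) = 14"
    unfolding set_06 sym
    by (simp add: subset_sum_insert subset_sum_Suc_empty subset_sum_0 F)
      (simp add: cex_minor_def minor4_def cex_a_def cex_b_def cex_c_def cex_d_def)
qed

lemma zonotope_sum_seg:
  assumes "finite I" "\<And>i. i \<in> I \<Longrightarrow> f i \<in> v ` {..<k}"
  shows "zonotope k v (\<Sum>i\<in>I. seg (f i))"
  using assms
proof (induction I rule: finite_induct)
  case empty
  have "segment_sum k v (\<lambda>_. 0) = 0" unfolding segment_sum_alt by (intro sum.neutral) (simp add: set_zero)
  moreover have "(\<lambda>_. 0) \<in> nonneg_orthant k" by (simp add: nonneg_orthant_def)
  moreover have "(\<Sum>i\<in>{}. seg (f i)) = {0} + 0" by (simp add: set_zero)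
  ultimately show ?case unfolding zonotope_def by metis
next
  case (insert a I)
  obtain j where "j < k" "f a = v j" using insert.prems[of a] by auto
  then have "zonotope k v (seg (f a))" using zonotope_seg by metis
  then have "zonotope k v (seg (f a) + (\<Sum>i\<in>I. seg (f i)))"
    using insert by (intro zonotope_plus) auto
  then show ?case using insert.hyps by simp
qed

text \<open>For \<open>A\<close> the cube plus the first six segments, the volume, the two shadows
  and their mixed difference are \<open>g\<close>, \<open>h6\<close>, \<open>h7\<close> and
  \<open>k\<close>, so assertion 4 would give \<open>g * k \<le> h6 * h7\<close>.\<close>

lemma not_two_projections_inequality:
  assumes n: "4 \<le> CARD('n::finite)" and m: "CARD('n) + 4 \<le> m"
  shows "\<not> two_projections_inequality TYPE('n) m"
proof
  assume two: "two_projections_inequality TYPE('n) m"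
  obtain J :: "'n set" where J: "card J = 4" using obtain_subset_with_card_n[OF n] by metis
  have "finite J" by simp
  then obtain xs where "set xs = J" "distinct xs" "length xs = 4"
    using finite_distinct_list[of J] J distinct_card by metis
  then obtain a b c d where abcd: "distinct [a, b, c, d]" "J = {a, b, c, d}"
    by (auto simp: numeral_eq_Suc length_Suc_conv)
  define V where "V i = cex_a i *\<^sub>R axis a 1 + cex_b i *\<^sub>R axis b 1 + cex_c i *\<^sub>R axis c 1 + cex_d i *\<^sub>R axis d (1 :: real)" for i
  have V: "V i $ a = cex_a i" "V i $ b = cex_b i" "V i $ c = cex_c i" "V i $ d = cex_d i" for i
    using abcd(1) by (auto simp: V_def axis_def)
  have V0: "V i $ k = 0" if "k \<notin> J" for i k using that abcd by (auto simp: V_def axis_def)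
  define u w where "u = (axis a 1 :: real^'n)" and "w = (axis b 1 :: real^'n)"
  \<comment> \<open>The last two columns are unit vectors of different axes: they supply the two
    directions of projection and are not among the generators of \<open>A\<close>.\<close>
  have Vu: "V 6 = u" "V 7 = w"
    by (simp_all add: V_def u_def w_def cex_a_def cex_b_def cex_c_def cex_d_def)
  have u: "norm u = 1" "norm w = 1" "orthogonal u w"
    using abcd(1) by (auto simp: u_def w_def orthogonal_def inner_axis_axis)
  define F where "F I = vol (axes_sum J + (\<Sum>i\<in>I. seg (V i)))" for I
  have F4: "F {i, j, k, l} = cex_minor i j k l" if "distinct [i, j, k, l]" for i j k l
    unfolding F_def abcd(2) vol_axes_sum_plus[OF abcd(1) that] V cex_minor_def ..
  have Fsym: "F M = subset_sum 4 M F" if "M \<subseteq> {..<8}" for M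
    using vol_axes_sum_subset_sum[of J V M 8, OF V0 that] J by (simp add: F_def[abs_def])
  define g h6 h7 k where "g = subset_sum 4 {..<6} F" and "h6 = subset_sum 3 {..<6} (\<lambda>I. F (insert 6 I))"
    and "h7 = subset_sum 3 {..<6} (\<lambda>I. F (insert 7 I))" and "k = subset_sum 2 {..<6} (\<lambda>I. F (insert 6 (insert 7 I)))"
  have S: "subset_sum 4 (insert a M) H = subset_sum 4 M H + subset_sum 3 M (\<lambda>I. H (insert a I))"
    "subset_sum 3 (insert a M) H = subset_sum 3 M H + subset_sum 2 M (\<lambda>I. H (insert a I))"
    if "finite M" "a \<notin> M" for a M H
    using subset_sum_insert[OF that, of 3 H] subset_sum_insert[OF that, of 2 H] by (simp_all add: eval_nat_numeral)
  have F6: "F {..<6} = g" by (simp add: Fsym g_def)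
  have F66: "F (insert 6 {..<6}) = g + h6" by (simp add: Fsym S g_def h6_def)
  have F67: "F (insert 7 {..<6}) = g + h7" by (subst Fsym) (auto simp: S g_def h7_def)
  have F667: "F (insert 6 (insert 7 {..<6})) = g + h7 + h6 + k"
    by (subst Fsym) (auto simp: S g_def h6_def h7_def k_def)
  define A where "A = axes_sum J + (\<Sum>i<6. seg (V i))"
  have cA: "convex_body A" unfolding A_def by (intro convex_body_plus convex_body_sum) auto
  have vA: "vol A = g" using F6 by (simp add: A_def F_def)
  have vAu: "vol (A + seg u) = g + h6" using F66 by (simp add: A_def F_def Vu ac_simps)
  have vAw: "vol (A + seg w) = g + h7" using F67 by (simp add: A_def F_def Vu ac_simps)
  have vAwu: "vol (A + seg w + seg u) = g + h7 + h6 + k" using F667 by (simp add: A_def F_def Vu ac_simps)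
  obtain h where h: "bij_betw h {0..<card (- J)} (- J)" using ex_bij_betw_nat_finite[of "- J"] by auto
  \<comment> \<open>Six columns and the \<open>n - 4\<close> axes of the cube are
    \<open>n + 2\<close> generators, which fit into \<open>m - 2\<close> places because
    \<open>m - n \<ge> 4\<close>.\<close>
  define v where "v i = (if i < 6 then V i else axis (h (i - 6)) 1)" for i
  have cardJ: "card (- J) = CARD('n) - 4" using J by (simp add: Compl_eq_Diff_UNIV card_Diff_subset)
  have "zonotope (m - 2) v (axes_sum J)"
    unfolding axes_sum_def
  proof (rule zonotope_sum_seg)
    fix k assume "k \<in> - J"
    then have "k \<in> h ` {0..<card (- J)}" using bij_betw_imp_surj_on[OF h] by simp
    then obtain j where "j < card (- J)" "k = h j" by auto
    then have "axis k 1 = v (6 + j)" "6 + j < m - 2" using cardJ n m by (auto simp: v_def)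
    then show "axis k 1 \<in> v ` {..<m - 2}" by blast
  qed simp
  moreover have "zonotope (m - 2) v (\<Sum>i<6. seg (V i))"
  proof (rule zonotope_sum_seg)
    fix i :: nat assume "i \<in> {..<6}"
    then have "V i = v i" "i < m - 2" using n m by (auto simp: v_def)
    then show "V i \<in> v ` {..<m - 2}" by blast
  qed simp
  ultimately have "zonotope (m - 2) v A" unfolding A_def by (rule zonotope_plus)
  then have "vol A * (shadow u (A + seg w) - shadow u A) \<le> shadow u A * shadow w A"
    using two u hausdorff_projection_1[OF cA u(1)] hausdorff_projection_1[OF cA u(2)] hausdorff_projection_2[OF cA u]
    unfolding two_projections_inequality_def by metis
  then have "g * k \<le> h6 * h7" unfolding shadow_def vA vAu vAw vAwu by simp
  moreover have "g = 14" "k = 14" "h6 * h7 = 192"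
    unfolding g_def k_def h6_def h7_def by (rule cex_minor_values; fact F4)+
  ultimately show False by simp
qed

theorem theorem2:
  fixes m :: nat
  assumes "CARD('n::finite) \<le> m"
  shows
    "(min CARD('n) (m - CARD('n)) \<le> 3 \<longrightarrow>
        all_volume_polynomials_rayleigh TYPE('n) m \<and>
        sum_volume_inequality TYPE('n) m \<and>
        projection_ratio_inequality TYPE('n) m \<and>
        two_projections_inequality TYPE('n) m) \<and>
     (min CARD('n) (m - CARD('n)) > 3 \<longrightarrow>
        \<not> all_volume_polynomials_rayleigh TYPE('n) m \<and>
        \<not> sum_volume_inequality TYPE('n) m \<and>
        \<not> projection_ratio_inequality TYPE('n) m \<and>
        \<not> two_projections_inequality TYPE('n) m)"
proof -
  have "0 < CARD('n)" by simp
  then have "1 \<le> m" using assms by linarith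
  \<comment> \<open>Read forwards, the three implications carry assertion 1 to the others; read
    backwards, they carry the failure of assertion 4 to the others.\<close>
  note imp = rayleigh_imp_sum_volume[where 'n = 'n and m = m]
    sum_volume_imp_projection_ratio[where 'n = 'n, OF _ \<open>1 \<le> m\<close>]
    projection_ratio_imp_two_projections[where 'n = 'n, OF _ assms]
  have "all_volume_polynomials_rayleigh TYPE('n) m" if "min CARD('n) (m - CARD('n)) \<le> 3"
    using assms that by (rule all_volume_polynomials_rayleigh_low)
  moreover have "\<not> two_projections_inequality TYPE('n) m" if "min CARD('n) (m - CARD('n)) > 3"
    using that by (intro not_two_projections_inequality) auto
  ultimately show ?thesis using imp by blast
qed

end
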